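(* Let $X$ be a proper geodesic metric space and $o\in X$. Let $G$ be a group acting properly, by isometries on $X$ with a contracting element. Suppose that $G$ is not virtually cyclic. Let $\omega\in\mathbb R_+$. Let $\mu=(\mu_x)$ be the restriction to the reduced horoboundary $(\partial X,\mathfrak R)$ of a $G$-invariant, $\omega$-conformal density. The following are equivalent. 1. The action of $G$ on $X$ is divergent (and thus $\omega=\omega_G$). 2. $\mu_o$ gives positive measure to the radial limit set $\Lambda_{\rm rad}(G)$. 3. $\mu_o$ gives full measure to the radial limit set $\Lambda_{\rm rad}(G)$.
   Context: A geodesic is a path $\gamma: I\to X$ ($I\subset\mathbb R$ an interval) with $d(\gamma(t),\gamma(t'))=|t-t'|$ for all $t,t'\in I$; $X$ is geodesic if any two points are joined by a geodesic, and proper if closed balls are compact. The group $G$ is endowed with the discrete topology. Contracting elements: let $Y\subset X$ be closed. A projection of $x\in X$ on $Y$ is a point $y\in Y$ with $d(x,y)=d(x,Y)$; $\pi_Y(Z)$ is the set of all projections on $Y$ of points of $Z\subset X$. For $\alpha>0$, $Y$ is $\alpha$-contracting if for every geodesic $\gamma$ with $d(\gamma,Y)\ge\alpha$ (infimum distance) we have $\mathrm{diam}\,\pi_Y(\gamma)\le\alpha$; $Y$ is contracting if it is $\alpha$-contracting for some $\alpha>0$. An element $g\in G$ is contracting if, for $y\in X$, the orbit map $\mathbb Z\to X$, $n\mapsto g^ny$, is a quasi-isometric embedding with contracting image (this does not depend on $y$). Growth: $\omega_G=\limsup_{\ell\to\infty}\frac1\ell\ln \#\{g\in G : d(o,go)\le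 \ell\}$ is the critical exponent of the Poincaré series $\mathcal P_G(s)=\sum_{g\in G}e^{-s\,d(o,go)}$. The action of $G$ on $X$ is divergent if $\mathcal P_G(s)$ diverges at $s=\omega_G$. Horocompactification: let $C^*(X)$ be the space of continuous cocycles $c:X\times X\to\mathbb R$ (i.e. $c(x,z)=c(x,y)+c(y,z)$ for all $x,y,z\in X$), with the topology of uniform convergence on compact subsets. The map $\iota:X\to C^*(X)$, $\iota(z)=b_z$ with $b_z(x,y)=d(x,z)-d(y,z)$, is a homeomorphism onto its image, with which $X$ is identified. The horocompactification $\bar X$ is the closure of $\iota(X)$ in $C^*(X)$ (it is compact), the horoboundary is $\partial X=\bar X\setminus\iota(X)$; $\mathfrak B$ is the Borel $\sigma$-algebra of $\bar X$. $G$ acts on $\bar X$ by homeomorphisms extending its action on $X$. Two cocycles $c,c'\in\bar X$ are equivalent, $c\sim c'$, if either both lie in $\iota(X)$ and $c=c'$, or both lie in $\partial X$ and $\|c-c'\|_\infty=\sup_{x,x'\in X}|c(x,x')-c'(x,x')|<\infty$. A subset of $\bar X$ is saturated if it is a union of equivalence classes. $\mathfrak R\subset\mathfrak B$ is the $\sigma$-algebra of saturated Borel subsets; the reduced horoboundary is the measurable space $(\partial X,\mathfrak R)$ (with $\mathfrak R$ restricted to $\partial X$). Densities: a density on $(\bar X,\mathfrak B)$ is a family $\nu=(\nu_x)_{x\in X}$ of positive finite measures on $(\bar X,\mathfrak B)$ with $\nu_x\ll\nu_y$ for all $x,y\in X$, normalized so that $\nu_o$ has total mass $1$. It is $G$-invariant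 if $g_*\nu_x=\nu_{gx}$ for all $g\in G$, $x\in X$, and $\omega$-conformal if for all $x,y\in X$, $\frac{d\nu_x}{d\nu_y}(c)=e^{-\omega c(x,y)}$ for $\nu_y$-a.e. $c$. Its restriction $\mu$ to $(\partial X,\mathfrak R)$ is given by $\mu_x(B)=\nu_x(B)$ for $B\in\mathfrak R$, $B\subset\partial X$. Radial limit set: for $x,y\in X$, $r\ge0$, the shadow is $\mathcal O_x(y,r)=\{c\in\bar X : \frac12[d(x,y)+c(y,x)]\le r\}$. The set $\Lambda_{\rm rad}(G,x,r)$ consists of all $c\in\partial X$ such that for every $T\ge0$ there is $g\in G$ with $d(x,go)\ge T$ and $c\in\mathcal O_x(go,r)$. The radial limit set is $\Lambda_{\rm rad}(G)=\bigcup_{r\ge0}G\,\Lambda_{\rm rad}(G,o,r)$; it is saturated.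
   Formalization: Item 1 is stated as "the action is divergent and ω = ω_G": divergence alone does not force ω = ω_G (orbit sums for F₂ on its tree with ω > ω_G give μ = 0). "Full measure" means measure 1, the total mass of ν_o. *)

theory Defs
  imports
    "HOL-Probability.Conditional_Expectation"
    "HOL-Algebra.Group_Action"
    "HOL-Algebra.Elementary_Groups"
begin

section \<open>Geodesics and contracting sets\<close>

definition geodesic_path :: "(real \<Rightarrow> 'a::metric_space) \<Rightarrow> real set \<Rightarrow> bool" where
  "geodesic_path \<gamma> I \<longleftrightarrow>
     is_interval I \<and> (\<forall>t\<in>I. \<forall>t'\<in>I. dist (\<gamma> t) (\<gamma> t') = \<bar>t - t'\<bar>)"

definition geodesic_space :: "'a::metric_space itself \<Rightarrow> bool" where
  "geodesic_space _ \<longleftrightarrow>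
     (\<forall>x y :: 'a. \<exists>\<gamma> a b. a \<le> b \<and> geodesic_path \<gamma> {a..b} \<and> \<gamma> a = x \<and> \<gamma> b = y)"

definition proper_space :: "'a::metric_space itself \<Rightarrow> bool" where
  "proper_space _ \<longleftrightarrow> (\<forall>(x::'a) r. compact (cball x r))"

definition projection :: "'a::metric_space set \<Rightarrow> 'a set \<Rightarrow> 'a set" where
  "projection Y Z = {y \<in> Y. \<exists>x\<in>Z. dist x y = infdist x Y}"

text \<open>\<^const>\<open>diameter\<close> is only meaningful on bounded sets, hence the separate
  boundedness requirement.\<close>

definition alpha_contracting :: "real \<Rightarrow> 'a::metric_space set \<Rightarrow> bool" where
  "alpha_contracting \<alpha> Y \<longleftrightarrow>
     (\<forall>\<gamma> I. geodesic_path \<gamma> I \<and> setdist (\<gamma> ` I) Y \<ge> \<alpha> \<longrightarrow>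
        bounded (projection Y (\<gamma> ` I)) \<and> diameter (projection Y (\<gamma> ` I)) \<le> \<alpha>)"

definition contracting_set :: "'a::metric_space set \<Rightarrow> bool" where
  "contracting_set Y \<longleftrightarrow> closed Y \<and> (\<exists>\<alpha>>0. alpha_contracting \<alpha> Y)"

section \<open>Groups and actions\<close>

definition virtually_cyclic :: "('g, 'm) monoid_scheme \<Rightarrow> bool" where
  "virtually_cyclic G \<longleftrightarrow>
     (\<exists>H. subgroup H G \<and> finite (rcosets\<^bsub>G\<^esub> H) \<and> cyclic_group (G\<lparr>carrier := H\<rparr>))"

definition isometric_action ::
  "('g, 'm) monoid_scheme \<Rightarrow> ('g \<Rightarrow> 'a::metric_space \<Rightarrow> 'a) \<Rightarrow> bool" where
  "isometric_action G \<phi> \<longleftrightarrow>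
     group_action G UNIV \<phi> \<and> (\<forall>g\<in>carrier G. \<forall>x y. dist (\<phi> g x) (\<phi> g y) = dist x y)"

text \<open>Properness of an action of a discrete group.\<close>

definition proper_action ::
  "('g, 'm) monoid_scheme \<Rightarrow> ('g \<Rightarrow> 'a::metric_space \<Rightarrow> 'a) \<Rightarrow> bool" where
  "proper_action G \<phi> \<longleftrightarrow>
     (\<forall>K. compact K \<longrightarrow> finite {g \<in> carrier G. \<phi> g ` K \<inter> K \<noteq> {}})"

definition qi_embedding_int :: "(int \<Rightarrow> 'a::metric_space) \<Rightarrow> bool" where
  "qi_embedding_int f \<longleftrightarrow>
     (\<exists>L\<ge>1. \<exists>C\<ge>0. \<forall>m n.
        real_of_int \<bar>m - n\<bar> / L - C \<le> dist (f m) (f n) \<and>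
        dist (f m) (f n) \<le> L * real_of_int \<bar>m - n\<bar> + C)"

text \<open>The property of the orbit map below does not depend on \<open>y\<close>.\<close>

definition contracting_element ::
  "('g, 'm) monoid_scheme \<Rightarrow> ('g \<Rightarrow> 'a::metric_space \<Rightarrow> 'a) \<Rightarrow> 'g \<Rightarrow> bool" where
  "contracting_element G \<phi> g \<longleftrightarrow> g \<in> carrier G \<and>
     (\<exists>y. qi_embedding_int (\<lambda>n::int. \<phi> (g [^]\<^bsub>G\<^esub> n) y) \<and>
          contracting_set (range (\<lambda>n::int. \<phi> (g [^]\<^bsub>G\<^esub> n) y)))"

definition critical_exponent ::
  "('g, 'm) monoid_scheme \<Rightarrow> ('g \<Rightarrow> 'a::metric_space \<Rightarrow> 'a) \<Rightarrow> 'a \<Rightarrow> ereal" where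
  "critical_exponent G \<phi> p =
     Limsup at_top (\<lambda>l::real. ereal (1 / l * ln (real (card {g \<in> carrier G. dist p (\<phi> g p) \<le> l}))))"

definition poincare_series ::
  "('g, 'm) monoid_scheme \<Rightarrow> ('g \<Rightarrow> 'a::metric_space \<Rightarrow> 'a) \<Rightarrow> 'a \<Rightarrow> real \<Rightarrow> ennreal" where
  "poincare_series G \<phi> p s = (\<Sum>\<^sub>\<infinity>g\<in>carrier G. ennreal (exp (- s * dist p (\<phi> g p))))"

definition divergent_action ::
  "('g, 'm) monoid_scheme \<Rightarrow> ('g \<Rightarrow> 'a::metric_space \<Rightarrow> 'a) \<Rightarrow> 'a \<Rightarrow> bool" where
  "divergent_action G \<phi> p \<longleftrightarrow>
     (\<exists>s. critical_exponent G \<phi> p = ereal s \<and> poincare_series G \<phi> p s = \<infinity>)"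

section \<open>The horocompactification\<close>

type_synonym 'a cocycle = "'a \<Rightarrow> 'a \<Rightarrow> real"

definition cocycles :: "'a::metric_space cocycle set" where
  "cocycles = {c. continuous_on UNIV (\<lambda>(x, y). c x y) \<and> (\<forall>x y z. c x z = c x y + c y z)}"

definition compact_nhd :: "('a::metric_space \<times> 'a) set \<Rightarrow> real \<Rightarrow> 'a cocycle \<Rightarrow> 'a cocycle set" where
  "compact_nhd K e c = {c' \<in> cocycles. \<forall>(x, y)\<in>K. \<bar>c' x y - c x y\<bar> < e}"

definition cocycle_open :: "'a::metric_space cocycle set \<Rightarrow> bool" where
  "cocycle_open U \<longleftrightarrow>
     U \<subseteq> cocycles \<and> (\<forall>c\<in>U. \<exists>K e. compact K \<and> e > 0 \<and> compact_nhd K e c \<subseteq> U)"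

text \<open>Uniform convergence on compact subsets of \<open>X \<times> X\<close>.\<close>

definition cocycle_topology :: "'a::metric_space cocycle topology" where
  "cocycle_topology = topology cocycle_open"

lemma cocycle_openD:
  assumes "cocycle_open U" "c \<in> U"
  shows "\<exists>K e. compact K \<and> e > 0 \<and> compact_nhd K e c \<subseteq> U"
  using assms(1)[unfolded cocycle_open_def, THEN conjunct2] assms(2) by (rule bspec)

lemma compact_nhd_mono:
  assumes "K \<subseteq> K'" "e' \<le> e"
  shows "compact_nhd K' e' c \<subseteq> compact_nhd K e c"
proof
  fix c' assume c': "c' \<in> compact_nhd K' e' c"
  have "\<bar>c' (fst q) (snd q) - c (fst q) (snd q)\<bar> < e" if "q \<in> K" for q
  proof -
    have "q \<in> K'"
      using assms(1) that by (rule subsetD)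
    then have "\<bar>c' (fst q) (snd q) - c (fst q) (snd q)\<bar> < e'"
      using c' by (simp add: compact_nhd_def case_prod_beta)
    then show ?thesis
      using assms(2) by linarith
  qed
  then show "c' \<in> compact_nhd K e c"
    using c' by (simp add: compact_nhd_def case_prod_beta)
qed

lemma istopology_cocycle_open: "istopology cocycle_open"
  unfolding istopology_def
proof (intro conjI allI impI)
  fix S T :: "'a cocycle set"
  assume S: "cocycle_open S" and T: "cocycle_open T"
  have "S \<inter> T \<subseteq> cocycles"
    using S[unfolded cocycle_open_def, THEN conjunct1] by (rule le_infI1)
  moreover have "\<exists>K e. compact K \<and> e > 0 \<and> compact_nhd K e c \<subseteq> S \<inter> T" if c: "c \<in> S \<inter> T" for c
  proof -
    obtain K e where 1: "compact K" "e > 0" "compact_nhd K e c \<subseteq> S"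
      using cocycle_openD[OF S IntD1[OF c]] by (elim exE conjE)
    obtain L d where 2: "compact L" "d > 0" "compact_nhd L d c \<subseteq> T"
      using cocycle_openD[OF T IntD2[OF c]] by (elim exE conjE)
    have "compact_nhd (K \<union> L) (min e d) c \<subseteq> S \<inter> T"
      using order_trans[OF compact_nhd_mono[OF Un_upper1 min.cobounded1] 1(3)]
        order_trans[OF compact_nhd_mono[OF Un_upper2 min.cobounded2] 2(3)]
      by (rule Int_greatest)
    moreover have "compact (K \<union> L)"
      using 1(1) 2(1) by (rule compact_Un)
    moreover have "min e d > 0"
      using 1(2) 2(2) by simp
    ultimately show ?thesis
      by (intro exI[of _ "K \<union> L"] exI[of _ "min e d"] conjI)
  qed
  ultimately show "cocycle_open (S \<inter> T)"
    unfolding cocycle_open_def by (intro conjI ballI)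
next
  fix \<K> :: "'a cocycle set set"
  assume K: "\<forall>S\<in>\<K>. cocycle_open S"
  show "cocycle_open (\<Union>\<K>)"
    unfolding cocycle_open_def
  proof (intro conjI ballI)
    show "\<Union>\<K> \<subseteq> cocycles"
    proof (rule Union_least)
      fix S assume "S \<in> \<K>"
      with K have "cocycle_open S" by (rule bspec)
      then show "S \<subseteq> cocycles"
        unfolding cocycle_open_def by (rule conjunct1)
    qed
    fix c assume "c \<in> \<Union>\<K>"
    then obtain S where S: "S \<in> \<K>" "c \<in> S" by (rule UnionE)
    obtain L e where L: "compact L" "e > 0" "compact_nhd L e c \<subseteq> S"
      using cocycle_openD[OF bspec[OF K S(1)] S(2)] by (elim exE conjE)
    have "compact_nhd L e c \<subseteq> \<Union>\<K>"
      using L(3) Union_upper[OF S(1)] by (rule order_trans)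
    with L(1,2) show "\<exists>K e. compact K \<and> e > 0 \<and> compact_nhd K e c \<subseteq> \<Union>\<K>"
      by (intro exI[of _ L] exI[of _ e] conjI)
  qed
qed

lemma openin_cocycle_topology: "openin cocycle_topology U \<longleftrightarrow> cocycle_open U"
  unfolding cocycle_topology_def topology_inverse'[OF istopology_cocycle_open] by (rule refl)

definition point_cocycle :: "'a::metric_space \<Rightarrow> 'a cocycle" where
  "point_cocycle z = (\<lambda>x y. dist x z - dist y z)"

definition horocompactification :: "'a::metric_space cocycle set" where
  "horocompactification = cocycle_topology closure_of (range point_cocycle)"

definition horoboundary :: "'a::metric_space cocycle set" where
  "horoboundary = horocompactification - range point_cocycle"

definition horoborel :: "'a::metric_space cocycle measure" where
  "horoborel = sigma horocompactification
     {U. openin (subtopology cocycle_topology horocompactification) U}"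

text \<open>This satisfies \<open>g b\<^sub>z = b\<^sub>g\<^sub>z\<close>, and is the only continuous extension of the action
  on \<open>X\<close>.\<close>

definition cocycle_act ::
  "('g, 'm) monoid_scheme \<Rightarrow> ('g \<Rightarrow> 'a::metric_space \<Rightarrow> 'a) \<Rightarrow> 'g \<Rightarrow> 'a cocycle \<Rightarrow> 'a cocycle" where
  "cocycle_act G \<phi> g c = (\<lambda>x y. c (\<phi> (inv\<^bsub>G\<^esub> g) x) (\<phi> (inv\<^bsub>G\<^esub> g) y))"

definition horo_equiv :: "('a::metric_space cocycle \<times> 'a cocycle) set" where
  "horo_equiv = {(c, c').
     (c \<in> range point_cocycle \<and> c' \<in> range point_cocycle \<and> c = c') \<or>
     (c \<in> horoboundary \<and> c' \<in> horoboundary \<and> (\<exists>M. \<forall>x x'. \<bar>c x x' - c' x x'\<bar> \<le> M))}"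

definition saturated :: "'a::metric_space cocycle set \<Rightarrow> bool" where
  "saturated B \<longleftrightarrow> (\<exists>\<C> \<subseteq> horocompactification // horo_equiv. B = \<Union>\<C>)"

definition reduced_algebra :: "'a::metric_space cocycle measure" where
  "reduced_algebra = sigma horocompactification {B \<in> sets horoborel. saturated B}"

section \<open>Densities\<close>

definition density_family ::
  "'a::metric_space \<Rightarrow> ('a \<Rightarrow> 'a cocycle measure) \<Rightarrow> bool" where
  "density_family p \<nu> \<longleftrightarrow>
     (\<forall>x. sets (\<nu> x) = sets horoborel \<and> finite_measure (\<nu> x)) \<and>
     (\<forall>x y. absolutely_continuous (\<nu> y) (\<nu> x)) \<and>
     emeasure (\<nu> p) horocompactification = 1"

definition invariant_density ::
  "('g, 'm) monoid_scheme \<Rightarrow> ('g \<Rightarrow> 'a::metric_space \<Rightarrow> 'a) \<Rightarrow> ('a \<Rightarrow> 'a cocycle measure) \<Rightarrow> bool" where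
  "invariant_density G \<phi> \<nu> \<longleftrightarrow>
     (\<forall>g\<in>carrier G. \<forall>x. distr (\<nu> x) horoborel (cocycle_act G \<phi> g) = \<nu> (\<phi> g x))"

definition conformal_density :: "real \<Rightarrow> ('a::metric_space \<Rightarrow> 'a cocycle measure) \<Rightarrow> bool" where
  "conformal_density \<omega> \<nu> \<longleftrightarrow>
     (\<forall>x y. AE c in \<nu> y. RN_deriv (\<nu> y) (\<nu> x) c = ennreal (exp (- \<omega> * c x y)))"

definition reduced_restriction :: "'a::metric_space cocycle measure \<Rightarrow> 'a cocycle measure" where
  "reduced_restriction M = restrict_space (restr_to_subalg M reduced_algebra) horoboundary"

section \<open>The radial limit set\<close>

definition shadow :: "'a::metric_space \<Rightarrow> 'a \<Rightarrow> real \<Rightarrow> 'a cocycle set" where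
  "shadow x y r = {c \<in> horocompactification. 1 / 2 * (dist x y + c y x) \<le> r}"

definition radial_limit_set_at ::
  "('g, 'm) monoid_scheme \<Rightarrow> ('g \<Rightarrow> 'a::metric_space \<Rightarrow> 'a) \<Rightarrow> 'a \<Rightarrow> 'a \<Rightarrow> real \<Rightarrow> 'a cocycle set" where
  "radial_limit_set_at G \<phi> p x r =
     {c \<in> horoboundary. \<forall>T\<ge>0. \<exists>g\<in>carrier G. dist x (\<phi> g p) \<ge> T \<and> c \<in> shadow x (\<phi> g p) r}"

definition radial_limit_set ::
  "('g, 'm) monoid_scheme \<Rightarrow> ('g \<Rightarrow> 'a::metric_space \<Rightarrow> 'a) \<Rightarrow> 'a \<Rightarrow> 'a cocycle set" where
  "radial_limit_set G \<phi> p =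
     (\<Union>r\<in>{0..}. \<Union>g\<in>carrier G. cocycle_act G \<phi> g ` radial_limit_set_at G \<phi> p p r)"

end

theory Submission
  imports Defs "HOL-Real_Asymp.Real_Asymp"
begin

text \<open>The orbit \<open>A\<close> of a contracting element behaves like a geodesic in a hyperbolic space: a
  geodesic joining two points with distant projections on \<open>A\<close> passes close to both projections.
  As \<open>G\<close> is not virtually cyclic, some translate of \<open>A\<close> has a bounded projection on \<open>A\<close>. Every
  point then projects close to \<open>p\<close> on one of these two axes, which yields the lower bound in the
  shadow lemma: the shadow of \<open>g p\<close> seen from \<open>p\<close> has measure at least
  \<open>\<epsilon> exp (- \<omega> d(p, g p))\<close>.

  Up to right multiplication by one of finitely many elements, a geodesic from \<open>p\<close> to \<open>g p\<close> ends
  by following a translated axis. If the shadows of two such elements \<open>g\<close>, \<open>h\<close> meet, then \<open>g p\<close>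
  is close to a geodesic from \<open>p\<close> to a point near \<open>h p\<close>, or conversely. Hence these shadows are
  quasi-independent, and the Kochen-Stone lemma shows that the radial limit set has positive measure
  if the Poincare series diverges at \<open>\<omega>\<close>; the converse is the Borel-Cantelli lemma.

  The complement of the radial limit set is \<open>G\<close>-invariant. If it had positive measure, the
  restriction of the density to it would again be conformal and, the action being divergent, would
  charge the radial limit set.\<close>

section \<open>Contracting sets\<close>

text \<open>The space need not be hyperbolic, so horoboundary points cannot be handled through
  geodesic rays towards them. All geometry is done with points \<open>z\<close> of the space.
  Membership in a shadow is a closed condition on one value of a cocycle, and the points are dense
  in the horocompactification. So an inclusion of sets of points in a shadow passes to closures, and
  a cocycle lying in two shadows can be replaced by a point lying in two slightly larger ones. The
  restriction of a density to an invariant set has no reason to have mass 1, and it may charge the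
  space itself; hence the measure theory is done for invariant conformal families of arbitrary
  nonzero finite mass. Full measure can be deduced because positivity of the radial limit set is
  equivalent to a condition on orbit sums in which the density does not occur. The lower shadow
  bound has a second use: shadows of elements of \<open>S\<close> at comparable distance overlap
  boundedly, so the terms of the Poincare series at \<omega> in an annulus have a bounded sum. This
  bounds the critical exponent by \<omega> and makes sums over \<open>S\<close> comparable to sums
  over \<open>G\<close>.\<close>

lemma projection_singleton_iff: "q \<in> projection Y {x} \<longleftrightarrow> q \<in> Y \<and> dist x q = infdist x Y"
  by (auto simp: projection_def)

lemma projection_exists:
  fixes Y :: "'a::metric_space set"
  assumes "proper_space TYPE('a)" "closed Y" "Y \<noteq> {}"
  obtains q where "q \<in> projection Y {x}"
proof -
  obtain a where a: "a \<in> Y" using assms by auto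
  have comp: "compact (cball x (dist x a) \<inter> Y)"
    using assms(1,2) by (intro compact_Int_closed) (auto simp: proper_space_def)
  moreover have "cball x (dist x a) \<inter> Y \<noteq> {}"
    using a by auto
  moreover have "continuous_on (cball x (dist x a) \<inter> Y) (dist x)"
    by (intro continuous_intros)
  ultimately have "\<exists>q\<in>cball x (dist x a) \<inter> Y. \<forall>y\<in>cball x (dist x a) \<inter> Y. dist x q \<le> dist x y"
    by (rule continuous_attains_inf)
  then obtain q where q: "q \<in> cball x (dist x a) \<inter> Y"
    and min: "\<And>y. y \<in> cball x (dist x a) \<inter> Y \<Longrightarrow> dist x q \<le> dist x y"
    by blast
  have "dist x q \<le> dist x y" if "y \<in> Y" for y
    using min[of y] min[of a] a that by force
  then have "dist x q = infdist x Y"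
    using q assms(3) by (intro antisym) (auto simp: infdist_notempty intro!: cINF_greatest cINF_lower2)
  then show thesis
    using q that by (auto simp: projection_singleton_iff)
qed

lemma setdist_ge_infdist:
  assumes "\<And>x. x \<in> S \<Longrightarrow> \<alpha> \<le> infdist x Y" "S \<noteq> {}" "Y \<noteq> {}"
  shows "\<alpha> \<le> setdist S Y"
  using assms by (intro le_setdistI) (auto intro: order_trans[OF _ infdist_le])

lemma contracting_projections:
  assumes "alpha_contracting \<alpha> Y" "geodesic_path \<gamma> {a..b}" "a \<le> b"
    and far: "\<And>t. t \<in> {a..b} \<Longrightarrow> \<alpha> \<le> infdist (\<gamma> t) Y"
    and q: "q \<in> projection Y {\<gamma> a}" "q' \<in> projection Y {\<gamma> b}"
  shows "dist q q' \<le> \<alpha>"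
proof -
  have "\<alpha> \<le> setdist (\<gamma> ` {a..b}) Y"
    using far q assms(3) by (intro setdist_ge_infdist) (auto simp: projection_def)
  then have "bounded (projection Y (\<gamma> ` {a..b}))" "diameter (projection Y (\<gamma> ` {a..b})) \<le> \<alpha>"
    using assms(1,2) by (auto simp: alpha_contracting_def)
  moreover have "q \<in> projection Y (\<gamma> ` {a..b})" "q' \<in> projection Y (\<gamma> ` {a..b})"
    using q assms(3) by (auto simp: projection_def)
  ultimately show ?thesis
    using diameter_bounded_bound by fastforce
qed

lemma geodesic_path_continuous:
  assumes "geodesic_path \<gamma> I"
  shows "continuous_on I \<gamma>"
  unfolding continuous_on_iff
proof (intro ballI allI impI)
  fix x e :: real assume "x \<in> I" "0 < e"
  then show "\<exists>d>0. \<forall>x'\<in>I. dist x' x < d \<longrightarrow> dist (\<gamma> x') (\<gamma> x) < e"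
    using assms by (intro exI[of _ e]) (auto simp: geodesic_path_def dist_real_def)
qed

lemma geodesic_path_subset:
  "geodesic_path \<gamma> I \<Longrightarrow> J \<subseteq> I \<Longrightarrow> is_interval J \<Longrightarrow> geodesic_path \<gamma> J"
  by (auto simp: geodesic_path_def)

text \<open>Take the first time \<open>s\<close> within \<alpha> of \<open>Y\<close>. Up to
  \<open>s\<close> the geodesic satisfies the contraction hypothesis, so the projection has moved by
  at most \<alpha>, and \<open>\<gamma> s\<close> is \<alpha>-close to its own projection.
  Minimality of \<open>s\<close> is exported so that the first entries from the two ends can later
  be put in order.\<close>

lemma contracting_entry:
  fixes Y :: "'a::metric_space set"
  assumes proper: "proper_space TYPE('a)" and Y: "closed Y" "alpha_contracting \<alpha> Y" "\<alpha> > 0"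
    and \<gamma>: "geodesic_path \<gamma> {a..b}" and q: "q \<in> projection Y {\<gamma> a}"
    and near: "u \<in> {a..b}" "infdist (\<gamma> u) Y \<le> \<alpha>"
  obtains s where "s \<in> {a..b}" "dist (\<gamma> s) q \<le> 2 * \<alpha>"
    "\<And>t. t \<in> {a..b} \<Longrightarrow> infdist (\<gamma> t) Y \<le> \<alpha> \<Longrightarrow> s \<le> t"
proof -
  define T where "T = {a..b} \<inter> (\<lambda>t. infdist (\<gamma> t) Y) -` {..\<alpha>}"
  have "closed T"
    unfolding T_def
    by (intro continuous_closed_preimage continuous_on_infdist geodesic_path_continuous[OF \<gamma>]) auto
  then have "compact T"
    using compact_Int_closed[OF compact_Icc[of a b], of T] by (simp add: T_def Int_absorb1)
  moreover have "T \<noteq> {}"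
    using near by (auto simp: T_def)
  ultimately obtain s where s: "s \<in> T" and min: "\<And>t. t \<in> T \<Longrightarrow> s \<le> t"
    using compact_attains_inf[of T] by auto
  have sab: "s \<in> {a..b}" and s\<alpha>: "infdist (\<gamma> s) Y \<le> \<alpha>"
    using s by (auto simp: T_def)
  have before: "\<alpha> < infdist (\<gamma> t) Y" if "t \<in> {a..<s}" for t
    using min[of t] that sab by (force simp: T_def)
  have "dist (\<gamma> s) q \<le> 2 * \<alpha>"
  proof (cases "s = a")
    case True
    then show ?thesis
      using q s\<alpha> Y(3) by (auto simp: projection_singleton_iff)
  next
    case False
    then have "a < s" using sab by auto
    \<comment> \<open>At the entry time the distance is still at least \<alpha>, as it varies
      continuously; so contraction applies to the closed segment \<open>{a..s}\<close>.\<close>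
    have ge: "\<alpha> \<le> infdist (\<gamma> s) Y"
    proof (rule field_le_epsilon)
      fix e :: real assume "0 < e"
      define t where "t = max a (s - e)"
      have t: "t \<in> {a..<s}" "s - t \<le> e"
        using \<open>0 < e\<close> \<open>a < s\<close> by (auto simp: t_def)
      have "infdist (\<gamma> t) Y \<le> infdist (\<gamma> s) Y + dist (\<gamma> t) (\<gamma> s)"
        by (rule infdist_triangle)
      also have "dist (\<gamma> t) (\<gamma> s) = s - t"
        using \<gamma> t sab by (auto simp: geodesic_path_def)
      finally show "\<alpha> \<le> infdist (\<gamma> s) Y + e"
        using before[OF t(1)] t(2) by linarith
    qed
    obtain q'' where q'': "q'' \<in> projection Y {\<gamma> s}"
      using projection_exists[OF proper Y(1)] q by (auto simp: projection_def)
    have "dist q q'' \<le> \<alpha>"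
    proof (rule contracting_projections[OF Y(2)])
      show "geodesic_path \<gamma> {a..s}"
        by (rule geodesic_path_subset[OF \<gamma>]) (use sab in auto)
      show "\<alpha> \<le> infdist (\<gamma> t) Y" if "t \<in> {a..s}" for t
        using before[of t] ge that by (cases "t = s") auto
    qed (use q q'' sab in auto)
    moreover have "dist (\<gamma> s) q'' \<le> \<alpha>"
      using q'' s\<alpha> by (auto simp: projection_singleton_iff)
    ultimately show ?thesis
      using dist_triangle2[of "\<gamma> s" q q''] by linarith
  qed
  then show thesis
    using that[of s] sab min by (auto simp: T_def)
qed

lemma geodesic_path_reverse:
  assumes "geodesic_path \<gamma> {a..b}"
  shows "geodesic_path (\<lambda>t. \<gamma> (a + b - t)) {a..b}"
  using assms by (auto simp: geodesic_path_def)

text \<open>A geodesic staying \<alpha>-far from \<open>Y\<close> would have \<alpha>-close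
  projections, so some \<open>u\<close> is near \<open>Y\<close>. The first entries from either end
  lie on their own side of \<open>u\<close>, which gives \<open>s \<le> t\<close>.\<close>

lemma contracting_geodesic:
  fixes Y :: "'a::metric_space set"
  assumes proper: "proper_space TYPE('a)" and Y: "closed Y" "alpha_contracting \<alpha> Y" "\<alpha> > 0"
    and \<gamma>: "geodesic_path \<gamma> {a..b}" "a \<le> b"
    and q: "q \<in> projection Y {\<gamma> a}" "q' \<in> projection Y {\<gamma> b}" and far: "\<alpha> < dist q q'"
  obtains s t where "a \<le> s" "s \<le> t" "t \<le> b" "dist (\<gamma> s) q \<le> 2 * \<alpha>" "dist (\<gamma> t) q' \<le> 2 * \<alpha>"
proof -
  obtain u where u: "u \<in> {a..b}" "infdist (\<gamma> u) Y \<le> \<alpha>"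
    using contracting_projections[OF Y(2) \<gamma> _ q] far by fastforce
  obtain s where s: "s \<in> {a..b}" "dist (\<gamma> s) q \<le> 2 * \<alpha>"
      and min: "\<And>t. t \<in> {a..b} \<Longrightarrow> infdist (\<gamma> t) Y \<le> \<alpha> \<Longrightarrow> s \<le> t"
    using contracting_entry[OF proper Y \<gamma>(1) q(1) u] by blast
  obtain t where t: "t \<in> {a..b}" "dist (\<gamma> (a + b - t)) q' \<le> 2 * \<alpha>"
      and max: "\<And>t'. t' \<in> {a..b} \<Longrightarrow> infdist (\<gamma> (a + b - t')) Y \<le> \<alpha> \<Longrightarrow> t \<le> t'"
    using contracting_entry[OF proper Y geodesic_path_reverse[OF \<gamma>(1)], of q' "a + b - u"] q(2) u by auto
  have "s \<le> u" "t \<le> a + b - u"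
    using min[OF u] max[of "a + b - u"] u by auto
  then show thesis
    using that[of s "a + b - t"] s t by auto
qed

text \<open>Replacing \<open>q\<close> and \<open>q'\<close> by the points \<open>\<gamma> s\<close>
  and \<open>\<gamma> t\<close> of the geodesic costs 2\<alpha>, 4\<alpha> and 2\<alpha> in the
  three terms.\<close>

lemma contracting_dist:
  fixes Y :: "'a::metric_space set"
  assumes proper: "proper_space TYPE('a)" and geo: "geodesic_space TYPE('a)"
    and Y: "closed Y" "alpha_contracting \<alpha> Y" "\<alpha> > 0"
    and q: "q \<in> projection Y {x}" "q' \<in> projection Y {z}" and far: "\<alpha> < dist q q'"
  shows "dist x q + dist q q' + dist q' z \<le> dist x z + 8 * \<alpha>"
proof -
  obtain \<gamma> a b where \<gamma>: "a \<le> b" "geodesic_path \<gamma> {a..b}" "\<gamma> a = x" "\<gamma> b = z"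
    using geo unfolding geodesic_space_def by blast
  obtain s t where st: "a \<le> s" "s \<le> t" "t \<le> b" "dist (\<gamma> s) q \<le> 2 * \<alpha>" "dist (\<gamma> t) q' \<le> 2 * \<alpha>"
    using contracting_geodesic[OF proper Y \<gamma>(2,1), of q q'] q far \<gamma>(3,4) by auto
  have d: "dist (\<gamma> u) (\<gamma> v) = v - u" if "a \<le> u" "u \<le> v" "v \<le> b" for u v
    using \<gamma>(2) that by (auto simp: geodesic_path_def)
  have "dist x z = dist x (\<gamma> s) + dist (\<gamma> s) (\<gamma> t) + dist (\<gamma> t) z"
    using d[of a s] d[of s t] d[of t b] d[of a b] st \<gamma> by auto
  moreover have "dist x q \<le> dist x (\<gamma> s) + 2 * \<alpha>" "dist q' z \<le> dist (\<gamma> t) z + 2 * \<alpha>"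
    using st dist_triangle[of x q "\<gamma> s"] dist_triangle3[of q' z "\<gamma> t"] by linarith+
  moreover have "dist q q' \<le> dist (\<gamma> s) (\<gamma> t) + 4 * \<alpha>"
    using st dist_triangle[of q q' "\<gamma> t"] dist_triangle3[of q "\<gamma> t" "\<gamma> s"] by linarith
  ultimately show ?thesis by linarith
qed

text \<open>A point of \<open>Y\<close> is its own projection, so \<open>contracting_dist\<close>
  applies when \<open>q\<close> and \<open>z\<close> are far apart; otherwise \<open>q\<close> is
  nearest to \<open>x\<close> and the remaining term is at most \<alpha>.\<close>

lemma contracting_dist_mem:
  fixes Y :: "'a::metric_space set"
  assumes proper: "proper_space TYPE('a)" and geo: "geodesic_space TYPE('a)"
    and Y: "closed Y" "alpha_contracting \<alpha> Y" "\<alpha> > 0"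
    and q: "q \<in> projection Y {x}" and z: "z \<in> Y"
  shows "dist x q + dist q z \<le> dist x z + 8 * \<alpha>"
proof (cases "\<alpha> < dist q z")
  case True
  have "z \<in> projection Y {z}"
    using z by (simp add: projection_singleton_iff)
  from contracting_dist[OF proper geo Y q this True] show ?thesis by simp
next
  case False
  moreover have "dist x q \<le> dist x z"
    using q z by (auto simp: projection_singleton_iff intro: infdist_le)
  ultimately show ?thesis using Y(3) by linarith
qed

text \<open>Adding the estimates of \<open>contracting_dist_mem\<close> for both endpoints counts
  the distance to \<open>q\<close> twice, against an error of 16\<alpha>.\<close>

lemma contracting_quasi_convex:
  fixes Y :: "'a::metric_space set"
  assumes proper: "proper_space TYPE('a)" and geo: "geodesic_space TYPE('a)"
    and Y: "closed Y" "alpha_contracting \<alpha> Y" "\<alpha> > 0"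
    and \<gamma>: "geodesic_path \<gamma> {a..b}" "\<gamma> a \<in> Y" "\<gamma> b \<in> Y" and t: "t \<in> {a..b}"
    and q: "q \<in> projection Y {\<gamma> t}"
  shows "dist (\<gamma> t) q \<le> 8 * \<alpha>"
proof -
  have "dist (\<gamma> t) (\<gamma> a) = t - a" "dist (\<gamma> t) (\<gamma> b) = b - t" "dist (\<gamma> a) (\<gamma> b) = b - a"
    using \<gamma>(1) t by (auto simp: geodesic_path_def)
  moreover have "dist (\<gamma> a) (\<gamma> b) \<le> dist q (\<gamma> a) + dist q (\<gamma> b)"
    by (rule dist_triangle3)
  ultimately show ?thesis
    using contracting_dist_mem[OF proper geo Y q \<gamma>(2)] contracting_dist_mem[OF proper geo Y q \<gamma>(3)]
    by linarith
qed

text \<open>Here \<open>z\<close> is seen from \<open>x\<close> through \<open>p\<close>, while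
  \<open>x\<close> projects on \<open>Y\<close> far from \<open>p\<close>. If \<open>z\<close>
  projected \<alpha>-close to \<open>q\<close>, going from \<open>x\<close> to \<open>z\<close>
  through \<open>p\<close> would mean travelling from \<open>q\<close> to \<open>p\<close> and back,
  a detour of about twice \<open>dist q p\<close>; the threshold is where this exceeds the allowed
  excess \<open>2 * r\<close>. So the projections are far apart and the geodesic passes near
  \<open>q\<close>.\<close>

lemma contracting_tail:
  fixes Y :: "'a::metric_space set"
  assumes proper: "proper_space TYPE('a)" and geo: "geodesic_space TYPE('a)"
    and Y: "closed Y" "alpha_contracting \<alpha> Y" "\<alpha> > 0"
    and a: "a \<in> Y" "dist p a \<le> d"
    and q: "q \<in> projection Y {x}" "r + 9 * \<alpha> + 2 * d < dist q p"
    and z: "dist x p + dist p z \<le> dist x z + 2 * r"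
    and \<gamma>: "geodesic_path \<gamma> {b..c}" "b \<le> c" "\<gamma> b = x" "\<gamma> c = z"
  obtains t where "t \<in> {b..c}" "dist (\<gamma> t) q \<le> 2 * \<alpha>"
proof -
  obtain q' where q': "q' \<in> projection Y {z}"
    using projection_exists[OF proper Y(1)] a by auto
  have "\<alpha> < dist q q'"
  proof (rule ccontr)
    assume "\<not> \<alpha> < dist q q'"
    moreover have "dist x q + dist q a \<le> dist x a + 8 * \<alpha>" "dist z q' + dist q' a \<le> dist z a + 8 * \<alpha>"
      using contracting_dist_mem[OF proper geo Y] q(1) q' a(1) by blast+
    moreover have "dist x a \<le> dist x p + d" "dist z a \<le> dist p z + d" "dist q p \<le> dist q a + d"
      using a(2) dist_triangle[of x a p] dist_triangle[of z a p] dist_triangle[of q p a]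
      by (auto simp: dist_commute)
    moreover have "dist x z \<le> dist x q + dist q q' + dist z q'"
      using dist_triangle[of x z q] dist_triangle[of q z q'] by (simp add: dist_commute)
    moreover have "dist q a \<le> dist q q' + dist q' a"
      by (rule dist_triangle)
    ultimately show False
      using q(2) z by linarith
  qed
  then obtain s t where "b \<le> s" "s \<le> t" "t \<le> c" "dist (\<gamma> s) q \<le> 2 * \<alpha>"
    using contracting_geodesic[OF proper Y \<gamma>(1,2), of q q'] q(1) q' \<gamma>(3,4) by metis
  then show thesis
    using that[of s] by auto
qed

section \<open>Proper isometric actions\<close>

text \<open>Pairwise distances are easier to transport by an isometry than \<open>diameter\<close>.
  The sign condition on \<alpha> handles empty projections, whose diameter is 0.\<close>

lemma alpha_contracting_iff:
  assumes "0 \<le> \<alpha>"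
  shows "alpha_contracting \<alpha> Y \<longleftrightarrow>
    (\<forall>\<gamma> I. geodesic_path \<gamma> I \<and> setdist (\<gamma> ` I) Y \<ge> \<alpha> \<longrightarrow>
      (\<forall>u\<in>projection Y (\<gamma> ` I). \<forall>v\<in>projection Y (\<gamma> ` I). dist u v \<le> \<alpha>))"
proof -
  have "bounded S \<and> diameter S \<le> \<alpha> \<longleftrightarrow> (\<forall>u\<in>S. \<forall>v\<in>S. dist u v \<le> \<alpha>)" for S :: "'a set"
  proof
    assume "bounded S \<and> diameter S \<le> \<alpha>"
    then show "\<forall>u\<in>S. \<forall>v\<in>S. dist u v \<le> \<alpha>"
      using diameter_bounded_bound by fastforce
  next
    assume S: "\<forall>u\<in>S. \<forall>v\<in>S. dist u v \<le> \<alpha>"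
    then have "diameter S \<le> \<alpha>"
      using assms by (cases "S = {}") (auto simp: diameter_def intro!: cSUP_least)
    then show "bounded S \<and> diameter S \<le> \<alpha>"
      using S bounded_two_points by blast
  qed
  then show ?thesis
    by (simp add: alpha_contracting_def)
qed

text \<open>Turns a coincidence found by the pigeonhole principle into a commutation relation:
  \<open>f\<close> conjugates one quotient into the other.\<close>

lemma (in group) conjugate_quotients:
  assumes "a \<in> carrier G" "b \<in> carrier G" "c \<in> carrier G" "d \<in> carrier G" "f \<in> carrier G"
    and eq: "inv a \<otimes> (f \<otimes> b) = inv c \<otimes> (f \<otimes> d)"
  shows "f \<otimes> (b \<otimes> inv d) = a \<otimes> inv c \<otimes> f"
proof -
  have "f \<otimes> b = a \<otimes> (inv a \<otimes> (f \<otimes> b))"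
    using assms(1-5) by (simp add: m_assoc[symmetric])
  then have "f \<otimes> (b \<otimes> inv d) = a \<otimes> (inv c \<otimes> (f \<otimes> d)) \<otimes> inv d"
    using assms(1-5) unfolding eq by (simp add: m_assoc[symmetric])
  also have "\<dots> = a \<otimes> inv c \<otimes> f"
    using assms(1-5) by (simp add: m_assoc)
  finally show ?thesis .
qed

locale proper_isometric_action =
  fixes G :: "('g, 'm) monoid_scheme" (structure) and \<phi> :: "'g \<Rightarrow> 'a::metric_space \<Rightarrow> 'a"
  assumes proper_space: "proper_space TYPE('a)"
    and geodesic_space: "geodesic_space TYPE('a)"
    and isometric_action: "isometric_action G \<phi>"
    and proper_action: "proper_action G \<phi>"
begin

sublocale group_action G UNIV \<phi>
  using isometric_action by (simp add: isometric_action_def)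

sublocale group G
  using group_hom by (simp add: group_hom_def)

lemma act_mult: "g \<in> carrier G \<Longrightarrow> h \<in> carrier G \<Longrightarrow> \<phi> (g \<otimes> h) x = \<phi> g (\<phi> h x)"
  by (rule composition_rule) auto

lemma act_one [simp]: "\<phi> \<one> x = x"
  using id_eq_one by (metis UNIV_I restrict_apply')

lemma act_inv_act [simp]: "g \<in> carrier G \<Longrightarrow> \<phi> (inv g) (\<phi> g x) = x"
  by (metis act_mult act_one inv_closed l_inv)

lemma act_act_inv [simp]: "g \<in> carrier G \<Longrightarrow> \<phi> g (\<phi> (inv g) x) = x"
  by (metis act_mult act_one inv_closed r_inv)

lemma dist_act [simp]: "g \<in> carrier G \<Longrightarrow> dist (\<phi> g x) (\<phi> g y) = dist x y"
  using isometric_action by (simp add: isometric_action_def)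

lemma dist_act_left: "g \<in> carrier G \<Longrightarrow> dist (\<phi> g x) y = dist x (\<phi> (inv g) y)"
  by (metis act_act_inv dist_act)

lemma dist_act_act:
  "g \<in> carrier G \<Longrightarrow> h \<in> carrier G \<Longrightarrow> dist (\<phi> g x) (\<phi> h y) = dist x (\<phi> (inv g \<otimes> h) y)"
  by (simp add: dist_act_left act_mult)

lemma finite_dist_act_le: "finite {g \<in> carrier G. dist x (\<phi> g y) \<le> R}"
proof -
  \<comment> \<open>The radius makes the ball contain \<open>y\<close> as well as its image, so
    properness applies to one compact set.\<close>
  have "compact (cball x (max R (dist x y)))"
    using proper_space by (simp add: proper_space_def)
  then have "finite {g \<in> carrier G. \<phi> g ` cball x (max R (dist x y)) \<inter> cball x (max R (dist x y)) \<noteq> {}}"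
    using proper_action by (simp add: proper_action_def)
  moreover have "\<phi> g ` cball x (max R (dist x y)) \<inter> cball x (max R (dist x y)) \<noteq> {}"
    if "dist x (\<phi> g y) \<le> R" for g
  proof -
    have "\<phi> g y \<in> \<phi> g ` cball x (max R (dist x y)) \<inter> cball x (max R (dist x y))"
      using that by auto
    then show ?thesis by blast
  qed
  ultimately show ?thesis
    by (auto elim!: rev_finite_subset)
qed

lemma infdist_act:
  assumes "g \<in> carrier G"
  shows "infdist (\<phi> g x) (\<phi> g ` Y) = infdist x Y"
  using assms by (auto simp: infdist_def image_image)

lemma projection_act:
  assumes "g \<in> carrier G"
  shows "projection (\<phi> g ` Y) (\<phi> g ` Z) = \<phi> g ` projection Y Z"
  using assms by (auto simp: projection_def infdist_act intro!: imageI)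

lemma projection_act_singleton:
  assumes "g \<in> carrier G"
  shows "projection (\<phi> g ` Y) {\<phi> g x} = \<phi> g ` projection Y {x}"
  using projection_act[OF assms, of Y "{x}"] by simp

lemma setdist_act:
  assumes g: "g \<in> carrier G"
  shows "setdist (\<phi> g ` S) (\<phi> g ` T) = setdist S T"
proof -
  have "{dist u v | u v. u \<in> \<phi> g ` S \<and> v \<in> \<phi> g ` T} = {dist (\<phi> g u) (\<phi> g v) | u v. u \<in> S \<and> v \<in> T}"
    by blast
  also have "\<dots> = {dist u v | u v. u \<in> S \<and> v \<in> T}"
    using g by simp
  finally have "{dist u v | u v. u \<in> \<phi> g ` S \<and> v \<in> \<phi> g ` T} = {dist u v | u v. u \<in> S \<and> v \<in> T}" .
  then show ?thesis
    by (simp add: setdist_def)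
qed

lemma geodesic_path_act:
  "g \<in> carrier G \<Longrightarrow> geodesic_path \<gamma> I \<Longrightarrow> geodesic_path (\<lambda>t. \<phi> g (\<gamma> t)) I"
  by (auto simp: geodesic_path_def)

lemma alpha_contracting_act:
  assumes g: "g \<in> carrier G" and \<alpha>: "0 \<le> \<alpha>" and Y: "alpha_contracting \<alpha> Y"
  shows "alpha_contracting \<alpha> (\<phi> g ` Y)"
  unfolding alpha_contracting_iff[OF \<alpha>]
proof (intro allI impI ballI, elim conjE)
  fix \<gamma> I u v
  assume \<gamma>: "geodesic_path \<gamma> I" and far: "\<alpha> \<le> setdist (\<gamma> ` I) (\<phi> g ` Y)"
    and uv: "u \<in> projection (\<phi> g ` Y) (\<gamma> ` I)" "v \<in> projection (\<phi> g ` Y) (\<gamma> ` I)"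
  define \<gamma>' where "\<gamma>' = (\<lambda>t. \<phi> (inv g) (\<gamma> t))"
  have eq: "\<gamma> ` I = \<phi> g ` \<gamma>' ` I"
    using g by (simp add: \<gamma>'_def image_image)
  have "geodesic_path \<gamma>' I"
    using geodesic_path_act[OF _ \<gamma>] g by (simp add: \<gamma>'_def)
  moreover have "\<alpha> \<le> setdist (\<gamma>' ` I) Y"
    using far g by (simp add: eq setdist_act)
  moreover obtain u' v' where "u = \<phi> g u'" "v = \<phi> g v'"
    "u' \<in> projection Y (\<gamma>' ` I)" "v' \<in> projection Y (\<gamma>' ` I)"
    using uv g by (auto simp: eq projection_act)
  ultimately show "dist u v \<le> \<alpha>"
    using Y g unfolding alpha_contracting_iff[OF \<alpha>] by simp
qed

lemma closed_act:
  assumes g: "g \<in> carrier G" and Y: "closed Y"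
  shows "closed (\<phi> g ` Y)"
proof -
  have "continuous_on UNIV (\<phi> (inv g))"
    using g by (auto simp: continuous_on_iff intro!: exI)
  then have "closed (\<phi> (inv g) -` Y)"
    using Y by (intro closed_vimage) auto
  also have "\<phi> (inv g) -` Y = \<phi> g ` Y"
    using g by (auto simp: image_iff) (metis act_act_inv)
  finally show ?thesis .
qed

end

section \<open>The axis of a contracting element and its stabiliser\<close>

locale contracting_axis = proper_isometric_action G \<phi>
  for G :: "('g, 'm) monoid_scheme" (structure) and \<phi> :: "'g \<Rightarrow> 'a::metric_space \<Rightarrow> 'a" +
  fixes g0 :: 'g and y :: 'a and \<alpha> :: real
  assumes g0 [simp]: "g0 \<in> carrier G"
    and qi: "qi_embedding_int (\<lambda>n::int. \<phi> (g0 [^] n) y)"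
    and closed_axis: "closed (range (\<lambda>n::int. \<phi> (g0 [^] n) y))"
    and contracting_axis: "alpha_contracting \<alpha> (range (\<lambda>n::int. \<phi> (g0 [^] n) y))"
    and \<alpha>_pos: "\<alpha> > 0"
begin

definition axis :: "'a set" where
  "axis = range (\<lambda>n::int. \<phi> (g0 [^] n) y)"

lemma axis_nonempty [simp]: "axis \<noteq> {}"
  by (simp add: axis_def)

lemma axis_translate: "\<phi> (g0 [^] (n::int)) ` axis = axis"
proof -
  have "\<phi> (g0 [^] n) ` axis = (\<lambda>m. \<phi> (g0 [^] m) y) ` range (\<lambda>m. n + m)"
    unfolding image_image by (simp add: axis_def image_image act_mult int_pow_mult)
  then show ?thesis
    by (simp only: surj_plus axis_def)
qed

lemma finite_axis_dist_le: "finite {n::int. dist x (\<phi> (g0 [^] n) y) \<le> R}"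
proof -
  obtain L C where LC: "L \<ge> 1" "C \<ge> 0" and
    low: "\<And>m n. real_of_int \<bar>m - n\<bar> / L - C \<le> dist (\<phi> (g0 [^] m) y) (\<phi> (g0 [^] n) y)"
    using qi unfolding qi_embedding_int_def by blast
  define B where "B = \<lceil>L * (C + (dist x y + R))\<rceil>"
  have "{n::int. dist x (\<phi> (g0 [^] n) y) \<le> R} \<subseteq> {-B..B}"
  proof
    fix n assume "n \<in> {n::int. dist x (\<phi> (g0 [^] n) y) \<le> R}"
    moreover have "dist y (\<phi> (g0 [^] n) y) \<le> dist x y + dist x (\<phi> (g0 [^] n) y)"
      by (rule dist_triangle3)
    ultimately have "real_of_int \<bar>n\<bar> / L \<le> C + (dist x y + R)"
      using low[of 0 n] by simp
    then have "real_of_int \<bar>n\<bar> \<le> L * (C + (dist x y + R))"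
      using LC by (simp add: pos_divide_le_eq mult.commute)
    then have "\<bar>n\<bar> \<le> B"
      unfolding B_def by linarith
    then show "n \<in> {-B..B}" by auto
  qed
  then show ?thesis
    by (rule finite_subset) simp
qed

lemma ex_axis_dist_gt: "\<exists>n::int. R < dist x (\<phi> (g0 [^] n) z)"
proof -
  have "infinite (- {n::int. dist x (\<phi> (g0 [^] n) y) \<le> R + dist y z})"
    using finite_axis_dist_le infinite_UNIV_int finite_compl by blast
  then obtain n :: int where "R + dist y z < dist x (\<phi> (g0 [^] n) y)"
    using not_finite_existsD[of "\<lambda>n. \<not> dist x (\<phi> (g0 [^] n) y) \<le> R + dist y z"]
    by (auto simp: Compl_eq not_le)
  moreover have "dist x (\<phi> (g0 [^] n) y) \<le> dist x (\<phi> (g0 [^] n) z) + dist (\<phi> (g0 [^] n) y) (\<phi> (g0 [^] n) z)"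
    by (rule dist_triangle2)
  ultimately show ?thesis
    by (intro exI[of _ n]) simp
qed

text \<open>A nontrivial relation would bring the orbit back to \<open>y\<close> at infinitely many
  exponents, against the quasi-isometric embedding.\<close>

lemma int_pow_eq_one_iff: "g0 [^] (n::int) = \<one> \<longleftrightarrow> n = 0"
proof
  assume 1: "g0 [^] n = \<one>"
  show "n = 0"
  proof (rule ccontr)
    assume n: "n \<noteq> 0"
    have *: "g0 [^] (n * m) = \<one>" for m :: int
      by (metis 1 g0 int_pow_one int_pow_pow)
    have "range (\<lambda>m. n * m) \<subseteq> {k. dist y (\<phi> (g0 [^] k) y) \<le> 0}"
      by (auto simp: *)
    then have "finite (range (\<lambda>m. n * m))"
      using finite_axis_dist_le finite_subset by blast
    moreover have "inj (\<lambda>m. n * m)"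
      using n by (auto simp: inj_on_def)
    ultimately show False
      using finite_imageD infinite_UNIV_int by blast
  qed
qed simp

text \<open>A projection of a point of \<open>\<phi> f\<close>
  axis\<open>that is not \<alpha>-close to the fixed\<close>q0\<open>lies within 2\<alpha> of a geodesic with endpoints on\<close>\<phi>
  f \<open>axis\<close>, which is within 8\<alpha> of that set by quasi-convexity; hence 10\<alpha>.
  Finitely many such orbit points would make the projection bounded.\<close>

lemma infinite_near_axis:
  assumes f: "f \<in> carrier G" and unb: "\<not> bounded (projection axis (\<phi> f ` axis))"
  shows "infinite {i::int. \<exists>m::int. dist (\<phi> (g0 [^] i) y) (\<phi> f (\<phi> (g0 [^] m) y)) \<le> 10 * \<alpha>}"
    (is "infinite ?I")
proof
  assume fin: "finite ?I"
  note ax = closed_axis[folded axis_def] contracting_axis[folded axis_def] \<alpha>_pos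
  note fax = closed_act[OF f ax(1)] alpha_contracting_act[OF f less_imp_le[OF \<alpha>_pos] ax(2)] \<alpha>_pos
  have y: "y \<in> axis"
    by (auto simp: axis_def intro!: range_eqI[of _ _ "0::int"])
  obtain q0 where q0: "q0 \<in> projection axis {\<phi> f y}"
    using projection_exists[OF proper_space ax(1)] by auto
  have "projection axis (\<phi> f ` axis) \<subseteq> cball q0 \<alpha> \<union> (\<lambda>i. \<phi> (g0 [^] i) y) ` ?I"
  proof
    fix q' assume "q' \<in> projection axis (\<phi> f ` axis)"
    then obtain b where b: "b \<in> axis" and q': "q' \<in> projection axis {\<phi> f b}"
      by (auto simp: projection_def)
    show "q' \<in> cball q0 \<alpha> \<union> (\<lambda>i. \<phi> (g0 [^] i) y) ` ?I"
    proof (cases "\<alpha> < dist q0 q'")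
      case False
      then show ?thesis by simp
    next
      case True
      obtain \<gamma> c d where \<gamma>: "c \<le> d" "geodesic_path \<gamma> {c..d}" "\<gamma> c = \<phi> f y" "\<gamma> d = \<phi> f b"
        using geodesic_space unfolding geodesic_space_def by blast
      obtain t where t: "t \<in> {c..d}" "dist (\<gamma> t) q' \<le> 2 * \<alpha>"
        using contracting_geodesic[OF proper_space ax \<gamma>(2,1), of q0 q'] q0 q' True \<gamma>(3,4) by force
      obtain w where w: "w \<in> projection (\<phi> f ` axis) {\<gamma> t}"
        using projection_exists[OF proper_space fax(1)] by auto
      have "dist (\<gamma> t) w \<le> 8 * \<alpha>"
        using contracting_quasi_convex[OF proper_space geodesic_space fax \<gamma>(2) _ _ t(1) w] \<gamma>(3,4) y b
        by auto
      then have "dist q' w \<le> 10 * \<alpha>"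
        using t(2) dist_triangle3[of q' w "\<gamma> t"] by linarith
      moreover obtain i :: int where "q' = \<phi> (g0 [^] i) y"
        using q' by (auto simp: projection_def axis_def)
      moreover obtain m :: int where "w = \<phi> f (\<phi> (g0 [^] m) y)"
        using w by (auto simp: projection_def axis_def)
      ultimately show ?thesis by auto
    qed
  qed
  moreover have "bounded (cball q0 \<alpha> \<union> (\<lambda>i. \<phi> (g0 [^] i) y) ` ?I)"
    using fin by (simp add: finite_imp_bounded)
  ultimately have "bounded (projection axis (\<phi> f ` axis))"
    by (rule bounded_subset[rotated])
  then show False using unb by contradiction
qed

text \<open>For each of the infinitely many \<open>i\<close> where the two axes are close, the
  element \<open>t i\<close> moves \<open>y\<close> by at most 10\<alpha>, and only finitely many
  elements do so. Two equal values make \<open>f\<close> conjugate a power of \<open>g0\<close> to a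
  power of \<open>g0\<close>. The factorisation through \<open>t\<close> serves to count
  cosets.\<close>

lemma commensurating:
  assumes f: "f \<in> carrier G" and unb: "\<not> bounded (projection axis (\<phi> f ` axis))"
  obtains i m k l :: int and t where "t \<in> carrier G" "dist y (\<phi> t y) \<le> 10 * \<alpha>"
    "f = g0 [^] i \<otimes> t \<otimes> g0 [^] m" "k > 0" "f \<otimes> g0 [^] k = g0 [^] l \<otimes> f"
proof -
  define I where "I = {i::int. \<exists>m::int. dist (\<phi> (g0 [^] i) y) (\<phi> f (\<phi> (g0 [^] m) y)) \<le> 10 * \<alpha>}"
  define B where "B = {t \<in> carrier G. dist y (\<phi> t y) \<le> 10 * \<alpha>}"
  have "\<forall>i\<in>I. \<exists>m::int. dist (\<phi> (g0 [^] i) y) (\<phi> f (\<phi> (g0 [^] m) y)) \<le> 10 * \<alpha>"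
    by (simp add: I_def)
  from bchoice[OF this] obtain m :: "int \<Rightarrow> int"
    where m: "\<And>i. i \<in> I \<Longrightarrow> dist (\<phi> (g0 [^] i) y) (\<phi> f (\<phi> (g0 [^] m i) y)) \<le> 10 * \<alpha>"
    by blast
  define t where "t = (\<lambda>i. inv (g0 [^] i) \<otimes> (f \<otimes> g0 [^] m i))"
  have tG: "t i \<in> carrier G" for i
    using f by (simp add: t_def)
  have tB: "t i \<in> B" if "i \<in> I" for i
    using m[OF that] f tG by (simp add: B_def t_def act_mult dist_act_left)
  have ft: "f = g0 [^] i \<otimes> t i \<otimes> g0 [^] (- m i)" for i
  proof -
    have "g0 [^] i \<otimes> t i = f \<otimes> g0 [^] m i"
      using f by (simp add: t_def m_assoc[symmetric])
    then show ?thesis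
      using f by (simp add: int_pow_neg m_assoc)
  qed
  have "finite B"
    unfolding B_def by (rule finite_dist_act_le)
  moreover have "infinite I"
    using infinite_near_axis[OF assms] by (simp add: I_def)
  ultimately have "\<not> inj_on t I"
    using tB by (meson finite_subset image_subsetI finite_imageD)
  then obtain i j where ij: "i \<in> I" "j \<in> I" "i \<noteq> j" "t i = t j"
    by (auto simp: inj_on_def)
  have comm: "f \<otimes> g0 [^] (m i - m j) = g0 [^] (i - j) \<otimes> f" if "t i = t j" for i j
    using conjugate_quotients[of "g0 [^] i" "g0 [^] m i" "g0 [^] j" "g0 [^] m j" f] that f
    by (simp add: t_def int_pow_diff)
  have "m i \<noteq> m j"
  proof
    assume "m i = m j"
    then have "g0 [^] (i - j) \<otimes> f = f"
      using comm[OF ij(4)] f by simp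
    then have "g0 [^] (i - j) = \<one>"
      using f by (simp add: l_cancel_one)
    then show False
      using ij(3) by (simp add: int_pow_eq_one_iff)
  qed
  \<comment> \<open>The roles of \<open>i\<close> and \<open>j\<close> are exchanged if necessary,
    to make the exponent positive.\<close>
  then obtain k l :: int where "k > 0" "f \<otimes> g0 [^] k = g0 [^] l \<otimes> f"
    using comm[OF ij(4)] comm[OF ij(4)[symmetric]]
    by (cases "m i < m j") (force simp: not_less)+
  then show thesis
    using that[of "t i" i "- m i" k l] tB[OF ij(1)] ft[of i] by (simp add: B_def)
qed

text \<open>Every \<open>f\<close> factors as \<open>g0 [^] i \<otimes> t \<otimes> g0 [^] m\<close>
  with \<open>t\<close> in a finite set, so its coset depends only on \<open>t\<close> and
  \<open>m\<close>. For fixed \<open>t\<close> this dependence is periodic in \<open>m\<close>,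
  hence the cyclic group generated by \<open>g0\<close> has finite index.\<close>

lemma virtually_cyclicI:
  assumes unb: "\<And>f. f \<in> carrier G \<Longrightarrow> \<not> bounded (projection axis (\<phi> f ` axis))"
  shows "virtually_cyclic G"
proof -
  define H where "H = range (\<lambda>n::int. g0 [^] n)"
  have H: "subgroup H G"
    unfolding H_def by (rule subgroup_of_powers) simp
  have HG: "H \<subseteq> carrier G"
    using H subgroup.subset by blast
  define B where "B = {t \<in> carrier G. dist y (\<phi> t y) \<le> 10 * \<alpha>}"
  have "finite B"
    unfolding B_def by (rule finite_dist_act_le)
  have absorb: "H #> (g0 [^] i \<otimes> t) = H #> t" if "t \<in> carrier G" for i :: int and t
    using coset_join2[of "g0 [^] i", OF _ H] that coset_mult_assoc[OF HG, of "g0 [^] i" t]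
    by (auto simp: H_def)
  have fin: "finite (range (\<lambda>m::int. H #> (t \<otimes> g0 [^] m)))" if "t \<in> B" for t
  proof -
    have t: "t \<in> carrier G" using that by (simp add: B_def)
    \<comment> \<open>The hypothesis covers \<open>t\<close> itself: moving a power of
      \<open>g0\<close> through \<open>t\<close> to the left, where the coset absorbs it, yields the
      period \<open>k\<close>.\<close>
    obtain k l :: int where kl: "k > 0" "t \<otimes> g0 [^] k = g0 [^] l \<otimes> t"
      by (rule commensurating[OF t unb[OF t]])
    have step: "H #> (t \<otimes> g0 [^] (k + m)) = H #> (t \<otimes> g0 [^] m)" for m :: int
    proof -
      have "t \<otimes> g0 [^] (k + m) = g0 [^] l \<otimes> (t \<otimes> g0 [^] m)"
        using t kl(2) by (metis g0 int_pow_closed int_pow_mult m_assoc)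
      then show ?thesis using absorb t by simp
    qed
    have steps: "H #> (t \<otimes> g0 [^] (int n * k + m)) = H #> (t \<otimes> g0 [^] m)" for n and m :: int
    proof (induction n)
      case (Suc n)
      then show ?case
        using step[of "int n * k + m"] by (simp add: algebra_simps)
    qed simp
    have per: "H #> (t \<otimes> g0 [^] m) = H #> (t \<otimes> g0 [^] (m mod k))" for m :: int
    proof -
      define q where "q = m div k"
      have m: "m = q * k + m mod k"
        by (simp add: q_def)
      show ?thesis
      proof (cases "0 \<le> q")
        case True
        then show ?thesis using steps[of "nat q" "m mod k"] m by simp
      next
        case False
        then have "int (nat (- q)) * k + m = m mod k"
          using m by (simp add: algebra_simps)
        then show ?thesis using steps[of "nat (- q)" m] by simp
      qed
    qed
    have "H #> (t \<otimes> g0 [^] m) \<in> (\<lambda>m::int. H #> (t \<otimes> g0 [^] m)) ` {0..<k}" for m :: int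
      using per[of m] kl(1) by (intro image_eqI[of _ _ "m mod k"]) auto
    then have "range (\<lambda>m::int. H #> (t \<otimes> g0 [^] m)) \<subseteq> (\<lambda>m::int. H #> (t \<otimes> g0 [^] m)) ` {0..<k}"
      by blast
    then show ?thesis
      by (rule finite_subset) simp
  qed
  have "rcosets H \<subseteq> (\<Union>t\<in>B. range (\<lambda>m::int. H #> (t \<otimes> g0 [^] m)))"
  proof
    fix S assume "S \<in> rcosets H"
    then obtain f where f: "f \<in> carrier G" "S = H #> f"
      by (auto simp: RCOSETS_def)
    obtain i m k l :: int and t where "t \<in> carrier G" "dist y (\<phi> t y) \<le> 10 * \<alpha>"
        "f = g0 [^] i \<otimes> t \<otimes> g0 [^] m" "k > 0" "f \<otimes> g0 [^] k = g0 [^] l \<otimes> f"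
      by (rule commensurating[OF f(1) unb[OF f(1)]])
    then have t: "t \<in> B" "f = g0 [^] i \<otimes> t \<otimes> g0 [^] m"
      by (auto simp: B_def)
    then have tG: "t \<in> carrier G" by (simp add: B_def)
    have "S = H #> (t \<otimes> g0 [^] m)"
      using absorb[of "t \<otimes> g0 [^] m" i] tG by (simp add: f t m_assoc)
    then show "S \<in> (\<Union>t\<in>B. range (\<lambda>m::int. H #> (t \<otimes> g0 [^] m)))"
      using t(1) by auto
  qed
  then have "finite (rcosets H)"
    using \<open>finite B\<close> fin by (meson finite_UN_I finite_subset)
  moreover have "cyclic_group (G\<lparr>carrier := H\<rparr>)"
  proof -
    have "group (G\<lparr>carrier := H\<rparr>)"
      using H by (rule subgroup_imp_group)
    moreover have "g0 \<in> H"
      unfolding H_def by (rule range_eqI[of _ _ "1::int"]) simp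
    moreover have "H = range (\<lambda>n::int. g0 [^]\<^bsub>G\<lparr>carrier := H\<rparr>\<^esub> n)"
    proof -
      have "(\<lambda>n::int. g0 [^] n) = (\<lambda>n. g0 [^]\<^bsub>G\<lparr>carrier := H\<rparr>\<^esub> n)"
        by (intro ext int_pow_consistent H \<open>g0 \<in> H\<close>)
      then show ?thesis
        using H_def by simp
    qed
    ultimately show ?thesis
      by (auto simp: group.cyclic_group)
  qed
  ultimately show ?thesis
    using H by (auto simp: virtually_cyclic_def)
qed

end

section \<open>Independent axes, half-spaces and geodesics that end along an axis\<close>

context contracting_axis
begin

lemma axis_act_contracting:
  assumes "f \<in> carrier G"
  shows "closed (\<phi> f ` axis)" "alpha_contracting \<alpha> (\<phi> f ` axis)"
  using closed_act[OF assms closed_axis] alpha_contracting_act[OF assms _ contracting_axis] \<alpha>_pos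
  by (auto simp: axis_def)

lemma axis_projection_exists:
  assumes "f \<in> carrier G"
  obtains q where "q \<in> projection (\<phi> f ` axis) {x}"
  using projection_exists[OF proper_space axis_act_contracting(1)[OF assms]] by auto

text \<open>A conjugate of a power of \<open>g0\<close> slides the translated axis along itself, and
  a large power moves \<open>p\<close> as far as desired.\<close>

lemma axis_act_translation:
  assumes f: "f \<in> carrier G"
  obtains u where "u \<in> carrier G" "\<phi> u ` \<phi> f ` axis = \<phi> f ` axis" "R < dist p (\<phi> u p)"
proof -
  obtain n :: int where n: "R < dist (\<phi> (inv f) p) (\<phi> (g0 [^] n) (\<phi> (inv f) p))"
    using ex_axis_dist_gt by blast
  define u where "u = f \<otimes> g0 [^] n \<otimes> inv f"
  have "\<phi> u ` \<phi> f ` axis = \<phi> f ` \<phi> (g0 [^] n) ` axis"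
    using f by (simp add: u_def image_image act_mult)
  moreover have "dist p (\<phi> u p) = dist (\<phi> (inv f) p) (\<phi> (g0 [^] n) (\<phi> (inv f) p))"
    using f by (simp add: u_def act_mult dist_act_left)
  ultimately show thesis
    using that[of u] n f by (simp add: u_def axis_translate)
qed

text \<open>If \<open>x\<close> projects on the axis far from \<open>p\<close>, then a geodesic from \<open>x\<close> to any point of the
  independent translate runs along the axis before passing close to \<open>p\<close>; hence \<open>x\<close> projects on
  the translate close to \<open>p\<close>.\<close>

lemma independent_axes:
  assumes "\<not> virtually_cyclic G"
  obtains F D where "finite F" "F \<subseteq> carrier G"
    "\<And>x. \<exists>f\<in>F. \<forall>q\<in>projection (\<phi> f ` axis) {x}. dist q p \<le> D"
proof -
  obtain f where f: "f \<in> carrier G" and bdd: "bounded (projection axis (\<phi> f ` axis))"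
    using assms virtually_cyclicI by blast
  from bdd obtain D1 where D1: "\<And>q. q \<in> projection axis (\<phi> f ` axis) \<Longrightarrow> dist q p \<le> D1"
    by (metis bounded_any_center dist_commute)
  note ax = closed_axis[folded axis_def] contracting_axis[folded axis_def] \<alpha>_pos
  define a0 where "a0 = \<phi> f y"
  have a0: "a0 \<in> \<phi> f ` axis"
    by (auto simp: a0_def axis_def intro!: imageI range_eqI[of _ _ "0::int"])
  \<comment> \<open>The first term serves when \<open>x\<close> projects near \<open>p\<close> on
    the axis, the second is the bound obtained on the translate otherwise; \<open>a0\<close> is a
    fixed point of the translate to compare with.\<close>
  define D where "D = max (D1 + \<alpha>) (dist p a0 + 2 * D1 + 8 * \<alpha>)"
  have "\<exists>f\<in>{\<one>, f}. \<forall>q\<in>projection (\<phi> f ` axis) {x}. dist q p \<le> D" for x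
  proof (cases "\<forall>q\<in>projection axis {x}. dist q p \<le> D1 + \<alpha>")
    case True
    then show ?thesis by (force simp: D_def)
  next
    case False
    then obtain q where q: "q \<in> projection axis {x}" "D1 + \<alpha> < dist q p"
      by auto
    have "dist a p \<le> D" if a: "a \<in> projection (\<phi> f ` axis) {x}" for a
    proof -
      obtain q' where q': "q' \<in> projection axis {a}"
        using projection_exists[OF proper_space ax(1)] by auto
      have q'p: "dist q' p \<le> D1"
        using q' a by (intro D1) (auto simp: projection_def)
      then have "\<alpha> < dist q q'"
        using q(2) dist_triangle[of q p q'] by linarith
      then have "dist x q + dist q q' + dist q' a \<le> dist x a + 8 * \<alpha>"
        using contracting_dist[OF proper_space geodesic_space ax q(1) q'] by simp
      moreover have "dist x q' \<le> dist x q + dist q q'"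
        by (rule dist_triangle)
      moreover have "dist x p \<le> dist x q' + D1" "dist a p \<le> dist q' a + D1"
        using q'p dist_triangle[of x p q'] dist_triangle[of a p q'] by (auto simp: dist_commute)
      moreover have "dist x a \<le> dist x a0"
        using a a0 by (auto simp: projection_singleton_iff intro: infdist_le)
      moreover have "dist x a0 \<le> dist x p + dist p a0"
        by (rule dist_triangle)
      ultimately show ?thesis
        unfolding D_def by linarith
    qed
    then show ?thesis by blast
  qed
  then show thesis
    using that[of "{\<one>, f}" D] f by auto
qed

text \<open>\<open>V f\<close> consists of points with a projection on the
  \<open>f\<close>-translate of the axis far from \<open>p\<close>. If \<open>x\<close> projects
  near \<open>p\<close> on it, \<open>contracting_dist\<close> shows that a path from
  \<open>x\<close> to a point of \<open>V f\<close> can go through \<open>p\<close> at bounded extra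
  cost. The covering property will force the measure to charge the closure of
  \<open>V f\<close>.\<close>

lemma visible_half_spaces:
  assumes "\<not> virtually_cyclic G"
  obtains F V r where "finite F" "F \<subseteq> carrier G"
    "\<And>x. \<exists>f\<in>F. \<forall>z\<in>V f. dist x p + dist p z \<le> dist x z + 2 * r"
    "\<And>f. f \<in> F \<Longrightarrow> \<exists>u\<in>carrier G. V f \<union> \<phi> u ` V f = UNIV"
proof -
  obtain F D where F: "finite F" "F \<subseteq> carrier G"
    and D: "\<And>x. \<exists>f\<in>F. \<forall>q\<in>projection (\<phi> f ` axis) {x}. dist q p \<le> D"
    using independent_axes[OF assms] by metis
  define V where "V = (\<lambda>f. {z. \<exists>q\<in>projection (\<phi> f ` axis) {z}. D + \<alpha> < dist q p})"
  have "\<exists>f\<in>F. \<forall>z\<in>V f. dist x p + dist p z \<le> dist x z + 2 * (D + 4 * \<alpha>)" for x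
  proof -
    obtain f where f: "f \<in> F" and qD: "\<And>q. q \<in> projection (\<phi> f ` axis) {x} \<Longrightarrow> dist q p \<le> D"
      using D by blast
    have fG: "f \<in> carrier G" using f F by auto
    obtain q where q: "q \<in> projection (\<phi> f ` axis) {x}"
      using axis_projection_exists[OF fG] by blast
    have "dist x p + dist p z \<le> dist x z + 2 * (D + 4 * \<alpha>)" if "z \<in> V f" for z
    proof -
      obtain q' where q': "q' \<in> projection (\<phi> f ` axis) {z}" "D + \<alpha> < dist q' p"
        using \<open>z \<in> V f\<close> by (auto simp: V_def)
      then have "\<alpha> < dist q q'"
        using qD[OF q] dist_triangle3[of q' p q] by linarith
      then have "dist x q + dist q q' + dist q' z \<le> dist x z + 8 * \<alpha>"
        by (intro contracting_dist[OF proper_space geodesic_space axis_act_contracting[OF fG] \<alpha>_pos q q'(1)])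
      moreover have "dist x p \<le> dist x q + D" "dist p z \<le> D + dist q z" "dist q z \<le> dist q q' + dist q' z"
        using qD[OF q] dist_triangle[of x p q] dist_triangle[of p z q] dist_triangle[of q z q']
        by (simp_all add: dist_commute)
      ultimately have "dist x p + dist p z \<le> (dist x q + D) + (D + dist q z)"
        "dist q z + dist x q \<le> dist x z + 8 * \<alpha>"
        by linarith+
      then show ?thesis by simp
    qed
    then show ?thesis using f by blast
  qed
  moreover have "\<exists>u\<in>carrier G. V f \<union> \<phi> u ` V f = UNIV" if f: "f \<in> F" for f
  proof -
    have fG: "f \<in> carrier G" using f F by auto
    \<comment> \<open>Sliding by more than twice \<open>D + \<alpha>\<close> moves projections close
      to \<open>p\<close> away from \<open>p\<close>, so the complement of \<open>V f\<close> lies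
      in the translate of \<open>V f\<close>.\<close>
    obtain u where u: "u \<in> carrier G" "\<phi> u ` \<phi> f ` axis = \<phi> f ` axis" "2 * (D + \<alpha>) < dist p (\<phi> u p)"
      by (rule axis_act_translation[OF fG])
    have "z \<in> \<phi> u ` V f" if "z \<notin> V f" for z
    proof -
      obtain q where q: "q \<in> projection (\<phi> f ` axis) {\<phi> (inv u) z}"
        using axis_projection_exists[OF fG] by blast
      have "\<phi> u q \<in> projection (\<phi> u ` \<phi> f ` axis) {\<phi> u (\<phi> (inv u) z)}"
        unfolding projection_act_singleton[OF u(1)] using q by blast
      then have "\<phi> u q \<in> projection (\<phi> f ` axis) {z}"
        using u by simp
      then have "dist (\<phi> u q) p \<le> D + \<alpha>"
        using \<open>z \<notin> V f\<close> by (auto simp: V_def not_less)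
      moreover have "dist p (\<phi> u p) \<le> dist (\<phi> u q) p + dist (\<phi> u q) (\<phi> u p)"
        by (rule dist_triangle3)
      ultimately have "D + \<alpha> < dist q p"
        using u by simp
      then have "\<phi> (inv u) z \<in> V f"
        using q by (auto simp: V_def)
      then show ?thesis
        using u(1) by (metis act_act_inv imageI)
    qed
    then show ?thesis using u(1) by blast
  qed
  ultimately show thesis
    using that[OF F, of V] by blast
qed

text \<open>\<open>S\<close> consists of the \<open>g\<close> such that a geodesic from \<open>p\<close> to \<open>g p\<close> ends by following a translated
  axis for a long, but bounded, time. A geodesic from \<open>p\<close> to a point in the shadow of \<open>g p\<close> enters
  this axis at the same place, hence passes close to \<open>g p\<close>.\<close>

lemma contracting_tails:
  assumes "\<not> virtually_cyclic G"
  obtains S U K where "S \<subseteq> carrier G" "finite U" "U \<subseteq> carrier G"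
    "\<And>g. g \<in> carrier G \<Longrightarrow> \<exists>u\<in>U. g \<otimes> u \<in> S"
    "\<And>g h z. g \<in> S \<Longrightarrow> h \<in> S \<Longrightarrow> dist p (\<phi> g p) + dist (\<phi> g p) z \<le> dist p z + 2 * r \<Longrightarrow>
       dist p (\<phi> h p) + dist (\<phi> h p) z \<le> dist p z + 2 * r \<Longrightarrow> dist p (\<phi> g p) \<le> dist p (\<phi> h p) \<Longrightarrow>
       dist p (\<phi> g p) + dist (\<phi> g p) (\<phi> h p) \<le> dist p (\<phi> h p) + K"
proof -
  obtain F D where F: "finite F" "F \<subseteq> carrier G"
    and D: "\<And>x. \<exists>f\<in>F. \<forall>q\<in>projection (\<phi> f ` axis) {x}. dist q p \<le> D"
    using independent_axes[OF assms] by metis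
  define d where "d = Max ((\<lambda>f. dist p (\<phi> f y)) ` F)"
  have d: "dist p (\<phi> f y) \<le> d" if "f \<in> F" for f
    unfolding d_def using F(1) that by auto
  \<comment> \<open>The threshold of \<open>contracting_tail\<close>. A translation by more than
    \<open>L + D\<close> then carries a projection within \<open>D\<close> of \<open>p\<close>
    beyond this threshold.\<close>
  define L where "L = r + 9 * \<alpha> + 2 * d"
  have "\<forall>f\<in>F. \<exists>u. u \<in> carrier G \<and> \<phi> u ` \<phi> f ` axis = \<phi> f ` axis \<and> L + D < dist p (\<phi> u p)"
  proof
    fix f assume "f \<in> F"
    then have "f \<in> carrier G" using F(2) by auto
    then obtain u where "u \<in> carrier G" "\<phi> u ` \<phi> f ` axis = \<phi> f ` axis" "L + D < dist p (\<phi> u p)"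
      by (rule axis_act_translation)
    then show "\<exists>u. u \<in> carrier G \<and> \<phi> u ` \<phi> f ` axis = \<phi> f ` axis \<and> L + D < dist p (\<phi> u p)"
      by blast
  qed
  from bchoice[OF this] obtain u where
    "\<forall>f\<in>F. u f \<in> carrier G \<and> \<phi> (u f) ` \<phi> f ` axis = \<phi> f ` axis \<and> L + D < dist p (\<phi> (u f) p)"
    by (elim exE)
  then have u: "\<And>f. f \<in> F \<Longrightarrow> u f \<in> carrier G"
    "\<And>f. f \<in> F \<Longrightarrow> \<phi> (u f) ` \<phi> f ` axis = \<phi> f ` axis" "\<And>f. f \<in> F \<Longrightarrow> L + D < dist p (\<phi> (u f) p)"
    by simp_all
  \<comment> \<open>The translated projections also stay within \<open>L'\<close> of
    \<open>p\<close>: passing close to the projection then means passing close to the orbit point,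
    with constant \<open>K\<close>.\<close>
  define L' where "L' = Max ((\<lambda>f. dist p (\<phi> (u f) p)) ` F) + D"
  have L': "dist p (\<phi> (u f) p) + D \<le> L'" if "f \<in> F" for f
    unfolding L'_def using F(1) that by auto
  define S where "S = {g \<in> carrier G. \<exists>f\<in>F. \<exists>q\<in>projection (\<phi> f ` axis) {\<phi> (inv g) p}. L < dist q p \<and> dist q p \<le> L'}"
  define K where "K = 2 * \<alpha> + L'"
  have tail: "\<exists>t\<in>{b..c}. dist (\<gamma> t) (\<phi> g p) \<le> K"
    if g: "g \<in> S" and z: "dist p (\<phi> g p) + dist (\<phi> g p) z \<le> dist p z + 2 * r"
      and \<gamma>: "geodesic_path \<gamma> {b..c}" "b \<le> c" "\<gamma> b = p" "\<gamma> c = z" for g z \<gamma> b c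
  proof -
    obtain f q where f: "f \<in> F" and q: "q \<in> projection (\<phi> f ` axis) {\<phi> (inv g) p}" "L < dist q p" "dist q p \<le> L'"
      using g by (auto simp: S_def)
    have G: "g \<in> carrier G" "inv g \<in> carrier G" "f \<in> carrier G"
      using g f F by (auto simp: S_def)
    have "\<phi> f y \<in> \<phi> f ` axis"
      by (auto simp: axis_def intro!: imageI range_eqI[of _ _ "0::int"])
    moreover have "dist (\<phi> (inv g) p) p + dist p (\<phi> (inv g) z) \<le> dist (\<phi> (inv g) p) (\<phi> (inv g) z) + 2 * r"
      using z G by (simp add: dist_act_left)
    ultimately obtain t where t: "t \<in> {b..c}" "dist (\<phi> (inv g) (\<gamma> t)) q \<le> 2 * \<alpha>"
      using contracting_tail[OF proper_space geodesic_space axis_act_contracting[OF G(3)] \<alpha>_pos _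
          d[OF f] q(1) q(2)[unfolded L_def] _ geodesic_path_act[OF G(2) \<gamma>(1)] \<gamma>(2)] \<gamma>(3,4)
      by metis
    have "dist (\<gamma> t) (\<phi> g p) = dist (\<phi> (inv g) (\<gamma> t)) p"
      using G by (simp add: dist_act_left)
    also have "\<dots> \<le> K"
      unfolding K_def using t(2) q(3) dist_triangle[of "\<phi> (inv g) (\<gamma> t)" p q] by linarith
    finally show ?thesis using t(1) by blast
  qed
  show thesis
  proof (rule that[of S "(\<lambda>f. inv (u f)) ` F" "4 * K"])
    show "S \<subseteq> carrier G" by (auto simp: S_def)
    show "finite ((\<lambda>f. inv (u f)) ` F)" using F(1) by simp
    show "(\<lambda>f. inv (u f)) ` F \<subseteq> carrier G" using u(1) by auto
  next
    fix g assume g: "g \<in> carrier G"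
    obtain f where f: "f \<in> F" and qD: "\<And>q. q \<in> projection (\<phi> f ` axis) {\<phi> (inv g) p} \<Longrightarrow> dist q p \<le> D"
      using D by blast
    have fG: "f \<in> carrier G" using f F by auto
    obtain q where q: "q \<in> projection (\<phi> f ` axis) {\<phi> (inv g) p}"
      using axis_projection_exists[OF fG] by blast
    \<comment> \<open>Multiplying \<open>g\<close> on the right by the inverse of \<open>u f\<close>
      applies \<open>u f\<close> to \<open>\<phi> (inv g) p\<close>, hence slides its projection
      along the axis.\<close>
    have "\<phi> (u f) q \<in> projection (\<phi> (u f) ` \<phi> f ` axis) {\<phi> (u f) (\<phi> (inv g) p)}"
      unfolding projection_act_singleton[OF u(1)[OF f]] using q by blast
    moreover have "\<phi> (u f) (\<phi> (inv g) p) = \<phi> (inv (g \<otimes> inv (u f))) p"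
      using g u(1)[OF f] by (simp add: inv_mult_group act_mult)
    ultimately have q': "\<phi> (u f) q \<in> projection (\<phi> f ` axis) {\<phi> (inv (g \<otimes> inv (u f))) p}"
      using u(2)[OF f] by simp
    have "dist (\<phi> (u f) q) (\<phi> (u f) p) \<le> D"
      using qD[OF q] u(1)[OF f] by simp
    then have "L < dist (\<phi> (u f) q) p" "dist (\<phi> (u f) q) p \<le> L'"
      using u(3)[OF f] L'[OF f] dist_triangle3[of p "\<phi> (u f) p" "\<phi> (u f) q"]
        dist_triangle[of "\<phi> (u f) q" p "\<phi> (u f) p"] by (auto simp: dist_commute)
    then have "g \<otimes> inv (u f) \<in> S"
      using q' f g u(1)[OF f] by (auto simp: S_def)
    then show "\<exists>v\<in>(\<lambda>f. inv (u f)) ` F. g \<otimes> v \<in> S"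
      using f by blast
  next
    fix g h z
    assume gh: "g \<in> S" "h \<in> S" and z: "dist p (\<phi> g p) + dist (\<phi> g p) z \<le> dist p z + 2 * r"
       "dist p (\<phi> h p) + dist (\<phi> h p) z \<le> dist p z + 2 * r" and le: "dist p (\<phi> g p) \<le> dist p (\<phi> h p)"
    obtain \<gamma> b c where \<gamma>: "b \<le> c" "geodesic_path \<gamma> {b..c}" "\<gamma> b = p" "\<gamma> c = z"
      using geodesic_space unfolding geodesic_space_def by blast
    obtain s t where s: "s \<in> {b..c}" "dist (\<gamma> s) (\<phi> g p) \<le> K" and t: "t \<in> {b..c}" "dist (\<gamma> t) (\<phi> h p) \<le> K"
      using tail[OF gh(1) z(1) \<gamma>(2,1,3,4)] tail[OF gh(2) z(2) \<gamma>(2,1,3,4)] by blast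
    have d: "dist p (\<gamma> s) = s - b" "dist p (\<gamma> t) = t - b" "dist (\<gamma> s) (\<gamma> t) = \<bar>s - t\<bar>"
      using \<gamma>(2) s(1) t(1) \<gamma>(1) unfolding \<gamma>(3)[symmetric] by (auto simp: geodesic_path_def)
    have "dist p (\<phi> g p) \<le> s - b + K" "s - b \<le> dist p (\<phi> g p) + K" "t - b \<le> dist p (\<phi> h p) + K"
      using s(2) t(2) d dist_triangle[of p "\<phi> g p" "\<gamma> s"] dist_triangle2[of p "\<gamma> s" "\<phi> g p"]
        dist_triangle2[of p "\<gamma> t" "\<phi> h p"] by linarith+
    moreover have "dist p (\<phi> h p) \<le> t - b + K"
      using t(2) d(2) dist_triangle[of p "\<phi> h p" "\<gamma> t"] by linarith
    moreover have "dist (\<phi> g p) (\<phi> h p) \<le> 2 * K + \<bar>s - t\<bar>"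
      using s(2) t(2) d(3) dist_triangle3[of "\<phi> g p" "\<phi> h p" "\<gamma> s"] dist_triangle[of "\<gamma> s" "\<phi> h p" "\<gamma> t"]
      by linarith
    \<comment> \<open>If \<open>s \<le> t\<close>, the points occur in this order up to errors
      \<open>K\<close>. If \<open>t < s\<close>, the assumption on distances bounds
      \<open>s - t\<close> by \<open>2 * K\<close>. Either way the total error is
      \<open>4 * K\<close>.\<close>
    ultimately show "dist p (\<phi> g p) + dist (\<phi> g p) (\<phi> h p) \<le> dist p (\<phi> h p) + 4 * K"
      using le by linarith
  qed
qed

end

section \<open>The horocompactification\<close>

lemma cocycle_open_eval:
  assumes "open U"
  shows "cocycle_open {c \<in> cocycles. c x y \<in> U}"
  unfolding cocycle_open_def
proof (intro conjI ballI)
  fix c assume c: "c \<in> {c \<in> cocycles. c x y \<in> U}"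
  then obtain e where "e > 0" "\<And>t. \<bar>t - c x y\<bar> < e \<Longrightarrow> t \<in> U"
    using assms by (auto simp: open_dist dist_real_def)
  then have "compact_nhd {(x, y)} e c \<subseteq> {c \<in> cocycles. c x y \<in> U}"
    by (auto simp: compact_nhd_def)
  then show "\<exists>K e. compact K \<and> e > 0 \<and> compact_nhd K e c \<subseteq> {c \<in> cocycles. c x y \<in> U}"
    using \<open>e > 0\<close> by (intro exI[of _ "{(x, y)}"] exI[of _ e]) auto
qed auto

lemma topspace_cocycle_topology [simp]: "topspace cocycle_topology = cocycles"
proof
  show "topspace cocycle_topology \<subseteq> (cocycles :: 'a cocycle set)"
    using openin_topspace[of cocycle_topology] unfolding openin_cocycle_topology
    by (auto simp: cocycle_open_def)
  have "openin cocycle_topology (cocycles :: 'a cocycle set)"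
    using cocycle_open_eval[of UNIV] by (simp add: openin_cocycle_topology)
  then show "cocycles \<subseteq> topspace (cocycle_topology :: 'a cocycle topology)"
    by (rule openin_subset)
qed

lemma openin_eval:
  "open U \<Longrightarrow> openin cocycle_topology {c \<in> cocycles. c x y \<in> U}"
  using cocycle_open_eval by (simp add: openin_cocycle_topology)

lemma closedin_eval:
  assumes "closed C"
  shows "closedin cocycle_topology {c \<in> cocycles. c x y \<in> C}"
proof -
  have "cocycles - {c \<in> cocycles. c x y \<in> C} = {c \<in> cocycles. c x y \<in> - C}"
    by auto
  then show ?thesis
    using assms openin_eval[of "- C"] by (auto simp: closedin_def)
qed

lemma Hausdorff_cocycle_topology: "Hausdorff_space cocycle_topology"
  unfolding Hausdorff_space_def topspace_cocycle_topology
proof (intro allI impI)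
  fix c c' :: "'a cocycle" assume c: "c \<in> cocycles \<and> c' \<in> cocycles \<and> c \<noteq> c'"
  then obtain x y where "c x y \<noteq> c' x y" by (auto simp: fun_eq_iff)
  then obtain U V where "open U" "open V" "c x y \<in> U" "c' x y \<in> V" "U \<inter> V = {}"
    using hausdorff[of "c x y" "c' x y"] by blast
  then show "\<exists>U V. openin cocycle_topology U \<and> openin cocycle_topology V \<and> c \<in> U \<and> c' \<in> V \<and> disjnt U V"
    using c openin_eval[of U x y] openin_eval[of V x y]
    by (intro exI[of _ "{c \<in> cocycles. c x y \<in> U}"] exI[of _ "{c \<in> cocycles. c x y \<in> V}"])
       (auto simp: disjnt_def)
qed

lemma point_cocycle_in_cocycles [simp]: "point_cocycle z \<in> cocycles"
  by (auto simp: cocycles_def point_cocycle_def case_prod_beta intro!: continuous_intros)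

lemma continuous_map_point_cocycle: "continuous_map euclidean cocycle_topology point_cocycle"
  unfolding continuous_map_def
proof (intro conjI allI impI)
  fix U :: "'a cocycle set" assume U: "openin cocycle_topology U"
  have "\<exists>d>0. \<forall>z'. dist z' z < d \<longrightarrow> point_cocycle z' \<in> U" if z: "point_cocycle z \<in> U" for z
  proof -
    obtain K e where K: "e > 0" "compact_nhd K e (point_cocycle z) \<subseteq> U"
      using cocycle_openD[OF _ z] U by (auto simp: openin_cocycle_topology)
    have "point_cocycle z' \<in> U" if "dist z' z < e / 2" for z'
    proof -
      have "\<bar>point_cocycle z' x y - point_cocycle z x y\<bar> < e" for x y
        using that dist_triangle[of x z' z] dist_triangle[of x z z'] dist_triangle[of y z' z] dist_triangle[of y z z']
        by (simp add: point_cocycle_def dist_commute)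
      then have "point_cocycle z' \<in> compact_nhd K e (point_cocycle z)"
        by (auto simp: compact_nhd_def)
      then show ?thesis using K by auto
    qed
    then show ?thesis using K(1) by (intro exI[of _ "e / 2"]) auto
  qed
  then show "openin euclidean {z \<in> topspace euclidean. point_cocycle z \<in> U}"
    by (auto simp: open_dist)
qed auto

lemma closedin_horocompactification: "closedin cocycle_topology horocompactification"
  by (simp add: horocompactification_def)

lemma horocompactification_subset: "horocompactification \<subseteq> cocycles"
  using closedin_subset[OF closedin_horocompactification] by simp

lemma point_cocycle_in_horocompactification [simp]: "point_cocycle z \<in> horocompactification"
  unfolding horocompactification_def by (rule subsetD[OF closure_of_subset]) auto

lemma horocompactification_minimal:
  assumes "closedin cocycle_topology C" "\<And>z. point_cocycle z \<in> C"
  shows "horocompactification \<subseteq> C"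
  unfolding horocompactification_def using assms by (intro closure_of_minimal) auto

text \<open>For points this is the triangle inequality, and it is a closed condition on the
  cocycle.\<close>

lemma cocycle_le_dist:
  assumes "c \<in> horocompactification"
  shows "c x y \<le> dist x y"
proof -
  have "horocompactification \<subseteq> {c \<in> cocycles. c x y \<in> {..dist x y}}"
  proof (rule horocompactification_minimal[OF closedin_eval])
    show "point_cocycle z \<in> {c \<in> cocycles. c x y \<in> {..dist x y}}" for z
      using dist_triangle[of x z y] point_cocycle_in_cocycles[of z]
      by (simp add: point_cocycle_def del: point_cocycle_in_cocycles)
  qed simp
  then show ?thesis using assms by auto
qed

lemma cocycle_add:
  "c \<in> horocompactification \<Longrightarrow> c x z = c x y + c y z"
  using horocompactification_subset by (auto simp: cocycles_def)

lemma cocycle_swap: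
  assumes "c \<in> horocompactification"
  shows "c y x = - c x y"
  using cocycle_add[OF assms, of x x x] cocycle_add[OF assms, of x x y] by simp

text \<open>Two values are approximated by the same point, as needed for a cocycle lying in two
  shadows.\<close>

lemma horocompactification_approx:
  assumes c: "c \<in> horocompactification" and "e > 0"
  obtains z where "\<bar>point_cocycle z x y - c x y\<bar> < e" "\<bar>point_cocycle z x' y' - c x' y'\<bar> < e"
proof -
  define T where "T = {d \<in> cocycles. d x y \<in> ball (c x y) e} \<inter> {d \<in> cocycles. d x' y' \<in> ball (c x' y') e}"
  have "openin cocycle_topology T"
    unfolding T_def by (intro openin_Int openin_eval) auto
  moreover have "c \<in> T"
    using assms horocompactification_subset by (auto simp: T_def)
  ultimately obtain d where "d \<in> range point_cocycle" "d \<in> T"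
    using c unfolding horocompactification_def in_closure_of by blast
  then show thesis
    using that by (auto simp: T_def dist_real_def abs_minus_commute)
qed

lemma space_horoborel [simp]: "space horoborel = horocompactification"
  unfolding horoborel_def using horocompactification_subset
  by (intro space_measure_of) (auto simp: openin_subtopology)

lemma horoborel_openI:
  assumes "openin cocycle_topology U"
  shows "U \<inter> horocompactification \<in> sets horoborel"
proof -
  have "{U. openin (subtopology cocycle_topology horocompactification) U} \<subseteq> Pow horocompactification"
    by (auto simp: openin_subtopology)
  then show ?thesis
    using assms by (auto simp: horoborel_def openin_subtopology intro!: sigma_sets.Basic)
qed

lemma horoborel_closedI:
  assumes "closedin cocycle_topology C"
  shows "C \<inter> horocompactification \<in> sets horoborel"
proof -
  have "C \<inter> horocompactification
      = space horoborel - (topspace cocycle_topology - C) \<inter> horocompactification"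
    using horocompactification_subset by auto
  also have "\<dots> \<in> sets horoborel"
    using assms by (intro sets.compl_sets horoborel_openI) (auto simp: closedin_def)
  finally show ?thesis .
qed

lemma measurable_eval [measurable]: "(\<lambda>c. c x y) \<in> borel_measurable horoborel"
proof (rule borel_measurableI)
  fix S :: "real set" assume "open S"
  moreover have "(\<lambda>c. c x y) -` S \<inter> space horoborel = {c \<in> cocycles. c x y \<in> S} \<inter> horocompactification"
    using horocompactification_subset by auto
  ultimately show "(\<lambda>c. c x y) -` S \<inter> space horoborel \<in> sets horoborel"
    using horoborel_openI[OF openin_eval] by simp
qed

lemma shadow_sets [measurable]: "shadow x y r \<in> sets horoborel"
proof -
  have "shadow x y r = {c \<in> space horoborel. 1 / 2 * (dist x y + c y x) \<le> r}"
    by (simp add: shadow_def)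
  also have "\<dots> \<in> sets horoborel" by measurable
  finally show ?thesis .
qed

lemma closedin_shadow:
  "closedin cocycle_topology (shadow x y r)"
proof -
  have "shadow x y r = {c \<in> cocycles. c y x \<in> {..2 * r - dist x y}} \<inter> horocompactification"
    using horocompactification_subset by (auto simp: shadow_def field_simps)
  then show ?thesis
    by (simp only: closedin_Int[OF closedin_eval[OF closed_atMost] closedin_horocompactification])
qed

lemma point_cocycle_in_shadow_iff:
  "point_cocycle z \<in> shadow x y r \<longleftrightarrow> dist x y + dist y z \<le> dist x z + 2 * r"
  using point_cocycle_in_horocompactification[of z]
  by (auto simp: shadow_def point_cocycle_def simp del: point_cocycle_in_horocompactification)

text \<open>A proper space is a countable union of compact balls, whose images are compact, hence
  closed in a Hausdorff space.\<close>

lemma range_point_cocycle_sets: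
  assumes "proper_space TYPE('a::metric_space)"
  shows "range (point_cocycle :: 'a \<Rightarrow> 'a cocycle) \<in> sets horoborel"
proof -
  fix a :: 'a
  have "closedin cocycle_topology (point_cocycle ` cball a (real n))" for n
  proof (rule compactin_imp_closedin[OF Hausdorff_cocycle_topology])
    have "compactin euclidean (cball a (real n))"
      using assms by (simp add: proper_space_def)
    then show "compactin cocycle_topology (point_cocycle ` cball a (real n))"
      using continuous_map_point_cocycle by (rule image_compactin)
  qed
  then have "(\<Union>n. point_cocycle ` cball a (real n) \<inter> horocompactification) \<in> sets horoborel"
    by (intro sets.countable_UN) (auto intro: horoborel_closedI)
  also have "(\<Union>n. point_cocycle ` cball a (real n) \<inter> horocompactification) = range point_cocycle"
  proof
    show "range point_cocycle \<subseteq> (\<Union>n. point_cocycle ` cball a (real n) \<inter> horocompactification)"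
    proof
      fix c :: "'a cocycle" assume "c \<in> range point_cocycle"
      then obtain z where z: "c = point_cocycle z" by auto
      obtain n :: nat where "dist a z \<le> real n"
        using real_arch_simple by blast
      then show "c \<in> (\<Union>n. point_cocycle ` cball a (real n) \<inter> horocompactification)"
        unfolding z by (intro UN_I[of n] IntI imageI) auto
    qed
  qed auto
  finally show ?thesis .
qed

lemma horoboundary_sets:
  assumes "proper_space TYPE('a::metric_space)"
  shows "(horoboundary :: 'a cocycle set) \<in> sets horoborel"
proof -
  have "(horoboundary :: 'a cocycle set) = space horoborel - range point_cocycle"
    by (simp add: horoboundary_def)
  then show ?thesis
    using sets.compl_sets[OF range_point_cocycle_sets[OF assms]] by simp
qed

lemma saturatedI:
  assumes B: "B \<subseteq> horoboundary"
    and closed: "\<And>c c' M. c \<in> B \<Longrightarrow> c' \<in> horoboundary \<Longrightarrow> (\<And>x y. \<bar>c x y - c' x y\<bar> \<le> M) \<Longrightarrow> c' \<in> B"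
  shows "saturated B"
  unfolding saturated_def
proof (intro exI conjI)
  show "(\<lambda>c. horo_equiv `` {c}) ` B \<subseteq> horocompactification // horo_equiv"
    using B by (auto simp: horoboundary_def intro: quotientI)
  show "B = \<Union> ((\<lambda>c. horo_equiv `` {c}) ` B)"
  proof
    show "B \<subseteq> \<Union> ((\<lambda>c. horo_equiv `` {c}) ` B)"
    proof
      fix c assume c: "c \<in> B"
      then have "(c, c) \<in> horo_equiv"
        using B by (auto simp: horo_equiv_def intro!: exI[of _ "0::real"])
      then show "c \<in> \<Union> ((\<lambda>c. horo_equiv `` {c}) ` B)"
        using c by auto
    qed
    show "\<Union> ((\<lambda>c. horo_equiv `` {c}) ` B) \<subseteq> B"
      using B closed by (auto simp: horo_equiv_def horoboundary_def)
  qed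
qed

text \<open>On saturated Borel subsets of the horoboundary nothing is lost by reducing the
  \<sigma>-algebra, so the analysis can be done on the full Borel \<sigma>-algebra.\<close>

lemma emeasure_reduced_restriction:
  fixes M :: "'a::metric_space cocycle measure"
  assumes proper: "proper_space TYPE('a)" and M: "sets M = sets horoborel"
    and B: "B \<in> sets horoborel" "B \<subseteq> horoboundary" "saturated B"
  shows "emeasure (reduced_restriction M) B = emeasure M B"
proof -
  have sp: "space M = horocompactification"
    using sets_eq_imp_space_eq[OF M] by simp
  have gen: "{B \<in> sets horoborel. saturated B} \<subseteq> Pow (horocompactification :: 'a cocycle set)"
    using sets.sets_into_space[where M = "horoborel :: 'a cocycle measure"] by auto
  have sub: "subalgebra M reduced_algebra"
    unfolding subalgebra_def
  proof
    show "space reduced_algebra = space M"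
      using gen by (simp add: reduced_algebra_def sp space_measure_of)
    have "sigma_sets (space horoborel) {B \<in> sets horoborel. saturated B} \<subseteq> sets (horoborel :: 'a cocycle measure)"
      by (intro sets.sigma_sets_subset) auto
    then show "sets reduced_algebra \<subseteq> sets M"
      using gen by (simp add: reduced_algebra_def M)
  qed
  have red: "C \<in> sets reduced_algebra" if "C \<in> sets horoborel" "saturated C" for C :: "'a cocycle set"
    using gen that by (auto simp: reduced_algebra_def)
  have "saturated (horoboundary :: 'a cocycle set)"
    by (rule saturatedI) auto
  then have bd: "horoboundary \<in> sets (restr_to_subalg M reduced_algebra)"
    using red[OF horoboundary_sets[OF proper]] sub by (simp add: sets_restr_to_subalg)
  have "emeasure (reduced_restriction M) B = emeasure (restr_to_subalg M reduced_algebra) B"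
    unfolding reduced_restriction_def
    using bd B(2) by (intro emeasure_restrict_space) auto
  also have "\<dots> = emeasure M B"
    by (intro emeasure_restr_to_subalg[OF sub] red B)
  finally show ?thesis .
qed

section \<open>Quasi-independent families of events\<close>

text \<open>A second-moment argument. \<open>E n\<close> is where the count \<open>X n\<close> is at
  least half its mean \<open>q n / m\<close>; the total mass \<open>m\<close> is kept because it
  need not be 1. Quasi-independence keeps the measure of \<open>E n\<close> above
  \<open>1 / (4 * C)\<close>, and a point in infinitely many \<open>E n\<close> has unbounded
  counts.\<close>

lemma (in finite_measure) kochen_stone:
  fixes F :: "nat \<Rightarrow> 'i set"
  assumes fin: "\<And>n. finite (F n)" and A: "\<And>n i. i \<in> F n \<Longrightarrow> A i \<in> sets M"
    and q: "filterlim (\<lambda>n. \<Sum>i\<in>F n. measure M (A i)) at_top sequentially"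
    and "0 < C" and quasi: "\<forall>\<^sub>F n in sequentially.
      (\<Sum>i\<in>F n. \<Sum>j\<in>F n. measure M (A i \<inter> A j)) \<le> C * (\<Sum>i\<in>F n. measure M (A i))\<^sup>2"
    and B: "B \<in> sets M" "\<And>x. x \<in> space M \<Longrightarrow> infinite {i \<in> (\<Union>n. F n). x \<in> A i} \<Longrightarrow> x \<in> B"
  shows "0 < measure M B"
proof -
  define q where "q = (\<lambda>n. \<Sum>i\<in>F n. measure M (A i))"
  define m where "m = measure M (space M)"
  define X :: "nat \<Rightarrow> 'a \<Rightarrow> real" where "X = (\<lambda>n x. \<Sum>i\<in>F n. indicator (A i) x)"
  define E where "E = (\<lambda>n. {x \<in> space M. q n / 2 \<le> X n x * m})"
  have [measurable]: "X n \<in> borel_measurable M" for n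
    unfolding X_def using A by (intro borel_measurable_sum borel_measurable_indicator) auto
  have E [measurable]: "E n \<in> sets M" for n
    unfolding E_def by measurable
  have X_nonneg: "0 \<le> X n x" for n x
    unfolding X_def by (intro sum_nonneg) auto
  have intX: "integrable M (X n)" "(\<integral>x. X n x \<partial>M) = q n" for n
    unfolding X_def q_def using A by (auto simp: sets.sets_into_space Int_absorb1 emeasure_eq_measure)
  have X2: "(X n x)\<^sup>2 = (\<Sum>i\<in>F n. \<Sum>j\<in>F n. indicator (A i \<inter> A j) x)" for n x
    by (simp add: X_def power2_eq_square sum_product indicator_inter_arith)
  have intX2: "integrable M (\<lambda>x. (X n x)\<^sup>2)"
      "(\<integral>x. (X n x)\<^sup>2 \<partial>M) = (\<Sum>i\<in>F n. \<Sum>j\<in>F n. measure M (A i \<inter> A j))" for n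
    unfolding X2 using A
    by (auto simp: sets.sets_into_space Int_absorb1 emeasure_eq_measure sets.Int le_infI1
        intro!: Bochner_Integration.integrable_sum)
  have m_pos: "0 < m" if "0 < q n" for n
  proof (rule ccontr)
    assume "\<not> 0 < m"
    then have "m = 0"
      using measure_nonneg[of M "space M"] by (simp add: m_def)
    then have "measure M (A i) = 0" for i
      using bounded_measure[of "A i"] measure_nonneg[of M "A i"] by (simp add: m_def)
    then show False
      using that by (simp add: q_def)
  qed
  have q_pos: "\<forall>\<^sub>F n in sequentially. 0 < q n"
    using q unfolding q_def filterlim_at_top_dense by blast
  have large: "\<forall>\<^sub>F n in sequentially. 1 / (4 * C) \<le> measure M (E n)"
    using q_pos quasi
  proof eventually_elim
    case (elim n)
    note qn = elim(1)
    \<comment> \<open>A pointwise substitute for the Cauchy-Schwarz inequality: off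
      \<open>E n\<close> the first term suffices, on \<open>E n\<close> the other two do.\<close>
    have pw: "X n x \<le> q n / (2 * m) + (X n x)\<^sup>2 / (4 * C * q n) + C * q n * indicator (E n) x"
      if "x \<in> space M" for x
    proof (cases "x \<in> E n")
      case False
      then have "X n x \<le> q n / (2 * m)"
        using that m_pos[OF qn] by (auto simp: E_def field_simps)
      moreover have "0 \<le> (X n x)\<^sup>2 / (4 * C * q n)"
        using \<open>0 < C\<close> qn by simp
      ultimately show ?thesis using False by simp
    next
      case True
      txt \<open>AM-GM with weights for which the quadratic term integrates to at most \<open>q n / 4\<close>.\<close>
      have "0 \<le> (X n x - 2 * C * q n)\<^sup>2 / (4 * C * q n)"
        using \<open>0 < C\<close> qn by simp
      also have "\<dots> = (X n x)\<^sup>2 / (4 * C * q n) - X n x + C * q n"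
        using \<open>0 < C\<close> qn by (simp add: field_simps power2_eq_square)
      finally have "X n x \<le> (X n x)\<^sup>2 / (4 * C * q n) + C * q n" by simp
      moreover have "0 \<le> q n / (2 * m)"
        using qn m_pos[OF qn] by simp
      ultimately show ?thesis using True by simp
    qed
    have "q n = (\<integral>x. X n x \<partial>M)"
      by (simp add: intX)
    also have "\<dots> \<le> (\<integral>x. q n / (2 * m) + (X n x)\<^sup>2 / (4 * C * q n) + C * q n * indicator (E n) x \<partial>M)"
      using pw E by (intro integral_mono intX Bochner_Integration.integrable_add integrable_divide intX2
          integrable_mult_right) (auto simp: emeasure_eq_measure)
    also have "\<dots> = q n / 2 + (\<integral>x. (X n x)\<^sup>2 \<partial>M) / (4 * C * q n) + C * q n * measure M (E n)"
      using E m_pos[OF qn] intX2(1) by (subst Bochner_Integration.integral_add integral_divide_zero;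
          (intro Bochner_Integration.integrable_add integrable_divide intX2
          integrable_mult_right)?)+ (auto simp: emeasure_eq_measure m_def)
    also have "(\<integral>x. (X n x)\<^sup>2 \<partial>M) / (4 * C * q n) \<le> C * (q n)\<^sup>2 / (4 * C * q n)"
      using elim(2) \<open>0 < C\<close> qn unfolding intX2 q_def by (intro divide_right_mono) auto
    also have "C * (q n)\<^sup>2 / (4 * C * q n) = q n / 4"
      using \<open>0 < C\<close> qn by (simp add: power2_eq_square)
    \<comment> \<open>The first two terms integrate to at most \<open>q n / 2\<close> and
      \<open>q n / 4\<close>; the last one must supply the missing quarter.\<close>
    finally have "q n * (1 / (4 * C)) \<le> q n * measure M (E n)"
      using \<open>0 < C\<close> by (simp add: field_simps)
    then show ?case
      using qn by (simp only: mult_le_cancel_left_pos)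
  qed
  \<comment> \<open>The intersection of the \<open>D k\<close> is the limit superior of the
    \<open>E n\<close>; continuity from above preserves the lower bound.\<close>
  define D where "D = (\<lambda>k. \<Union>n\<in>{k..}. E n)"
  have D [measurable]: "D k \<in> sets M" for k
    unfolding D_def by measurable
  have "decseq D"
    by (auto simp: D_def decseq_def intro: order_trans)
  then have lim: "(\<lambda>k. measure M (D k)) \<longlonglongrightarrow> measure M (\<Inter>k. D k)"
    by (intro finite_Lim_measure_decseq) auto
  have "1 / (4 * C) \<le> measure M (\<Inter>k. D k)"
  proof (rule tendsto_lowerbound[OF lim])
    show "\<forall>\<^sub>F k in sequentially. 1 / (4 * C) \<le> measure M (D k)"
      using large
    proof eventually_elim
      case (elim k)
      have "measure M (E k) \<le> measure M (D k)"
        by (intro finite_measure_mono D) (auto simp: D_def)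
      with elim show ?case by simp
    qed
  qed simp
  moreover have "(\<Inter>k. D k) \<subseteq> B"
  proof
    fix x assume x: "x \<in> (\<Inter>k. D k)"
    have xM: "x \<in> space M"
      using x D sets.sets_into_space by blast
    show "x \<in> B"
    proof (rule B(2)[OF xM], rule notI)
      assume fin': "finite {i \<in> (\<Union>n. F n). x \<in> A i}" (is "finite ?I")
      have Xc: "X n x \<le> card ?I" for n
      proof -
        have "X n x = card {i \<in> F n. x \<in> A i}"
          using fin by (simp add: X_def indicator_def sum.If_cases Int_def)
        also have "\<dots> \<le> card ?I"
          using fin' by (intro of_nat_mono card_mono) auto
        finally show ?thesis .
      qed
      have "\<forall>\<^sub>F n in sequentially. 2 * (card ?I * m) < q n"
        using q unfolding q_def filterlim_at_top_dense by blast
      then obtain k where k: "\<And>n. k \<le> n \<Longrightarrow> 2 * (card ?I * m) < q n"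
        unfolding eventually_sequentially by auto
      from x obtain n where n: "k \<le> n" "x \<in> E n"
        by (auto simp: D_def)
      then have "q n \<le> 2 * (X n x * m)"
        by (simp add: E_def)
      also have "\<dots> \<le> 2 * (card ?I * m)"
        using Xc[of n] by (intro mult_left_mono mult_right_mono) (auto simp: m_def)
      finally show False
        using k[OF n(1)] by simp
    qed
  qed
  then have "measure M (\<Inter>k. D k) \<le> measure M B"
    by (intro finite_measure_mono B(1))
  moreover have "0 < 1 / (4 * C)"
    using \<open>0 < C\<close> by simp
  ultimately show ?thesis by linarith
qed

lemma (in finite_measure) sum_measure_le_multiplicity:
  assumes fin: "finite I" and A: "\<And>i. i \<in> I \<Longrightarrow> A i \<in> sets M"
    and mult: "\<And>x. x \<in> space M \<Longrightarrow> card {i \<in> I. x \<in> A i} \<le> k"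
  shows "(\<Sum>i\<in>I. measure M (A i)) \<le> real k * measure M (space M)"
proof -
  have "(\<Sum>i\<in>I. measure M (A i)) = (\<integral>x. (\<Sum>i\<in>I. indicator (A i) x) \<partial>M)"
    using A by (auto simp: sets.sets_into_space Int_absorb1 emeasure_eq_measure)
  also have "\<dots> \<le> (\<integral>x. real k \<partial>M)"
  proof (rule integral_mono)
    show "integrable M (\<lambda>x. \<Sum>i\<in>I. indicator (A i) x :: real)"
      using A by (auto simp: emeasure_eq_measure)
    show "(\<Sum>i\<in>I. indicator (A i) x) \<le> real k" if "x \<in> space M" for x
      using mult[OF that] fin by (simp add: indicator_def sum.If_cases Int_def)
  qed simp
  finally show ?thesis by (simp add: mult.commute)
qed

text \<open>Isolates what the counting argument uses: a proper symmetric subadditive length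
  \<open>N\<close> on a group (to be the displacement of the base point) and sets \<open>A\<close>
  (to be shadows) with two-sided measure bounds. The geometry enters only through
  \<open>fellow\<close>, required on \<open>S\<close>; \<open>tails\<close> lets finitely many right
  multipliers bring every element into \<open>S\<close>.\<close>

locale shadow_family = group G + finite_measure M
  for G :: "('g, 'm) monoid_scheme" (structure) and M :: "'b measure" +
  fixes N :: "'g \<Rightarrow> real" and \<omega> \<epsilon> C K :: real and A :: "'g \<Rightarrow> 'b set" and S U :: "'g set"
  assumes N_nonneg: "\<And>g. 0 \<le> N g"
    and N_mult: "\<And>g h. g \<in> carrier G \<Longrightarrow> h \<in> carrier G \<Longrightarrow> N (g \<otimes> h) \<le> N g + N h"
    and N_inv: "\<And>g. g \<in> carrier G \<Longrightarrow> N (inv g) = N g"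
    and finite_ball: "\<And>t. finite {g \<in> carrier G. N g \<le> t}"
    and params: "0 \<le> \<omega>" "0 < \<epsilon>" "0 < C" "0 \<le> K"
    and S: "S \<subseteq> carrier G" and U: "finite U" "U \<subseteq> carrier G"
    and tails: "\<And>g. g \<in> carrier G \<Longrightarrow> \<exists>u\<in>U. g \<otimes> u \<in> S"
    and A: "\<And>g. g \<in> S \<Longrightarrow> A g \<in> sets M"
    and lower: "\<And>g. g \<in> S \<Longrightarrow> \<epsilon> * exp (- \<omega> * N g) \<le> measure M (A g)"
    and upper: "\<And>g. g \<in> S \<Longrightarrow> measure M (A g) \<le> C * exp (- \<omega> * N g)"
    and fellow: "\<And>g h x. g \<in> S \<Longrightarrow> h \<in> S \<Longrightarrow> x \<in> A g \<Longrightarrow> x \<in> A h \<Longrightarrow> N g \<le> N h \<Longrightarrow>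
      N g + N (inv g \<otimes> h) \<le> N h + K"
begin

definition weight :: "'g \<Rightarrow> real" where
  "weight g = exp (- \<omega> * N g)"

lemma weight_pos: "0 < weight g"
  by (simp add: weight_def)

definition D :: real where
  "D = Max (N ` U)"

lemma N_le_D: "u \<in> U \<Longrightarrow> N u \<le> D"
  unfolding D_def using U(1) by auto

lemma U_nonempty: "U \<noteq> {}"
  using tails[OF one_closed] by auto

lemma D_nonneg: "0 \<le> D"
  using U_nonempty N_le_D N_nonneg by (meson equals0I order_trans)

text \<open>Choose for each \<open>g\<close> a multiplier in \<open>U\<close> bringing it into
  \<open>S\<close>. For a fixed multiplier the map is injective and changes the weight by at most
  the factor \<open>exp (\<omega> * D)\<close>; summing over the multipliers gives
  \<open>card U\<close>.\<close>

lemma sum_weight_transfer: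
  assumes X: "finite X" "X \<subseteq> carrier G" and Y: "finite Y"
    and XY: "\<And>g u. g \<in> X \<Longrightarrow> u \<in> U \<Longrightarrow> g \<otimes> u \<in> S \<Longrightarrow> g \<otimes> u \<in> Y"
  shows "sum weight X \<le> (card U * exp (\<omega> * D)) * sum weight Y"
proof -
  have "\<forall>g\<in>X. \<exists>u. u \<in> U \<and> g \<otimes> u \<in> S"
    using tails X(2) by auto
  from bchoice[OF this] obtain u where u: "\<forall>g\<in>X. u g \<in> U \<and> g \<otimes> u g \<in> S"
    by (elim exE)
  have "sum weight X = (\<Sum>v\<in>U. sum weight {g \<in> X. u g = v})"
    using X(1) U(1) u by (intro sum.group[symmetric]) auto
  also have "\<dots> \<le> (\<Sum>v\<in>U. exp (\<omega> * D) * sum weight Y)"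
  proof (rule sum_mono)
    fix v assume v: "v \<in> U"
    have vG: "v \<in> carrier G" using v U(2) by auto
    let ?X = "{g \<in> X. u g = v}"
    have "sum weight ?X \<le> (\<Sum>g\<in>?X. exp (\<omega> * D) * weight (g \<otimes> v))"
    proof (rule sum_mono)
      fix g assume "g \<in> ?X"
      then have "N (g \<otimes> v) \<le> N g + D"
        using N_mult[of g v] vG X(2) N_le_D[OF v] by fastforce
      then have "\<omega> * N (g \<otimes> v) \<le> \<omega> * (N g + D)"
        using params(1) by (rule mult_left_mono)
      then show "weight g \<le> exp (\<omega> * D) * weight (g \<otimes> v)"
        by (simp add: weight_def algebra_simps flip: exp_add)
    qed
    also have "\<dots> = exp (\<omega> * D) * (\<Sum>g\<in>?X. weight (g \<otimes> v))"
      by (simp add: sum_distrib_left)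
    also have "(\<Sum>g\<in>?X. weight (g \<otimes> v)) = sum weight ((\<lambda>g. g \<otimes> v) ` ?X)"
    proof (rule sum.reindex[symmetric, unfolded comp_def])
      show "inj_on (\<lambda>g. g \<otimes> v) ?X"
        using vG X(2) by (intro inj_onI) (metis (no_types, lifting) mem_Collect_eq right_cancel subsetD)
    qed
    also have "\<dots> \<le> sum weight Y"
      using Y XY u v by (intro sum_mono2) (auto intro: less_imp_le[OF weight_pos])
    finally show "sum weight ?X \<le> exp (\<omega> * D) * sum weight Y"
      by simp
  qed
  finally show ?thesis by simp
qed

text \<open>Compare all \<open>h\<close> whose sets contain \<open>x\<close> with one of them,
  \<open>h0\<close>: by \<open>fellow\<close>, applied in the order of their lengths,
  \<open>inv h0 \<otimes> h\<close> stays in a fixed ball. The bound is independent of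
  \<open>t\<close>.\<close>

lemma multiplicity:
  assumes "\<And>h. h \<in> B \<Longrightarrow> h \<in> S \<and> t < N h \<and> N h \<le> t + a" "0 \<le> a"
  shows "card {h \<in> B. x \<in> A h} \<le> card {k \<in> carrier G. N k \<le> K + a}"
proof (cases "{h \<in> B. x \<in> A h} = {}")
  case False
  then obtain h0 where h0: "h0 \<in> B" "x \<in> A h0" by auto
  have G: "h \<in> carrier G" if "h \<in> B" for h
    using assms(1)[OF that] S by auto
  show ?thesis
  proof (rule card_inj_on_le)
    show "inj_on (\<lambda>h. inv h0 \<otimes> h) {h \<in> B. x \<in> A h}"
      using G h0 by (auto simp: inj_on_def)
    show "(\<lambda>h. inv h0 \<otimes> h) ` {h \<in> B. x \<in> A h} \<subseteq> {k \<in> carrier G. N k \<le> K + a}"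
    proof safe
      fix h assume h: "h \<in> B" "x \<in> A h"
      show "inv h0 \<otimes> h \<in> carrier G"
        using G h h0 by simp
      show "N (inv h0 \<otimes> h) \<le> K + a"
      proof (cases "N h0 \<le> N h")
        case True
        then show ?thesis
          using fellow[of h0 h x] assms(1)[OF h(1)] assms(1)[OF h0(1)] h h0 by auto
      next
        case False
        have "inv h0 \<otimes> h = inv (inv h \<otimes> h0)"
          using G h h0 by (simp add: inv_mult_group)
        then have "N (inv h0 \<otimes> h) = N (inv h \<otimes> h0)"
          using G h h0 by (simp add: N_inv)
        then show ?thesis
          using False fellow[of h h0 x] assms(1)[OF h(1)] assms(1)[OF h0(1)] h h0 by auto
      qed
    qed
    show "finite {k \<in> carrier G. N k \<le> K + a}"
      by (rule finite_ball)
  qed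
next
  case True
  show ?thesis
    unfolding True by simp
qed

text \<open>In \<open>S\<close>, the lower bound turns weights into measures, and bounded
  multiplicity compares their sum with the total mass. Passing from \<open>G\<close> to
  \<open>S\<close> widens the annulus by \<open>D\<close> on each side.\<close>

lemma annulus_bound:
  assumes "0 \<le> a"
  obtains K0 where "0 \<le> K0" "\<And>t. sum weight {g \<in> carrier G. t < N g \<and> N g \<le> t + a} \<le> K0"
proof -
  define k where "k = card {k \<in> carrier G. N k \<le> K + (a + 2 * D)}"
  define K0 where "K0 = (card U * exp (\<omega> * D)) * (k * measure M (space M) / \<epsilon>)"
  have "sum weight {g \<in> carrier G. t < N g \<and> N g \<le> t + a} \<le> K0" for t
  proof -
    define Y where "Y = {h \<in> S. t - D < N h \<and> N h \<le> (t - D) + (a + 2 * D)}"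
    have finY: "finite Y"
      by (rule finite_subset[OF _ finite_ball[of "t + a + D"]]) (use S in \<open>auto simp: Y_def\<close>)
    have "sum weight {g \<in> carrier G. t < N g \<and> N g \<le> t + a} \<le> (card U * exp (\<omega> * D)) * sum weight Y"
    proof (rule sum_weight_transfer[OF _ _ finY])
      show "finite {g \<in> carrier G. t < N g \<and> N g \<le> t + a}"
        by (rule finite_subset[OF _ finite_ball[of "t + a"]]) auto
      fix g u assume g: "g \<in> {g \<in> carrier G. t < N g \<and> N g \<le> t + a}" and u: "u \<in> U" and gu: "g \<otimes> u \<in> S"
      have uG: "u \<in> carrier G" using u U(2) by auto
      have "N (g \<otimes> u) \<le> N g + N u"
        using g uG by (intro N_mult) auto
      moreover have "N g \<le> N (g \<otimes> u) + N u"
        using N_mult[of "g \<otimes> u" "inv u"] g uG by (simp add: N_inv m_assoc)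
      ultimately show "g \<otimes> u \<in> Y"
        using g gu N_le_D[OF u] by (auto simp: Y_def)
    qed auto
    also have "sum weight Y \<le> k * measure M (space M) / \<epsilon>"
    proof -
      have "\<epsilon> * sum weight Y \<le> (\<Sum>h\<in>Y. measure M (A h))"
        unfolding sum_distrib_left using lower by (intro sum_mono) (auto simp: Y_def weight_def)
      also have "\<dots> \<le> k * measure M (space M)"
      proof (rule sum_measure_le_multiplicity[OF finY])
        show "card {h \<in> Y. x \<in> A h} \<le> k" for x
          unfolding k_def using D_nonneg assms by (intro multiplicity[of _ "t - D"]) (auto simp: Y_def)
      qed (use A in \<open>auto simp: Y_def\<close>)
      finally show ?thesis
        using params(2) by (simp add: field_simps)
    qed
    finally show ?thesis
      unfolding K0_def by (simp add: mult_left_mono)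
  qed
  moreover have "0 \<le> K0"
    unfolding K0_def using params(2) by auto
  ultimately show thesis using that by blast
qed

text \<open>If the sets of \<open>g\<close> and \<open>h\<close> meet, \<open>fellow\<close> makes
  the weight of \<open>h\<close> at most \<open>exp (\<omega> * K)\<close> times the product of the
  weights of \<open>g\<close> and \<open>inv g \<otimes> h\<close>. Summing over \<open>h\<close>
  amounts to summing over these quotients, which have length at most \<open>t + K\<close>.\<close>

lemma sum_measure_Int_le:
  assumes g: "g \<in> S"
  shows "(\<Sum>h | h \<in> S \<and> N h \<le> t \<and> N g \<le> N h. measure M (A g \<inter> A h))
    \<le> C * exp (\<omega> * K) * weight g * sum weight {k \<in> carrier G. N k \<le> t + K}"
proof -
  have gG: "g \<in> carrier G" using g S by auto
  let ?X = "{h. h \<in> S \<and> N h \<le> t \<and> N g \<le> N h}" and ?Y = "{h. h \<in> S \<and> N h \<le> t \<and> N g \<le> N h \<and> A g \<inter> A h \<noteq> {}}"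
  have fin: "finite ?X"
    by (rule finite_subset[OF _ finite_ball[of t]]) (use S in auto)
  have "(\<Sum>h\<in>?X. measure M (A g \<inter> A h)) = (\<Sum>h\<in>?Y. measure M (A g \<inter> A h))"
    using fin by (intro sum.mono_neutral_right) auto
  also have "\<dots> \<le> (\<Sum>h\<in>?Y. C * exp (\<omega> * K) * weight g * weight (inv g \<otimes> h))"
  proof (rule sum_mono)
    fix h assume h: "h \<in> ?Y"
    then obtain x where "x \<in> A g" "x \<in> A h" by auto
    then have "N g + N (inv g \<otimes> h) - K \<le> N h"
      using fellow[OF g, of h x] h by auto
    then have "\<omega> * (N g + N (inv g \<otimes> h) - K) \<le> \<omega> * N h"
      using params(1) by (rule mult_left_mono)
    then have "exp (- \<omega> * N h) \<le> exp (\<omega> * K) * weight g * weight (inv g \<otimes> h)"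
      by (simp add: weight_def algebra_simps flip: exp_add)
    then have "C * exp (- \<omega> * N h) \<le> C * (exp (\<omega> * K) * weight g * weight (inv g \<otimes> h))"
      using params(3) by simp
    moreover have "measure M (A g \<inter> A h) \<le> measure M (A h)"
      using A h by (intro finite_measure_mono) auto
    ultimately show "measure M (A g \<inter> A h) \<le> C * exp (\<omega> * K) * weight g * weight (inv g \<otimes> h)"
      using upper[of h] h by (simp add: mult.assoc)
  qed
  also have "\<dots> = C * exp (\<omega> * K) * weight g * (\<Sum>h\<in>?Y. weight (inv g \<otimes> h))"
    by (simp add: sum_distrib_left)
  also have "(\<Sum>h\<in>?Y. weight (inv g \<otimes> h)) = sum weight ((\<lambda>h. inv g \<otimes> h) ` ?Y)"
  proof (rule sum.reindex[symmetric, unfolded comp_def])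
    show "inj_on (\<lambda>h. inv g \<otimes> h) ?Y"
      using gG S by (intro inj_onI) (metis (no_types, lifting) Units_eq Units_l_cancel inv_closed mem_Collect_eq subsetD)
  qed
  also have "\<dots> \<le> sum weight {k \<in> carrier G. N k \<le> t + K}"
  proof (rule sum_mono2[OF finite_ball])
    show "(\<lambda>h. inv g \<otimes> h) ` ?Y \<subseteq> {k \<in> carrier G. N k \<le> t + K}"
    proof safe
      fix h x assume h: "h \<in> S" "N h \<le> t" "N g \<le> N h" and x: "x \<in> A g" "x \<in> A h"
      show "inv g \<otimes> h \<in> carrier G" using gG h S by auto
      show "N (inv g \<otimes> h) \<le> t + K"
        using fellow[OF g h(1) x h(3)] h(2) N_nonneg[of g] by linarith
    qed
  qed (auto intro: less_imp_le[OF weight_pos])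
  finally show ?thesis
    using params(3) weight_pos[of g] by (simp add: mult_left_mono)
qed

theorem limsup_positive:
  assumes div: "\<And>b. \<exists>t. b < sum weight {g \<in> carrier G. N g \<le> t}"
    and B: "B \<in> sets M" "\<And>x. x \<in> space M \<Longrightarrow> infinite {g \<in> S. x \<in> A g} \<Longrightarrow> x \<in> B"
  shows "0 < measure M B"
proof -
  define P where "P = (\<lambda>t. sum weight {g \<in> carrier G. N g \<le> t})"
  define F where "F = (\<lambda>n::nat. {g \<in> S. N g \<le> real n})"
  define T where "T = (\<lambda>n. sum weight (F n))"
  define Q where "Q = (\<lambda>n. \<Sum>g\<in>F n. measure M (A g))"
  have finF: "finite (F n)" for n
    by (rule finite_subset[OF _ finite_ball[of "real n"]]) (use S in \<open>auto simp: F_def\<close>)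
  define c where "c = real (card U) * exp (\<omega> * D)"
  have c_pos: "0 < c"
    using U_nonempty U(1) by (simp add: c_def card_gt_0_iff)
  obtain K0 where K0: "0 \<le> K0" "\<And>t. sum weight {g \<in> carrier G. t < N g \<and> N g \<le> t + (K + D)} \<le> K0"
    using annulus_bound[of "K + D"] params(4) D_nonneg by (metis add_nonneg_nonneg)
  \<comment> \<open>After multiplication by an element of \<open>U\<close>, an element either lies
    in \<open>F n\<close> or has length between \<open>n\<close> and \<open>n + K + D\<close>; the
    second kind is controlled by \<open>annulus_bound\<close>.\<close>
  have PT: "P (real n + K) \<le> c * (T n + K0)" for n
  proof -
    let ?Y = "F n \<union> {g \<in> carrier G. real n < N g \<and> N g \<le> real n + (K + D)}"
    have fin: "finite {g \<in> carrier G. real n < N g \<and> N g \<le> real n + (K + D)}"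
      by (rule finite_subset[OF _ finite_ball[of "real n + (K + D)"]]) auto
    have "P (real n + K) \<le> c * sum weight ?Y"
      unfolding P_def c_def
    proof (rule sum_weight_transfer[OF finite_ball])
      show "finite ?Y" using finF fin by simp
      fix g u assume g: "g \<in> {g \<in> carrier G. N g \<le> real n + K}" and u: "u \<in> U" and gu: "g \<otimes> u \<in> S"
      have "N (g \<otimes> u) \<le> N g + N u"
        using g u U(2) by (intro N_mult) auto
      then show "g \<otimes> u \<in> ?Y"
        using g gu N_le_D[OF u] S by (auto simp: F_def)
    qed auto
    also have "sum weight ?Y \<le> T n + K0"
      using K0(2)[of "real n"] finF fin
      by (subst sum.union_disjoint) (auto simp: F_def T_def)
    finally show ?thesis using c_pos by simp
  qed
  have T_top: "filterlim T at_top sequentially"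
    unfolding filterlim_at_top
  proof
    fix b
    obtain t where t: "c * (b + K0) < P t"
      using div unfolding P_def by blast
    have "b \<le> T n" if n: "nat \<lceil>t\<rceil> \<le> n" for n
    proof -
      have "P t \<le> P (real n + K)"
        unfolding P_def using n params(4)
        by (intro sum_mono2 finite_ball) (auto intro: less_imp_le[OF weight_pos])
      then have "c * (b + K0) < c * (T n + K0)"
        using t PT[of n] by linarith
      then show ?thesis using c_pos by simp
    qed
    then show "\<forall>\<^sub>F n in sequentially. b \<le> T n"
      unfolding eventually_sequentially by blast
  qed
  have TQ: "\<epsilon> * T n \<le> Q n" for n
    unfolding T_def Q_def sum_distrib_left using lower by (intro sum_mono) (auto simp: F_def weight_def)
  show ?thesis
  \<comment> \<open>The factor 4 is 2 for the two orders of a pair times 2 for absorbing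
    \<open>K0\<close> once \<open>T n\<close> exceeds it; \<epsilon> enters twice since
    \<open>T n \<le> Q n / \<epsilon>\<close> is squared.\<close>
  proof (rule kochen_stone[of F A "4 * C * exp (\<omega> * K) * c / \<epsilon>\<^sup>2"])
    show "filterlim (\<lambda>n. \<Sum>i\<in>F n. measure M (A i)) at_top sequentially"
    proof (rule filterlim_at_top_mono)
      show "filterlim (\<lambda>n. \<epsilon> * T n) at_top sequentially"
        using T_top params(2) by (intro filterlim_tendsto_pos_mult_at_top[OF tendsto_const])
      show "\<forall>\<^sub>F n in sequentially. \<epsilon> * T n \<le> (\<Sum>i\<in>F n. measure M (A i))"
        using TQ by (simp add: Q_def)
    qed
    have "\<forall>\<^sub>F n in sequentially. K0 \<le> T n"
      using T_top by (simp add: filterlim_at_top)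
    then show "\<forall>\<^sub>F n in sequentially. (\<Sum>i\<in>F n. \<Sum>j\<in>F n. measure M (A i \<inter> A j))
        \<le> 4 * C * exp (\<omega> * K) * c / \<epsilon>\<^sup>2 * (\<Sum>i\<in>F n. measure M (A i))\<^sup>2"
    proof eventually_elim
      case (elim n)
      have T_nonneg: "0 \<le> T n"
        unfolding T_def by (intro sum_nonneg less_imp_le[OF weight_pos])
      define a where "a = (\<lambda>g h. measure M (A g \<inter> A h))"
      \<comment> \<open>Keeps only the pairs ordered by length, the case treated by
        \<open>sum_measure_Int_le\<close>; every pair is ordered one way or the other.\<close>
      define a' where "a' = (\<lambda>g h. if N g \<le> N h then a g h else 0)"
      have "(\<Sum>g\<in>F n. \<Sum>h\<in>F n. a g h) \<le> (\<Sum>g\<in>F n. \<Sum>h\<in>F n. a' g h + a' h g)"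
        by (intro sum_mono) (auto simp: a'_def a_def Int_commute)
      also have "\<dots> = (\<Sum>g\<in>F n. \<Sum>h\<in>F n. a' g h) + (\<Sum>g\<in>F n. \<Sum>h\<in>F n. a' h g)"
        by (simp add: sum.distrib)
      also have "(\<Sum>g\<in>F n. \<Sum>h\<in>F n. a' h g) = (\<Sum>g\<in>F n. \<Sum>h\<in>F n. a' g h)"
        by (rule sum.swap)
      also have "(\<Sum>g\<in>F n. \<Sum>h\<in>F n. a' g h) \<le> (\<Sum>g\<in>F n. C * exp (\<omega> * K) * weight g * P (real n + K))"
      proof (rule sum_mono)
        fix g assume g: "g \<in> F n"
        have "(\<Sum>h\<in>F n. a' g h) = (\<Sum>h | h \<in> S \<and> N h \<le> real n \<and> N g \<le> N h. a g h)"
          unfolding a'_def using finF by (subst sum.inter_filter[symmetric]) (auto simp: F_def intro!: sum.cong)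
        also have "\<dots> \<le> C * exp (\<omega> * K) * weight g * P (real n + K)"
          unfolding a_def P_def using g by (intro sum_measure_Int_le) (auto simp: F_def)
        finally show "(\<Sum>h\<in>F n. a' g h) \<le> C * exp (\<omega> * K) * weight g * P (real n + K)" .
      qed
      also have "(\<Sum>g\<in>F n. C * exp (\<omega> * K) * weight g * P (real n + K))
          = C * exp (\<omega> * K) * T n * P (real n + K)"
        by (simp add: T_def sum_distrib_left sum_distrib_right)
      also have "\<dots> \<le> C * exp (\<omega> * K) * T n * (c * (2 * T n))"
      proof (rule mult_left_mono)
        have "c * (T n + K0) \<le> c * (2 * T n)"
          using elim c_pos by simp
        then show "P (real n + K) \<le> c * (2 * T n)"
          using PT[of n] by linarith
      qed (use params T_nonneg in auto)
      finally have "(\<Sum>g\<in>F n. \<Sum>h\<in>F n. a g h) \<le> 4 * C * exp (\<omega> * K) * c * (T n)\<^sup>2"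
        by (simp add: power2_eq_square algebra_simps)
      also have "(T n)\<^sup>2 \<le> (Q n / \<epsilon>)\<^sup>2"
        using TQ[of n] T_nonneg params(2) by (intro power_mono) (auto simp: field_simps)
      finally show ?case
        using params(3) c_pos by (simp add: a_def Q_def power_divide mult_left_mono)
    qed
    show "infinite {i \<in> \<Union> (range F). x \<in> A i} \<Longrightarrow> x \<in> space M \<Longrightarrow> x \<in> B" for x
    proof -
      have "\<Union> (range F) = S"
        using real_arch_simple by (auto simp: F_def)
      then show "infinite {i \<in> \<Union> (range F). x \<in> A i} \<Longrightarrow> x \<in> space M \<Longrightarrow> x \<in> B"
        using B(2) by simp
    qed
  qed (use finF A B params c_pos in \<open>auto simp: F_def\<close>)
qed

end

section \<open>Shadows and conformal densities\<close>

context proper_isometric_action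
begin

lemma cocycle_act_point_cocycle:
  "g \<in> carrier G \<Longrightarrow> cocycle_act G \<phi> g (point_cocycle z) = point_cocycle (\<phi> g z)"
  by (simp add: cocycle_act_def point_cocycle_def dist_act_left)

lemma continuous_act: "g \<in> carrier G \<Longrightarrow> continuous_on S (\<phi> g)"
  by (auto simp: continuous_on_iff intro!: exI)

lemma cocycle_act_cocycles:
  assumes "g \<in> carrier G" "c \<in> cocycles"
  shows "cocycle_act G \<phi> g c \<in> cocycles"
proof -
  have "continuous_on UNIV ((\<lambda>(x, y). c x y) \<circ> (\<lambda>z. (\<phi> (inv g) (fst z), \<phi> (inv g) (snd z))))"
    using assms by (intro continuous_on_compose continuous_on_Pair
        continuous_on_compose[OF continuous_on_fst continuous_act, unfolded comp_def]
        continuous_on_compose[OF continuous_on_snd continuous_act, unfolded comp_def])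
      (auto simp: cocycles_def intro: continuous_on_subset continuous_intros)
  then show ?thesis
    using assms(2) by (auto simp: cocycles_def cocycle_act_def comp_def case_prod_beta)
qed

lemma continuous_map_cocycle_act:
  assumes g: "g \<in> carrier G"
  shows "continuous_map cocycle_topology cocycle_topology (cocycle_act G \<phi> g)"
  unfolding continuous_map_def topspace_cocycle_topology
proof (intro conjI allI impI)
  show "cocycle_act G \<phi> g \<in> cocycles \<rightarrow> cocycles"
    using cocycle_act_cocycles[OF g] by auto
  fix U :: "'a cocycle set" assume "openin cocycle_topology U"
  then have U: "cocycle_open U" by (simp add: openin_cocycle_topology)
  show "openin cocycle_topology {c \<in> cocycles. cocycle_act G \<phi> g c \<in> U}"
    unfolding openin_cocycle_topology cocycle_open_def
  proof (intro conjI ballI)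
    fix c assume c: "c \<in> {c \<in> cocycles. cocycle_act G \<phi> g c \<in> U}"
    then have "cocycle_act G \<phi> g c \<in> U" by simp
    from cocycle_openD[OF U this] obtain K e
      where K: "compact K" "e > 0" "compact_nhd K e (cocycle_act G \<phi> g c) \<subseteq> U"
      by (elim exE conjE)
    define K' where "K' = (\<lambda>z. (\<phi> (inv g) (fst z), \<phi> (inv g) (snd z))) ` K"
    have "compact K'"
      unfolding K'_def using g
      by (intro compact_continuous_image[OF _ K(1)] continuous_on_Pair
        continuous_on_compose[OF continuous_on_fst continuous_act, unfolded comp_def]
        continuous_on_compose[OF continuous_on_snd continuous_act, unfolded comp_def] continuous_on_id) auto
    moreover have "compact_nhd K' e c \<subseteq> {c \<in> cocycles. cocycle_act G \<phi> g c \<in> U}"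
    proof
      fix d assume d: "d \<in> compact_nhd K' e c"
      then have "cocycle_act G \<phi> g d \<in> compact_nhd K e (cocycle_act G \<phi> g c)"
        using cocycle_act_cocycles[OF g, of d]
        by (auto simp: compact_nhd_def K'_def cocycle_act_def case_prod_beta)
      then show "d \<in> {c \<in> cocycles. cocycle_act G \<phi> g c \<in> U}"
        using d K(3) by (auto simp: compact_nhd_def)
    qed
    ultimately show "\<exists>K e. compact K \<and> e > 0 \<and> compact_nhd K e c \<subseteq> {c \<in> cocycles. cocycle_act G \<phi> g c \<in> U}"
      using K(2) by (intro exI[of _ K'] exI[of _ e]) simp
  qed auto
qed

lemma cocycle_act_horocompactification:
  assumes g: "g \<in> carrier G" and c: "c \<in> horocompactification"
  shows "cocycle_act G \<phi> g c \<in> horocompactification"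
proof -
  have "cocycle_act G \<phi> g ` horocompactification
      \<subseteq> cocycle_topology closure_of (cocycle_act G \<phi> g ` range point_cocycle)"
    unfolding horocompactification_def
    by (rule continuous_map_image_closure_subset[OF continuous_map_cocycle_act[OF g]])
  also have "\<dots> \<subseteq> horocompactification"
    unfolding horocompactification_def
    by (rule closure_of_mono) (auto simp: cocycle_act_point_cocycle[OF g])
  finally show ?thesis using c by auto
qed

lemma measurable_cocycle_act [measurable]:
  assumes g: "g \<in> carrier G"
  shows "cocycle_act G \<phi> g \<in> horoborel \<rightarrow>\<^sub>M horoborel"
  unfolding horoborel_def[where 'a = 'a]
proof (rule measurable_measure_of)
  show "{U. openin (subtopology cocycle_topology horocompactification) U}
      \<subseteq> Pow (horocompactification :: 'a cocycle set)"
    by (auto simp: openin_subtopology)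
  fix V :: "'a cocycle set"
  assume "V \<in> {U. openin (subtopology cocycle_topology horocompactification) U}"
  then obtain U where U: "openin cocycle_topology U" "V = U \<inter> horocompactification"
    by (auto simp: openin_subtopology)
  have "openin cocycle_topology {c \<in> cocycles. cocycle_act G \<phi> g c \<in> U}"
    using continuous_map_cocycle_act[OF g] U(1) by (auto simp: continuous_map_def)
  from horoborel_openI[OF this]
  have "{c \<in> cocycles. cocycle_act G \<phi> g c \<in> U} \<inter> horocompactification \<in> sets horoborel" .
  also have "{c \<in> cocycles. cocycle_act G \<phi> g c \<in> U} \<inter> horocompactification
      = cocycle_act G \<phi> g -` V \<inter> space horoborel"
    using U(2) cocycle_act_horocompactification[OF g] horocompactification_subset by auto
  finally show "cocycle_act G \<phi> g -` V \<inter> space (sigma horocompactification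
      {U. openin (subtopology cocycle_topology horocompactification) U}) \<in>
      sets (sigma horocompactification {U. openin (subtopology cocycle_topology horocompactification) U})"
    unfolding horoborel_def .
qed (use cocycle_act_horocompactification[OF g] in \<open>auto simp flip: horoborel_def\<close>)

lemma cocycle_act_vimage_sets:
  assumes "g \<in> carrier G" "A \<in> sets horoborel"
  shows "cocycle_act G \<phi> g -` A \<inter> horocompactification \<in> sets horoborel"
  using measurable_sets[OF measurable_cocycle_act[OF assms(1)] assms(2)] by simp

lemma cocycle_act_in_shadow_iff:
  assumes "g \<in> carrier G" "c \<in> horocompactification"
  shows "cocycle_act G \<phi> g c \<in> shadow x z r \<longleftrightarrow> c \<in> shadow (\<phi> (inv g) x) (\<phi> (inv g) z) r"
  using assms cocycle_act_horocompactification[OF assms]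
  by (simp add: shadow_def) (simp add: cocycle_act_def)

end

text \<open>Conformality is stated through integrals and the total mass is only required to be
  nonzero, so that the restriction of a density to a non-null invariant set is again an
  instance.\<close>

locale conformal_action = contracting_axis G \<phi> g0 y \<alpha>
  for G :: "('g, 'm) monoid_scheme" (structure) and \<phi> :: "'g \<Rightarrow> 'a::metric_space \<Rightarrow> 'a"
    and g0 :: 'g and y :: 'a and \<alpha> :: real +
  fixes p :: 'a and \<omega> :: real and \<nu> :: "'a \<Rightarrow> 'a cocycle measure"
  assumes not_virtually_cyclic: "\<not> virtually_cyclic G"
    and \<omega>_nonneg: "0 \<le> \<omega>"
    and sets_\<nu>: "\<And>x. sets (\<nu> x) = sets horoborel"
    and finite_\<nu>: "\<And>x. finite_measure (\<nu> x)"
    and conformal: "\<And>x z A. A \<in> sets horoborel \<Longrightarrow>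
      emeasure (\<nu> x) A = (\<integral>\<^sup>+ c. ennreal (exp (- \<omega> * c x z)) * indicator A c \<partial>\<nu> z)"
    and invariant: "\<And>g x A. g \<in> carrier G \<Longrightarrow> A \<in> sets horoborel \<Longrightarrow>
      emeasure (\<nu> (\<phi> g x)) A = emeasure (\<nu> x) (cocycle_act G \<phi> g -` A \<inter> horocompactification)"
    and nonzero: "emeasure (\<nu> p) horocompactification \<noteq> 0"
begin

sublocale \<nu>: finite_measure "\<nu> x" for x
  by (rule finite_\<nu>)

lemma space_\<nu> [simp]: "space (\<nu> x) = horocompactification"
  using sets_eq_imp_space_eq[OF sets_\<nu>] by simp

lemma measure_le_exp:
  assumes A: "A \<in> sets horoborel" and le: "\<And>c. c \<in> A \<Longrightarrow> a \<le> c x z"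
  shows "measure (\<nu> x) A \<le> exp (- \<omega> * a) * measure (\<nu> z) A"
proof -
  have "emeasure (\<nu> x) A \<le> (\<integral>\<^sup>+ c. ennreal (exp (- \<omega> * a)) * indicator A c \<partial>\<nu> z)"
    unfolding conformal[OF A, of x z] using le \<omega>_nonneg
    by (intro nn_integral_mono) (auto split: split_indicator intro!: ennreal_leI mult_left_mono)
  also have "\<dots> = ennreal (exp (- \<omega> * a)) * emeasure (\<nu> z) A"
    using A by (simp add: nn_integral_cmult_indicator sets_\<nu>)
  finally show ?thesis
    by (simp add: \<nu>.emeasure_eq_measure flip: ennreal_mult)
qed

text \<open>Cocycle values are bounded by distances, so the conformal factor is bounded and null
  sets do not depend on the base point.\<close>

lemma measure_null:
  assumes A: "A \<in> sets horoborel" and z: "measure (\<nu> z) A = 0"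
  shows "measure (\<nu> x) A = 0"
proof -
  have "- dist x z \<le> c x z" if "c \<in> A" for c
  proof -
    have "c \<in> horocompactification"
      using that A sets.sets_into_space by fastforce
    then show ?thesis
      using cocycle_le_dist[of c z x] cocycle_swap[of c z x] by (simp add: dist_commute)
  qed
  then have "measure (\<nu> x) A \<le> exp (- \<omega> * (- dist x z)) * measure (\<nu> z) A"
    by (rule measure_le_exp[OF A])
  then show ?thesis
    using z measure_nonneg[of "\<nu> x" A] by simp
qed

lemma measure_act:
  assumes "g \<in> carrier G" "A \<in> sets horoborel"
  shows "measure (\<nu> (\<phi> g x)) A = measure (\<nu> x) (cocycle_act G \<phi> g -` A \<inter> horocompactification)"
  using invariant[OF assms] by (simp add: measure_def)

definition mass :: real where
  "mass = measure (\<nu> p) horocompactification"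

lemma mass_pos: "0 < mass"
  using nonzero by (simp add: mass_def zero_less_measure_iff \<nu>.emeasure_eq_measure)

lemma measure_act_le_mass:
  assumes "g \<in> carrier G" "A \<in> sets horoborel"
  shows "measure (\<nu> (\<phi> g p)) A \<le> mass"
  unfolding measure_act[OF assms] mass_def using \<nu>.bounded_measure[of p] by simp

text \<open>The closure of \<open>V\<close> and its translate by \<open>u\<close> cover the
  horocompactification. By invariance the translate has the mass that the closure has from another
  base point, so both would be null together.\<close>

lemma half_space_positive:
  assumes u: "u \<in> carrier G" and V: "V \<union> \<phi> u ` V = UNIV"
  shows "0 < measure (\<nu> p) (cocycle_topology closure_of (point_cocycle ` V))"
proof (rule ccontr)
  define C where "C = cocycle_topology closure_of (point_cocycle ` V)"
  have clC: "closedin cocycle_topology C"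
    by (simp add: C_def)
  have VC: "point_cocycle z \<in> C" if "z \<in> V" for z
    unfolding C_def using that by (intro subsetD[OF closure_of_subset]) auto
  have C: "C \<in> sets horoborel"
  proof -
    have "C \<subseteq> horocompactification"
      unfolding C_def horocompactification_def by (intro closure_of_mono) auto
    then show ?thesis
      using horoborel_closedI[OF clC] by (simp add: Int_absorb2)
  qed
  assume "\<not> 0 < measure (\<nu> p) (cocycle_topology closure_of (point_cocycle ` V))"
  then have 0: "measure (\<nu> p) C = 0"
    by (simp add: C_def zero_less_measure_iff)
  define C' where "C' = cocycle_act G \<phi> (inv u) -` C \<inter> horocompactification"
  have C': "C' \<in> sets horoborel" "measure (\<nu> p) C' = 0"
    unfolding C'_def using u C measure_act[of "inv u" C p] measure_null[OF C 0]
    by (auto intro: cocycle_act_vimage_sets)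
  have "horocompactification \<subseteq> C \<union> {c \<in> topspace cocycle_topology. cocycle_act G \<phi> (inv u) c \<in> C}"
  proof (rule horocompactification_minimal)
    show "closedin cocycle_topology (C \<union> {c \<in> topspace cocycle_topology. cocycle_act G \<phi> (inv u) c \<in> C})"
      using u by (intro closedin_Un clC closedin_continuous_map_preimage[OF continuous_map_cocycle_act]) auto
    show "point_cocycle z \<in> C \<union> {c \<in> topspace cocycle_topology. cocycle_act G \<phi> (inv u) c \<in> C}" for z
    proof (cases "z \<in> V")
      case False
      then obtain v where "v \<in> V" "z = \<phi> u v"
        using V by blast
      then show ?thesis
        using VC u by (simp add: cocycle_act_point_cocycle)
    qed (use VC in auto)
  qed
  then have "horocompactification \<subseteq> C \<union> C'"
    by (auto simp: C'_def)
  then have "mass \<le> measure (\<nu> p) (C \<union> C')"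
    unfolding mass_def using C C' by (intro \<nu>.finite_measure_mono) (auto simp: sets_\<nu>)
  also have "\<dots> \<le> measure (\<nu> p) C + measure (\<nu> p) C'"
    using C C' by (intro measure_Un_le) (auto simp: sets_\<nu>)
  finally show False
    using mass_pos 0 C' by simp
qed

text \<open>Whatever \<open>x\<close> is, its shadow contains one of finitely many half-spaces,
  hence, being closed, the closure of that half-space. The bound is thus uniform in
  \<open>x\<close>.\<close>

lemma shadow_of_base_point:
  obtains r \<epsilon> where "0 < \<epsilon>" "\<And>x. \<epsilon> \<le> measure (\<nu> p) (shadow x p r)"
proof -
  obtain F V r where F: "finite F" "F \<subseteq> carrier G"
    and V: "\<And>x. \<exists>f\<in>F. \<forall>z\<in>V f. dist x p + dist p z \<le> dist x z + 2 * r"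
    and cover: "\<And>f. f \<in> F \<Longrightarrow> \<exists>u\<in>carrier G. V f \<union> \<phi> u ` V f = UNIV"
    by (rule visible_half_spaces[OF not_virtually_cyclic, where p = p]) (rule that; assumption)
  define m where "m = (\<lambda>f. measure (\<nu> p) (cocycle_topology closure_of (point_cocycle ` V f)))"
  have "F \<noteq> {}"
    using V[of p] by blast
  have "0 < m f" if f: "f \<in> F" for f
  proof -
    obtain u where "u \<in> carrier G" "V f \<union> \<phi> u ` V f = UNIV"
      using cover[OF f] by (elim bexE)
    then show ?thesis
      unfolding m_def by (rule half_space_positive)
  qed
  then have "0 < Min (m ` F)"
    using F(1) \<open>F \<noteq> {}\<close> by simp
  moreover have "Min (m ` F) \<le> measure (\<nu> p) (shadow x p r)" for x
  proof -
    obtain f where f: "f \<in> F" and z: "\<And>z. z \<in> V f \<Longrightarrow> dist x p + dist p z \<le> dist x z + 2 * r"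
      using V[of x] by blast
    have "Min (m ` F) \<le> m f"
      using F(1) f by simp
    also have "m f \<le> measure (\<nu> p) (shadow x p r)"
      unfolding m_def
    proof (rule \<nu>.finite_measure_mono)
      show "cocycle_topology closure_of (point_cocycle ` V f) \<subseteq> shadow x p r"
        by (intro closure_of_minimal closedin_shadow) (auto simp: point_cocycle_in_shadow_iff z)
    qed (simp add: sets_\<nu> shadow_sets)
    finally show ?thesis .
  qed
  ultimately show thesis using that by blast
qed

text \<open>Translating by \<open>g\<close> reduces the shadow of \<open>\<phi> g p\<close> seen
  from \<open>p\<close> to a shadow of \<open>p\<close>; the change of base point costs the
  exponential factor.\<close>

lemma shadow_lower_bound:
  assumes \<epsilon>: "\<And>x. \<epsilon> \<le> measure (\<nu> p) (shadow x p r)" and g: "g \<in> carrier G"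
  shows "\<epsilon> * exp (- \<omega> * dist p (\<phi> g p)) \<le> measure (\<nu> p) (shadow p (\<phi> g p) r)"
proof -
  let ?S = "shadow p (\<phi> g p) r"
  have "c \<in> cocycle_act G \<phi> g -` ?S \<inter> horocompactification \<longleftrightarrow> c \<in> shadow (\<phi> (inv g) p) p r" for c
    using cocycle_act_in_shadow_iff[OF g, of c p "\<phi> g p" r] g
    by (cases "c \<in> horocompactification") (simp_all add: shadow_def)
  then have "cocycle_act G \<phi> g -` ?S \<inter> horocompactification = shadow (\<phi> (inv g) p) p r"
    by blast
  then have "\<epsilon> \<le> measure (\<nu> (\<phi> g p)) ?S"
    using \<epsilon> measure_act[OF g shadow_sets] by simp
  also have "\<dots> \<le> exp (- \<omega> * (- dist p (\<phi> g p))) * measure (\<nu> p) ?S"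
  proof (rule measure_le_exp[OF shadow_sets])
    fix c assume "c \<in> ?S"
    then have "c \<in> horocompactification" by (simp add: shadow_def)
    then show "- dist p (\<phi> g p) \<le> c (\<phi> g p) p"
      using cocycle_le_dist[of c p "\<phi> g p"] cocycle_swap[of c p "\<phi> g p"] by simp
  qed
  finally have "\<epsilon> \<le> exp (\<omega> * dist p (\<phi> g p)) * measure (\<nu> p) ?S" by simp
  then show ?thesis
    by (simp add: exp_minus field_simps)
qed

text \<open>On the shadow, \<open>c p (\<phi> g p)\<close> is at least the distance minus
  \<open>2 * r\<close>, so the conformal factor is that small; the other measure is at most
  \<open>mass\<close>.\<close>

lemma shadow_upper_bound:
  assumes g: "g \<in> carrier G"
  shows "measure (\<nu> p) (shadow p (\<phi> g p) r)
    \<le> (mass * exp (\<omega> * (2 * r))) * exp (- \<omega> * dist p (\<phi> g p))"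
proof -
  let ?S = "shadow p (\<phi> g p) r"
  have "measure (\<nu> p) ?S \<le> exp (- \<omega> * (dist p (\<phi> g p) - 2 * r)) * measure (\<nu> (\<phi> g p)) ?S"
  proof (rule measure_le_exp[OF shadow_sets])
    fix c assume "c \<in> ?S"
    then show "dist p (\<phi> g p) - 2 * r \<le> c p (\<phi> g p)"
      using cocycle_swap[of c p "\<phi> g p"] by (simp add: shadow_def field_simps)
  qed
  also have "\<dots> \<le> exp (- \<omega> * (dist p (\<phi> g p) - 2 * r)) * mass"
    using measure_act_le_mass[OF g shadow_sets] by simp
  also have "\<dots> = (mass * exp (\<omega> * (2 * r))) * exp (- \<omega> * dist p (\<phi> g p))"
    by (simp add: algebra_simps flip: exp_add)
  finally show ?thesis .
qed

lemma shadow_family: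
  obtains r \<epsilon> C K S U where
    "shadow_family G (\<nu> p) (\<lambda>g. dist p (\<phi> g p)) \<omega> \<epsilon> C K (\<lambda>g. shadow p (\<phi> g p) r) S U"
proof -
  obtain \<epsilon> r where \<epsilon>: "0 < \<epsilon>" "\<And>x. \<epsilon> \<le> measure (\<nu> p) (shadow x p r)"
    by (rule shadow_of_base_point) (rule that; assumption)
  \<comment> \<open>The radius \<open>r + 1\<close> leaves room for replacing a cocycle in two
    shadows of radius \<open>r\<close> by a point with error less than 1.\<close>
  obtain S U K where S: "S \<subseteq> carrier G" and U: "finite U" "U \<subseteq> carrier G"
    and tails: "\<And>g. g \<in> carrier G \<Longrightarrow> \<exists>u\<in>U. g \<otimes> u \<in> S"
    and fellow: "\<And>g h z. g \<in> S \<Longrightarrow> h \<in> S \<Longrightarrow> dist p (\<phi> g p) + dist (\<phi> g p) z \<le> dist p z + 2 * (r + 1) \<Longrightarrow>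
       dist p (\<phi> h p) + dist (\<phi> h p) z \<le> dist p z + 2 * (r + 1) \<Longrightarrow> dist p (\<phi> g p) \<le> dist p (\<phi> h p) \<Longrightarrow>
       dist p (\<phi> g p) + dist (\<phi> g p) (\<phi> h p) \<le> dist p (\<phi> h p) + K"
    by (rule contracting_tails[OF not_virtually_cyclic, where r = "r + 1" and p = p]) (rule that; assumption)
  have "shadow_family G (\<nu> p) (\<lambda>g. dist p (\<phi> g p)) \<omega> \<epsilon> (mass * exp (\<omega> * (2 * r))) (max K 0)
      (\<lambda>g. shadow p (\<phi> g p) r) S U"
  proof
    fix g h assume g: "g \<in> carrier G"
    show "dist p (\<phi> (inv g) p) = dist p (\<phi> g p)"
      using g dist_act_left[OF g, of p p] by (simp add: dist_commute)
    assume h: "h \<in> carrier G"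
    show "dist p (\<phi> (g \<otimes> h) p) \<le> dist p (\<phi> g p) + dist p (\<phi> h p)"
      using g h dist_triangle[of p "\<phi> g (\<phi> h p)" "\<phi> g p"] by (simp add: act_mult)
  next
    show "finite {g \<in> carrier G. dist p (\<phi> g p) \<le> t}" for t
      by (rule finite_dist_act_le)
    show "0 < mass * exp (\<omega> * (2 * r))"
      using mass_pos by simp
    fix g assume "g \<in> S"
    then have g: "g \<in> carrier G" using S by auto
    show "\<epsilon> * exp (- \<omega> * dist p (\<phi> g p)) \<le> measure (\<nu> p) (shadow p (\<phi> g p) r)"
      by (rule shadow_lower_bound[OF \<epsilon>(2) g])
    show "measure (\<nu> p) (shadow p (\<phi> g p) r) \<le> mass * exp (\<omega> * (2 * r)) * exp (- \<omega> * dist p (\<phi> g p))"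
      by (rule shadow_upper_bound[OF g])
    show "shadow p (\<phi> g p) r \<in> sets (\<nu> p)"
      by (simp add: sets_\<nu> shadow_sets)
  next
    fix g h c
    assume gh: "g \<in> S" "h \<in> S" and c: "c \<in> shadow p (\<phi> g p) r" "c \<in> shadow p (\<phi> h p) r"
      and le: "dist p (\<phi> g p) \<le> dist p (\<phi> h p)"
    have G: "g \<in> carrier G" "h \<in> carrier G" using gh S by auto
    have cH: "c \<in> horocompactification"
      using c by (simp add: shadow_def)
    obtain z where z: "\<bar>point_cocycle z (\<phi> g p) p - c (\<phi> g p) p\<bar> < 1" "\<bar>point_cocycle z (\<phi> h p) p - c (\<phi> h p) p\<bar> < 1"
      by (rule horocompactification_approx[OF cH zero_less_one])
    have "dist p (\<phi> g p) + dist (\<phi> g p) (\<phi> h p) \<le> dist p (\<phi> h p) + K"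
      by (rule fellow[OF gh _ _ le, of z]) (use z c in \<open>auto simp: shadow_def point_cocycle_def field_simps\<close>)
    then show "dist p (\<phi> g p) + dist p (\<phi> (inv g \<otimes> h) p) \<le> dist p (\<phi> h p) + max K 0"
      using G by (simp add: dist_act_act)
  qed (use \<epsilon>(1) \<omega>_nonneg S U tails in auto)
  then show thesis by (rule that)
qed

end

section \<open>The radial limit set\<close>

lemma shadow_change:
  assumes "c \<in> shadow x z r" "r + dist x x' \<le> r'"
  shows "c \<in> shadow x' z r'"
proof -
  have c: "c \<in> horocompactification" "dist x z + c z x \<le> 2 * r"
    using assms(1) by (auto simp: shadow_def)
  have "dist x' z \<le> dist x x' + dist x z" "c z x' = c z x + c x x'" "c x x' \<le> dist x x'"
    using c(1) by (auto simp: cocycle_add cocycle_le_dist intro: dist_triangle3)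
  then show ?thesis
    using c assms(2) by (auto simp: shadow_def field_simps)
qed

lemma shadow_mono: "c \<in> shadow x z r \<Longrightarrow> r \<le> r' \<Longrightarrow> c \<in> shadow x z r'"
  by (rule shadow_change) auto

context proper_isometric_action
begin

lemma cocycle_act_mult:
  "g \<in> carrier G \<Longrightarrow> h \<in> carrier G \<Longrightarrow>
    cocycle_act G \<phi> (g \<otimes> h) c = cocycle_act G \<phi> g (cocycle_act G \<phi> h c)"
  by (simp add: cocycle_act_def inv_mult_group act_mult)

lemma cocycle_act_one [simp]: "cocycle_act G \<phi> \<one> c = c"
  by (simp add: cocycle_act_def)

lemma cocycle_act_inv_act [simp]:
  "g \<in> carrier G \<Longrightarrow> cocycle_act G \<phi> (inv g) (cocycle_act G \<phi> g c) = c"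
  by (simp flip: cocycle_act_mult)

lemma cocycle_act_act_inv [simp]:
  "g \<in> carrier G \<Longrightarrow> cocycle_act G \<phi> g (cocycle_act G \<phi> (inv g) c) = c"
  by (simp flip: cocycle_act_mult)

lemma cocycle_act_horoboundary:
  assumes g: "g \<in> carrier G" and c: "c \<in> horoboundary"
  shows "cocycle_act G \<phi> g c \<in> horoboundary"
proof -
  have "cocycle_act G \<phi> g c \<noteq> point_cocycle z" for z
  proof
    assume "cocycle_act G \<phi> g c = point_cocycle z"
    then have "c = cocycle_act G \<phi> (inv g) (point_cocycle z)"
      using g by (metis cocycle_act_inv_act)
    then have "c = point_cocycle (\<phi> (inv g) z)"
      using g by (simp add: cocycle_act_point_cocycle)
    then show False using c by (simp add: horoboundary_def)
  qed
  then show ?thesis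
    using c cocycle_act_horocompactification[OF g, of c] by (auto simp: horoboundary_def)
qed

lemma countable_carrier: "countable (carrier G)"
proof -
  fix p :: 'a
  have "carrier G \<subseteq> (\<Union>n. {g \<in> carrier G. dist p (\<phi> g p) \<le> real n})"
  proof
    fix g assume "g \<in> carrier G"
    moreover obtain n where "dist p (\<phi> g p) \<le> real n"
      using real_arch_simple by blast
    ultimately show "g \<in> (\<Union>n. {g \<in> carrier G. dist p (\<phi> g p) \<le> real n})"
      by blast
  qed
  moreover have "countable (\<Union>n. {g \<in> carrier G. dist p (\<phi> g p) \<le> real n})"
    by (rule countable_UN) (auto intro: countable_finite finite_dist_act_le)
  ultimately show ?thesis
    by (rule countable_subset)
qed

lemma radial_limit_set_at_mono:
  "r \<le> r' \<Longrightarrow> radial_limit_set_at G \<phi> p x r \<subseteq> radial_limit_set_at G \<phi> p x r'"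
  unfolding radial_limit_set_at_def by (blast intro: shadow_mono)

lemma cocycle_act_radial_limit_set_at:
  assumes g: "g \<in> carrier G" and c: "c \<in> radial_limit_set_at G \<phi> p p r"
    and r': "r + dist p (\<phi> g p) \<le> r'"
  shows "cocycle_act G \<phi> g c \<in> radial_limit_set_at G \<phi> p p r'"
  unfolding radial_limit_set_at_def
proof (intro CollectI conjI allI impI)
  have cb: "c \<in> horoboundary" using c by (simp add: radial_limit_set_at_def)
  show "cocycle_act G \<phi> g c \<in> horoboundary"
    by (rule cocycle_act_horoboundary[OF g cb])
  fix T :: real assume "0 \<le> T"
  then have "0 \<le> T + dist p (\<phi> g p)" by simp
  then obtain h where h: "h \<in> carrier G" "T + dist p (\<phi> g p) \<le> dist p (\<phi> h p)" "c \<in> shadow p (\<phi> h p) r"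
    using c unfolding radial_limit_set_at_def by blast
  have "cocycle_act G \<phi> g c \<in> shadow (\<phi> g p) (\<phi> g (\<phi> h p)) r"
    using h(3) g cb by (subst cocycle_act_in_shadow_iff) (auto simp: horoboundary_def)
  then have "cocycle_act G \<phi> g c \<in> shadow p (\<phi> (g \<otimes> h) p) r'"
    using r' g h(1) by (simp add: act_mult dist_commute shadow_change)
  moreover have "T \<le> dist p (\<phi> (g \<otimes> h) p)"
    using h(2) dist_triangle3[of "\<phi> g p" "\<phi> g (\<phi> h p)" p] g h(1) by (simp add: act_mult)
  ultimately show "\<exists>k\<in>carrier G. T \<le> dist p (\<phi> k p) \<and> cocycle_act G \<phi> g c \<in> shadow p (\<phi> k p) r'"
    using g h(1) by (intro bexI[of _ "g \<otimes> h"]) auto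
qed

text \<open>Translating by \<open>g\<close> can be absorbed by enlarging the radius by
  \<open>dist p (\<phi> g p)\<close>. This form is a countable union, which gives
  measurability.\<close>

lemma radial_limit_set_eq:
  "radial_limit_set G \<phi> p = (\<Union>n::nat. radial_limit_set_at G \<phi> p p (real n))"
proof
  show "radial_limit_set G \<phi> p \<subseteq> (\<Union>n::nat. radial_limit_set_at G \<phi> p p (real n))"
  proof
    fix c assume "c \<in> radial_limit_set G \<phi> p"
    then obtain r g c' where "g \<in> carrier G" "c' \<in> radial_limit_set_at G \<phi> p p r" "c = cocycle_act G \<phi> g c'"
      unfolding radial_limit_set_def by blast
    moreover obtain n :: nat where "r + dist p (\<phi> g p) \<le> real n"
      using real_arch_simple by blast
    ultimately show "c \<in> (\<Union>n::nat. radial_limit_set_at G \<phi> p p (real n))"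
      using cocycle_act_radial_limit_set_at by blast
  qed
  show "(\<Union>n::nat. radial_limit_set_at G \<phi> p p (real n)) \<subseteq> radial_limit_set G \<phi> p"
  proof
    fix c assume "c \<in> (\<Union>n::nat. radial_limit_set_at G \<phi> p p (real n))"
    then obtain n :: nat where "c \<in> radial_limit_set_at G \<phi> p p (real n)" by blast
    then have "c \<in> cocycle_act G \<phi> \<one> ` radial_limit_set_at G \<phi> p p (real n)"
      by (metis cocycle_act_one imageI)
    then show "c \<in> radial_limit_set G \<phi> p"
      unfolding radial_limit_set_def by (intro UN_I[of "real n"] UN_I[of \<one>]) auto
  qed
qed

lemma radial_limit_set_subset: "radial_limit_set G \<phi> p \<subseteq> horoboundary"
  unfolding radial_limit_set_eq by (auto simp: radial_limit_set_at_def)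

lemma radial_limit_set_at_sets: "radial_limit_set_at G \<phi> p x r \<in> sets horoborel"
proof -
  have "radial_limit_set_at G \<phi> p x r =
      horoboundary \<inter> (\<Inter>n::nat. \<Union>g\<in>{g \<in> carrier G. real n \<le> dist x (\<phi> g p)}. shadow x (\<phi> g p) r)"
    (is "_ = ?R")
  proof
    show "radial_limit_set_at G \<phi> p x r \<subseteq> ?R"
    proof
      fix c assume c: "c \<in> radial_limit_set_at G \<phi> p x r"
      have "c \<in> (\<Union>g\<in>{g \<in> carrier G. real n \<le> dist x (\<phi> g p)}. shadow x (\<phi> g p) r)" for n
      proof -
        have "\<exists>g\<in>carrier G. real n \<le> dist x (\<phi> g p) \<and> c \<in> shadow x (\<phi> g p) r"
          using c by (simp add: radial_limit_set_at_def)
        then show ?thesis by blast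
      qed
      then show "c \<in> ?R"
        using c by (simp add: radial_limit_set_at_def)
    qed
    show "?R \<subseteq> radial_limit_set_at G \<phi> p x r"
    proof
      fix c assume c: "c \<in> ?R"
      have "\<exists>g\<in>carrier G. T \<le> dist x (\<phi> g p) \<and> c \<in> shadow x (\<phi> g p) r" for T
      proof -
        obtain n :: nat where n: "T \<le> real n"
          using real_arch_simple by blast
        have "c \<in> (\<Union>g\<in>{g \<in> carrier G. real n \<le> dist x (\<phi> g p)}. shadow x (\<phi> g p) r)"
          using c by blast
        then obtain g where "g \<in> carrier G" "real n \<le> dist x (\<phi> g p)" "c \<in> shadow x (\<phi> g p) r"
          by blast
        then show ?thesis
          using n by (intro bexI[of _ g]) auto
      qed
      then show "c \<in> radial_limit_set_at G \<phi> p x r"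
        using c by (simp add: radial_limit_set_at_def)
    qed
  qed
  also have "\<dots> \<in> sets horoborel"
  proof (intro sets.Int horoboundary_sets proper_space sets.countable_INT)
    have "(\<Union>g\<in>{g \<in> carrier G. real n \<le> dist x (\<phi> g p)}. shadow x (\<phi> g p) r) \<in> sets horoborel" for n
      by (intro sets.countable_UN' shadow_sets countable_subset[OF _ countable_carrier]) auto
    then show "range (\<lambda>n. \<Union>g\<in>{g \<in> carrier G. real n \<le> dist x (\<phi> g p)}. shadow x (\<phi> g p) r)
        \<subseteq> sets horoborel"
      by blast
  qed simp
  finally show ?thesis .
qed

lemma radial_limit_set_sets: "radial_limit_set G \<phi> p \<in> sets horoborel"
  unfolding radial_limit_set_eq by (intro sets.countable_UN) (auto intro: radial_limit_set_at_sets)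

lemma radial_limit_set_saturated: "saturated (radial_limit_set G \<phi> p)"
proof (rule saturatedI[OF radial_limit_set_subset])
  fix c c' M
  assume c: "c \<in> radial_limit_set G \<phi> p" and c': "c' \<in> horoboundary"
    and M: "\<And>x z. \<bar>c x z - c' x z\<bar> \<le> M"
  obtain n :: nat where n: "c \<in> radial_limit_set_at G \<phi> p p (real n)"
    using c unfolding radial_limit_set_eq by blast
  obtain k :: nat where k: "real n + M \<le> real k"
    using real_arch_simple by blast
  have "0 \<le> M" using M[of p p] by linarith
  have "c' \<in> shadow p z (real k)" if "c \<in> shadow p z (real n)" for z
    using that c' M[of z p] k \<open>0 \<le> M\<close> by (auto simp: shadow_def horoboundary_def field_simps)
  then have "c' \<in> radial_limit_set_at G \<phi> p p (real k)"
    using n c' unfolding radial_limit_set_at_def by blast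
  then show "c' \<in> radial_limit_set G \<phi> p"
    unfolding radial_limit_set_eq by blast
qed

lemma cocycle_act_radial_limit_set:
  assumes g: "g \<in> carrier G" and c: "c \<in> radial_limit_set G \<phi> p"
  shows "cocycle_act G \<phi> g c \<in> radial_limit_set G \<phi> p"
proof -
  obtain n :: nat where n: "c \<in> radial_limit_set_at G \<phi> p p (real n)"
    using c unfolding radial_limit_set_eq by blast
  obtain k :: nat where "real n + dist p (\<phi> g p) \<le> real k"
    using real_arch_simple by blast
  from cocycle_act_radial_limit_set_at[OF g n this] show ?thesis
    unfolding radial_limit_set_eq by blast
qed

lemma cocycle_act_radial_limit_set_iff:
  assumes g: "g \<in> carrier G"
  shows "cocycle_act G \<phi> g c \<in> radial_limit_set G \<phi> p \<longleftrightarrow> c \<in> radial_limit_set G \<phi> p"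
  using cocycle_act_radial_limit_set[OF g, of c] g
    cocycle_act_radial_limit_set[of "inv g" "cocycle_act G \<phi> g c"] by auto

text \<open>A point of the space lies in only finitely many shadows, so the cocycle is a boundary
  one; finiteness of balls makes infinitely many shadows arbitrarily distant.\<close>

lemma infinite_shadows_radial:
  assumes c: "c \<in> horocompactification" and inf: "infinite {g \<in> carrier G. c \<in> shadow p (\<phi> g p) r}"
  shows "c \<in> radial_limit_set G \<phi> p"
proof -
  have "c \<in> horoboundary"
  proof (rule ccontr)
    assume "c \<notin> horoboundary"
    then obtain z where z: "c = point_cocycle z"
      using c by (auto simp: horoboundary_def)
    have "{g \<in> carrier G. c \<in> shadow p (\<phi> g p) r} \<subseteq> {g \<in> carrier G. dist p (\<phi> g p) \<le> dist p z + 2 * r}"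
      using zero_le_dist by (auto simp: z point_cocycle_in_shadow_iff intro: order_trans[rotated])
    then show False
      using inf finite_dist_act_le finite_subset by blast
  qed
  moreover have "\<exists>g\<in>carrier G. T \<le> dist p (\<phi> g p) \<and> c \<in> shadow p (\<phi> g p) r" for T
  proof (rule ccontr)
    assume "\<not> ?thesis"
    then have "{g \<in> carrier G. c \<in> shadow p (\<phi> g p) r} \<subseteq> {g \<in> carrier G. dist p (\<phi> g p) \<le> T}"
      by auto
    then show False
      using inf finite_dist_act_le finite_subset by blast
  qed
  ultimately have "c \<in> radial_limit_set_at G \<phi> p p r"
    by (simp add: radial_limit_set_at_def)
  moreover obtain n :: nat where "r \<le> real n"
    using real_arch_simple by blast
  ultimately show ?thesis
    unfolding radial_limit_set_eq using radial_limit_set_at_mono by blast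
qed

text \<open>Partial sums of the Poincare series by radius: finite real sums, whose unboundedness in
  \<open>t\<close> expresses divergence.\<close>

definition orbit_sum :: "'a \<Rightarrow> real \<Rightarrow> real \<Rightarrow> real" where
  "orbit_sum p s t = (\<Sum>g | g \<in> carrier G \<and> dist p (\<phi> g p) \<le> t. exp (- s * dist p (\<phi> g p)))"

lemma orbit_sum_mono: "t \<le> t' \<Longrightarrow> orbit_sum p s t \<le> orbit_sum p s t'"
  unfolding orbit_sum_def by (intro sum_mono2 finite_dist_act_le) auto

lemma orbit_sum_add:
  assumes "t \<le> t'"
  shows "orbit_sum p s t' = orbit_sum p s t +
    (\<Sum>g | g \<in> carrier G \<and> t < dist p (\<phi> g p) \<and> dist p (\<phi> g p) \<le> t'. exp (- s * dist p (\<phi> g p)))"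
proof -
  have eq: "{g \<in> carrier G. dist p (\<phi> g p) \<le> t'} = {g \<in> carrier G. dist p (\<phi> g p) \<le> t}
      \<union> {g \<in> carrier G. t < dist p (\<phi> g p) \<and> dist p (\<phi> g p) \<le> t'}"
    using assms by auto
  have "finite {g \<in> carrier G. t < dist p (\<phi> g p) \<and> dist p (\<phi> g p) \<le> t'}"
    by (rule finite_subset[OF _ finite_dist_act_le[of p p t']]) auto
  then show ?thesis
    unfolding orbit_sum_def eq by (intro sum.union_disjoint finite_dist_act_le) auto
qed

lemma poincare_series_infinite_iff:
  "poincare_series G \<phi> p s = \<infinity> \<longleftrightarrow> (\<forall>b. \<exists>t. b < orbit_sum p s t)"
proof -
  define f where "f = (\<lambda>g. exp (- s * dist p (\<phi> g p)))"
  have "poincare_series G \<phi> p s = (SUP F\<in>{F. finite F \<and> F \<subseteq> carrier G}. ennreal (sum f F))"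
    unfolding poincare_series_def f_def
    by (subst nonneg_infsum_complete) (auto intro!: SUP_cong simp: sum_ennreal)
  also have "\<dots> = \<infinity> \<longleftrightarrow> (\<forall>b. \<exists>t. b < orbit_sum p s t)" (is "?S = \<infinity> \<longleftrightarrow> _")
  proof
    assume inf: "?S = \<infinity>"
    show "\<forall>b. \<exists>t. b < orbit_sum p s t"
    proof (rule ccontr)
      assume "\<not> ?thesis"
      then obtain b where b: "\<And>t. orbit_sum p s t \<le> b"
        by (auto simp: not_less)
      have "?S \<le> ennreal b"
      proof (rule SUP_least)
        fix F assume "F \<in> {F. finite F \<and> F \<subseteq> carrier G}"
        then have F: "finite F" "F \<subseteq> carrier G" by auto
        \<comment> \<open>Any bound on the displacements of the elements of \<open>F\<close> would
          do; their sum avoids a maximum over a possibly empty set.\<close>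
        define t where "t = (\<Sum>g\<in>F. dist p (\<phi> g p))"
        have "sum f F \<le> orbit_sum p s t"
          unfolding orbit_sum_def f_def t_def using F
          by (intro sum_mono2 finite_dist_act_le) (auto intro: member_le_sum)
        then show "ennreal (sum f F) \<le> ennreal b"
          using b[of t] by (intro ennreal_leI) simp
      qed
      then show False using inf by (simp add: top_unique)
    qed
  next
    assume unb: "\<forall>b. \<exists>t. b < orbit_sum p s t"
    have "ennreal b \<le> ?S" for b
    proof -
      obtain t where "b < orbit_sum p s t" using unb by blast
      then have "ennreal b \<le> ennreal (sum f {g \<in> carrier G. dist p (\<phi> g p) \<le> t})"
        unfolding orbit_sum_def f_def by (intro ennreal_leI) simp
      also have "\<dots> \<le> ?S"
        by (intro SUP_upper) (auto intro: finite_dist_act_le)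
      finally show ?thesis .
    qed
    then have "of_nat n \<le> ?S" for n
      by (metis ennreal_of_nat_eq_real_of_nat)
    then show "?S = \<infinity>"
      by (metis ennreal_Ex_less_of_nat infinity_ennreal_def leD top.not_eq_extremum)
  qed
  finally show ?thesis .
qed

lemma orbit_count_pos: "0 \<le> l \<Longrightarrow> 0 < card {g \<in> carrier G. dist p (\<phi> g p) \<le> l}"
  by (subst card_gt_0_iff) (auto intro: finite_dist_act_le exI[of _ \<one>])

text \<open>Bounded annuli give linear growth of the orbit sums, so the orbit count is at most a
  linear factor times \<open>exp (s * l)\<close>; the linear factor disappears in the exponential
  growth rate.\<close>

lemma critical_exponent_le:
  assumes K: "\<And>t. (\<Sum>g | g \<in> carrier G \<and> t < dist p (\<phi> g p) \<and> dist p (\<phi> g p) \<le> t + 1.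
      exp (- s * dist p (\<phi> g p))) \<le> K" and s: "0 \<le> s"
  shows "critical_exponent G \<phi> p \<le> ereal s"
proof -
  define C where "C = max K 1"
  have sum_le: "orbit_sum p s (real n) \<le> (real n + 1) * C" for n
  proof (induction n)
    case 0
    \<comment> \<open>Starting at -1 lets the annulus bound include the elements fixing
      \<open>p\<close>.\<close>
    have "orbit_sum p s (-1) = 0"
      unfolding orbit_sum_def by (intro sum.neutral) (auto dest: order_trans[OF zero_le_dist])
    then show ?case
      using orbit_sum_add[of "-1" 0 p s] K[of "-1"] by (simp add: C_def)
  next
    case (Suc n)
    then show ?case
      using orbit_sum_add[of "real n" "real n + 1" p s] K[of "real n"] by (simp add: C_def algebra_simps)
  qed
  have count: "ln (card {g \<in> carrier G. dist p (\<phi> g p) \<le> l}) / l \<le> s + ln ((l + 2) * C) / l"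
    if l: "0 < l" for l
  proof -
    let ?X = "{g \<in> carrier G. dist p (\<phi> g p) \<le> l}"
    have "card ?X * exp (- s * l) \<le> orbit_sum p s l"
      unfolding orbit_sum_def using s by (intro sum_bounded_below) (auto intro: mult_left_mono)
    also have "\<dots> \<le> orbit_sum p s (real (nat \<lceil>l\<rceil>))"
      by (intro orbit_sum_mono) linarith
    also have "\<dots> \<le> (real (nat \<lceil>l\<rceil>) + 1) * C"
      by (rule sum_le)
    also have "\<dots> \<le> (l + 2) * C"
      using l by (intro mult_right_mono) (auto simp: C_def, linarith)
    finally have "card ?X \<le> (l + 2) * C * exp (s * l)"
      by (simp add: exp_minus field_simps)
    then have "ln (card ?X) \<le> ln ((l + 2) * C * exp (s * l))"
      using orbit_count_pos[of l p] l by (subst ln_le_cancel_iff) (auto simp: C_def)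
    also have "\<dots> = ln ((l + 2) * C) + s * l"
      using l by (subst ln_mult) (auto simp: C_def)
    finally show ?thesis
      using l by (simp add: field_simps)
  qed
  have "C > 0" by (simp add: C_def)
  then have "((\<lambda>l. s + ln ((l + 2) * C) / l) \<longlongrightarrow> s) at_top"
    by real_asymp
  then have lim: "((\<lambda>l. ereal (s + ln ((l + 2) * C) / l)) \<longlongrightarrow> ereal s) at_top"
    by simp
  have "critical_exponent G \<phi> p \<le> Limsup at_top (\<lambda>l. ereal (s + ln ((l + 2) * C) / l))"
    unfolding critical_exponent_def
    by (intro Limsup_mono eventually_mono[OF eventually_gt_at_top[of 0]]) (use count in simp)
  also have "\<dots> = ereal s"
    by (rule lim_imp_Limsup[OF _ lim]) simp
  finally show ?thesis .
qed

text \<open>With an \<open>s'\<close> strictly between the exponent and \<open>s\<close>, annulus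
  sums are eventually dominated by a geometric series of ratio \<open>exp (s' - s)\<close>, so the
  orbit sums would be bounded.\<close>

lemma critical_exponent_ge:
  assumes unb: "\<And>b. \<exists>t. b < orbit_sum p s t" and s: "0 \<le> s"
  shows "ereal s \<le> critical_exponent G \<phi> p"
proof (rule ccontr)
  assume "\<not> ?thesis"
  then have "critical_exponent G \<phi> p < ereal s" by simp
  from ereal_dense2[OF this] obtain s' where s': "critical_exponent G \<phi> p < ereal s'" "s' < s"
    by auto
  have "\<forall>\<^sub>F l in at_top. ereal (1 / l * ln (real (card {g \<in> carrier G. dist p (\<phi> g p) \<le> l}))) < ereal s'"
    using s'(1) unfolding critical_exponent_def by (rule Limsup_lessD)
  then obtain l0 where l0: "\<And>l. l0 \<le> l \<Longrightarrow> 1 / l * ln (real (card {g \<in> carrier G. dist p (\<phi> g p) \<le> l})) < s'"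
    unfolding eventually_at_top_linorder by auto
  define k where "k = nat \<lceil>l0\<rceil>"
  define q where "q = exp (s' - s)"
  have q: "0 < q" "q < 1" using s'(2) by (auto simp: q_def)
  have count: "card {g \<in> carrier G. dist p (\<phi> g p) \<le> l} \<le> exp (s' * l)" if "l0 \<le> l" "0 < l" for l
  proof -
    have "ln (card {g \<in> carrier G. dist p (\<phi> g p) \<le> l}) \<le> s' * l"
      using l0[OF that(1)] that(2) by (simp add: field_simps)
    then have "exp (ln (card {g \<in> carrier G. dist p (\<phi> g p) \<le> l})) \<le> exp (s' * l)"
      by (subst exp_le_cancel_iff)
    then show ?thesis
      using orbit_count_pos[of l p] that(2) by simp
  qed
  have annulus: "(\<Sum>g | g \<in> carrier G \<and> real n < dist p (\<phi> g p) \<and> dist p (\<phi> g p) \<le> real n + 1.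
      exp (- s * dist p (\<phi> g p))) \<le> exp s' * q ^ n" (is "sum _ ?X \<le> _") if n: "k \<le> n" for n
  proof -
    have "sum (\<lambda>g. exp (- s * dist p (\<phi> g p))) ?X \<le> card ?X * exp (- s * real n)"
      using s by (intro sum_bounded_above) (auto intro: mult_left_mono)
    also have "\<dots> \<le> card {g \<in> carrier G. dist p (\<phi> g p) \<le> real n + 1} * exp (- s * real n)"
      by (intro mult_right_mono of_nat_mono card_mono finite_dist_act_le) auto
    also have "\<dots> \<le> exp (s' * (real n + 1)) * exp (- s * real n)"
    proof (intro mult_right_mono count)
      show "l0 \<le> real n + 1"
        using n unfolding k_def by linarith
    qed auto
    also have "\<dots> = exp s' * q ^ n"
      by (simp add: q_def algebra_simps flip: exp_add exp_of_nat_mult)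
    finally show ?thesis .
  qed
  define b where "b = orbit_sum p s (real k) + exp s' * (1 / (1 - q))"
  have partial: "orbit_sum p s (real (k + m)) \<le> orbit_sum p s (real k) + exp s' * (\<Sum>j<m. q ^ j)" for m
  proof (induction m)
    case (Suc m)
    have "exp s' * q ^ (k + m) \<le> exp s' * q ^ m"
      using q by (intro mult_left_mono power_decreasing) auto
    then have "orbit_sum p s (real (k + m) + 1) \<le> orbit_sum p s (real (k + m)) + exp s' * q ^ m"
      using annulus[of "k + m"] orbit_sum_add[of "real (k + m)" "real (k + m) + 1" p s] by linarith
    also have "\<dots> \<le> orbit_sum p s (real k) + exp s' * (\<Sum>j<Suc m. q ^ j)"
      using Suc by (simp add: algebra_simps)
    finally show ?case
      by (simp add: add.commute)
  qed simp
  have "orbit_sum p s t \<le> b" for t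
  proof -
    obtain m where m: "t \<le> real m"
      using real_arch_simple by blast
    have "orbit_sum p s t \<le> orbit_sum p s (real (k + m))"
      using m by (intro orbit_sum_mono) simp
    also have "\<dots> \<le> orbit_sum p s (real k) + exp s' * (\<Sum>j<m. q ^ j)"
      by (rule partial)
    also have "(\<Sum>j<m. q ^ j) \<le> (\<Sum>j. q ^ j)"
      using q by (intro sum_le_suminf summable_geometric) auto
    also have "(\<Sum>j. q ^ j) = 1 / (1 - q)"
      using q by (intro suminf_geometric) auto
    finally show ?thesis
      unfolding b_def by simp
  qed
  then show False
    using unb[of b] by (auto simp: not_less[symmetric])
qed

end

section \<open>The radial limit set of a divergent action\<close>

context conformal_action
begin

lemma critical_exponent_le_\<omega>: "critical_exponent G \<phi> p \<le> ereal \<omega>"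
proof -
  obtain r \<epsilon> C K S U where
    "shadow_family G (\<nu> p) (\<lambda>g. dist p (\<phi> g p)) \<omega> \<epsilon> C K (\<lambda>g. shadow p (\<phi> g p) r) S U"
    by (rule shadow_family) (rule that; assumption)
  then interpret shadow_family G "\<nu> p" "\<lambda>g. dist p (\<phi> g p)" \<omega> \<epsilon> C K "\<lambda>g. shadow p (\<phi> g p) r" S U .
  obtain K0 where "\<And>t. sum weight {g \<in> carrier G. t < dist p (\<phi> g p) \<and> dist p (\<phi> g p) \<le> t + 1} \<le> K0"
    by (rule annulus_bound[OF zero_le_one]) (rule that; assumption)
  then show ?thesis
    unfolding weight_def by (intro critical_exponent_le[where K = K0] \<omega>_nonneg)
qed

lemma radial_limit_set_positive:
  assumes "\<And>b. \<exists>t. b < orbit_sum p \<omega> t"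
  shows "0 < measure (\<nu> p) (radial_limit_set G \<phi> p)"
proof -
  obtain r \<epsilon> C K S U where
    "shadow_family G (\<nu> p) (\<lambda>g. dist p (\<phi> g p)) \<omega> \<epsilon> C K (\<lambda>g. shadow p (\<phi> g p) r) S U"
    by (rule shadow_family) (rule that; assumption)
  then interpret shadow_family G "\<nu> p" "\<lambda>g. dist p (\<phi> g p)" \<omega> \<epsilon> C K "\<lambda>g. shadow p (\<phi> g p) r" S U .
  show ?thesis
  proof (rule limsup_positive)
    show "\<exists>t. b < sum weight {g \<in> carrier G. dist p (\<phi> g p) \<le> t}" for b
      using assms[of b] by (simp add: orbit_sum_def weight_def)
    show "radial_limit_set G \<phi> p \<in> sets (\<nu> p)"
      by (simp add: sets_\<nu> radial_limit_set_sets)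
    fix c assume c: "c \<in> space (\<nu> p)" "infinite {g \<in> S. c \<in> shadow p (\<phi> g p) r}"
    have "{g \<in> S. c \<in> shadow p (\<phi> g p) r} \<subseteq> {g \<in> carrier G. c \<in> shadow p (\<phi> g p) r}"
      using S by auto
    then have "infinite {g \<in> carrier G. c \<in> shadow p (\<phi> g p) r}"
      using c(2) by (rule infinite_super)
    then show "c \<in> radial_limit_set G \<phi> p"
      using c(1) by (intro infinite_shadows_radial) auto
  qed
qed

text \<open>Borel-Cantelli for the unions of shadows over unit annuli, whose measures are summable
  by the upper shadow bound.\<close>

lemma radial_limit_set_at_null:
  assumes b: "\<And>t. orbit_sum p \<omega> t \<le> b"
  shows "measure (\<nu> p) (radial_limit_set_at G \<phi> p p r) = 0"
proof -
  define X where "X = (\<lambda>n::nat. {g \<in> carrier G. real n < dist p (\<phi> g p) \<and> dist p (\<phi> g p) \<le> real n + 1})"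
  define E where "E = (\<lambda>n. \<Union>g\<in>X n. shadow p (\<phi> g p) r)"
  define a where "a = (\<lambda>n. \<Sum>g\<in>X n. exp (- \<omega> * dist p (\<phi> g p)))"
  define C where "C = mass * exp (\<omega> * (2 * r))"
  have finX: "finite (X n)" for n
    by (rule finite_subset[OF _ finite_dist_act_le[of p p "real n + 1"]]) (auto simp: X_def)
  have E: "E n \<in> sets (\<nu> p)" for n
    unfolding E_def sets_\<nu> using finX by (intro sets.finite_UN shadow_sets) auto
  have "summable a"
  proof (rule summableI_nonneg_bounded)
    show "0 \<le> a n" for n unfolding a_def by (intro sum_nonneg) auto
    have "orbit_sum p \<omega> (real n) = orbit_sum p \<omega> 0 + (\<Sum>i<n. a i)" for n
    proof (induction n)
      case (Suc n)
      then show ?case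
        using orbit_sum_add[of "real n" "real n + 1" p \<omega>] by (simp add: a_def X_def add.commute)
    qed simp
    moreover have "0 \<le> orbit_sum p \<omega> 0"
      unfolding orbit_sum_def by (intro sum_nonneg) auto
    ultimately show "(\<Sum>i<n. a i) \<le> b" for n
      using b[of "real n"] by (metis add_increasing2 add_le_cancel_left add.commute order_trans order_refl)
  qed
  have E_le: "measure (\<nu> p) (E n) \<le> C * a n" for n
  proof -
    have "measure (\<nu> p) (E n) \<le> (\<Sum>g\<in>X n. measure (\<nu> p) (shadow p (\<phi> g p) r))"
      unfolding E_def using finX by (intro measure_UNION_le) (auto simp: sets_\<nu> shadow_sets)
    also have "\<dots> \<le> C * a n"
      unfolding a_def C_def sum_distrib_left by (intro sum_mono shadow_upper_bound) (auto simp: X_def)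
    finally show ?thesis .
  qed
  have "summable (\<lambda>n. measure (\<nu> p) (E n))"
  proof (rule summable_comparison_test')
    show "summable (\<lambda>n. C * a n)"
      using \<open>summable a\<close> by (rule summable_mult)
    show "norm (measure (\<nu> p) (E n)) \<le> C * a n" if "0 \<le> n" for n
      using E_le[of n] by simp
  qed
  then have "limsup E \<in> null_sets (\<nu> p)"
    using E by (intro borel_cantelli_limsup1) (auto simp: \<nu>.emeasure_eq_measure)
  moreover have "radial_limit_set_at G \<phi> p p r \<subseteq> limsup E"
  proof
    fix c assume c: "c \<in> radial_limit_set_at G \<phi> p p r"
    have "\<exists>m\<ge>n. c \<in> E m" for n
    proof -
      have "0 \<le> real n + 1" by simp
      then obtain g where g: "g \<in> carrier G" "real n + 1 \<le> dist p (\<phi> g p)" "c \<in> shadow p (\<phi> g p) r"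
        using c unfolding radial_limit_set_at_def by blast
      \<comment> \<open>The annuli are open on the left, hence the ceiling minus one; asking for
        distance at least \<open>n + 1\<close> ensures \<open>m \<ge> n\<close>.\<close>
      define m where "m = nat (\<lceil>dist p (\<phi> g p)\<rceil> - 1)"
      have "n \<le> m" and m: "real m < dist p (\<phi> g p)" "dist p (\<phi> g p) \<le> real m + 1"
        using g(2) unfolding m_def by linarith+
      have "g \<in> X m"
        using g(1) m by (simp add: X_def)
      then have "c \<in> E m"
        unfolding E_def using g(3) by (rule UN_I)
      with \<open>n \<le> m\<close> show ?thesis by blast
    qed
    then show "c \<in> limsup E"
      by (auto simp: limsup_INF_SUP)
  qed
  ultimately have "measure (\<nu> p) (radial_limit_set_at G \<phi> p p r) \<le> measure (\<nu> p) (limsup E)"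
    by (intro \<nu>.finite_measure_mono) auto
  then show ?thesis
    using \<open>limsup E \<in> null_sets (\<nu> p)\<close> measure_nonneg[of "\<nu> p" "radial_limit_set_at G \<phi> p p r"]
    by (simp add: measure_eq_0_null_sets)
qed

text \<open>The right-hand side does not mention \<open>\<nu>\<close>, which allows positivity to be
  transferred from one density to another.\<close>

lemma radial_limit_set_positive_iff:
  "0 < measure (\<nu> p) (radial_limit_set G \<phi> p) \<longleftrightarrow> (\<forall>b. \<exists>t. b < orbit_sum p \<omega> t)"
proof
  assume pos: "0 < measure (\<nu> p) (radial_limit_set G \<phi> p)"
  show "\<forall>b. \<exists>t. b < orbit_sum p \<omega> t"
  proof (rule ccontr)
    assume "\<not> ?thesis"
    then obtain b where b: "\<And>t. orbit_sum p \<omega> t \<le> b"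
      by (auto simp: not_less)
    have "radial_limit_set_at G \<phi> p p (real n) \<in> null_sets (\<nu> p)" for n
      using radial_limit_set_at_null[OF b] radial_limit_set_at_sets
      by (auto simp: null_sets_def \<nu>.emeasure_eq_measure sets_\<nu>)
    then have "radial_limit_set G \<phi> p \<in> null_sets (\<nu> p)"
      unfolding radial_limit_set_eq by (intro null_sets_UN)
    then show False
      using pos by (simp add: measure_eq_0_null_sets)
  qed
qed (use radial_limit_set_positive in blast)

text \<open>Unbounded orbit sums give one inequality between \<omega> and the critical exponent; the
  existence of the density gives the other.\<close>

lemma divergent_iff:
  "divergent_action G \<phi> p \<and> ereal \<omega> = critical_exponent G \<phi> p \<longleftrightarrow> (\<forall>b. \<exists>t. b < orbit_sum p \<omega> t)"
proof
  assume "divergent_action G \<phi> p \<and> ereal \<omega> = critical_exponent G \<phi> p"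
  then have "poincare_series G \<phi> p \<omega> = \<infinity>"
    unfolding divergent_action_def by (metis ereal.inject)
  then show "\<forall>b. \<exists>t. b < orbit_sum p \<omega> t"
    by (rule poincare_series_infinite_iff[THEN iffD1])
next
  assume unb: "\<forall>b. \<exists>t. b < orbit_sum p \<omega> t"
  then have "poincare_series G \<phi> p \<omega> = \<infinity>"
    by (rule poincare_series_infinite_iff[THEN iffD2])
  moreover have "critical_exponent G \<phi> p = ereal \<omega>"
  proof (rule antisym[OF critical_exponent_le_\<omega>])
    show "ereal \<omega> \<le> critical_exponent G \<phi> p"
      by (rule critical_exponent_ge[OF _ \<omega>_nonneg]) (use unb in blast)
  qed
  ultimately show "divergent_action G \<phi> p \<and> ereal \<omega> = critical_exponent G \<phi> p"
    unfolding divergent_action_def by simp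
qed

lemma radial_limit_set_full:
  assumes pos: "0 < measure (\<nu> p) (radial_limit_set G \<phi> p)"
  shows "measure (\<nu> p) (radial_limit_set G \<phi> p) = mass"
proof (rule ccontr)
  assume ne: "measure (\<nu> p) (radial_limit_set G \<phi> p) \<noteq> mass"
  define \<Lambda> where "\<Lambda> = radial_limit_set G \<phi> p"
  define B where "B = horocompactification - \<Lambda>"
  have \<Lambda>: "\<Lambda> \<in> sets horoborel" "\<Lambda> \<subseteq> horocompactification"
    using radial_limit_set_sets radial_limit_set_subset by (auto simp: \<Lambda>_def horoboundary_def)
  have B: "B \<in> sets horoborel"
    using sets.compl_sets[OF \<Lambda>(1)] by (simp add: B_def)
  \<comment> \<open>\<open>B\<close> contains the points of the space as well as the non-radial
    boundary. Its invariance makes \<open>\<nu>'\<close> invariant, and restricting to a set leaves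
    the conformal factor unchanged.\<close>
  define \<nu>' where "\<nu>' = (\<lambda>x. density (\<nu> x) (indicator B))"
  have hX: "horocompactification \<in> sets (horoborel :: 'a cocycle measure)"
    using sets.top[of "horoborel :: 'a cocycle measure"] by simp
  have em: "emeasure (\<nu>' x) A = emeasure (\<nu> x) (B \<inter> A)" if "A \<in> sets horoborel" for x A
    unfolding \<nu>'_def using that B by (intro emeasure_restricted) (auto simp: sets_\<nu>)
  have massB: "measure (\<nu> p) B = mass - measure (\<nu> p) \<Lambda>"
    using \<nu>.finite_measure_compl[of \<Lambda> p] \<Lambda> by (simp add: B_def mass_def sets_\<nu>)
  have "conformal_action G \<phi> g0 y \<alpha> p \<omega> \<nu>'"
  proof (intro conformal_action.intro contracting_axis_axioms conformal_action_axioms.intro)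
    show "sets (\<nu>' x) = sets horoborel" for x
      by (simp add: \<nu>'_def sets_\<nu>)
    show "finite_measure (\<nu>' x)" for x
    proof (rule finite_measureI)
      show "emeasure (\<nu>' x) (space (\<nu>' x)) \<noteq> \<infinity>"
        using em[OF hX, of x] by (simp add: \<nu>'_def \<nu>.emeasure_eq_measure)
    qed
    show "emeasure (\<nu>' x) A = (\<integral>\<^sup>+ c. ennreal (exp (- \<omega> * c x z)) * indicator A c \<partial>\<nu>' z)"
      if A: "A \<in> sets horoborel" for x z A
    proof -
      have [measurable]: "B \<in> sets (\<nu> z)" "A \<in> sets (\<nu> z)" "(\<lambda>c. c x z) \<in> borel_measurable (\<nu> z)"
        using A B measurable_eval[of x z] by (auto simp: sets_\<nu> cong: measurable_cong_sets)
      have "(\<integral>\<^sup>+ c. ennreal (exp (- \<omega> * c x z)) * indicator A c \<partial>\<nu>' z)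
          = (\<integral>\<^sup>+ c. indicator B c * (ennreal (exp (- \<omega> * c x z)) * indicator A c) \<partial>\<nu> z)"
        unfolding \<nu>'_def by (intro nn_integral_density) measurable
      also have "\<dots> = (\<integral>\<^sup>+ c. ennreal (exp (- \<omega> * c x z)) * indicator (B \<inter> A) c \<partial>\<nu> z)"
        by (intro nn_integral_cong) (simp split: split_indicator)
      also have "\<dots> = emeasure (\<nu> x) (B \<inter> A)"
        using A B by (intro conformal[symmetric]) auto
      finally show ?thesis using em[OF A] by simp
    qed
    show "emeasure (\<nu>' (\<phi> g x)) A = emeasure (\<nu>' x) (cocycle_act G \<phi> g -` A \<inter> horocompactification)"
      if g: "g \<in> carrier G" and A: "A \<in> sets horoborel" for g x A
    proof -
      have "emeasure (\<nu>' (\<phi> g x)) A = emeasure (\<nu> x) (cocycle_act G \<phi> g -` (B \<inter> A) \<inter> horocompactification)"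
        using A B by (simp add: em invariant[OF g])
      also have "cocycle_act G \<phi> g -` (B \<inter> A) \<inter> horocompactification
          = B \<inter> (cocycle_act G \<phi> g -` A \<inter> horocompactification)"
        using cocycle_act_radial_limit_set_iff[OF g] cocycle_act_horocompactification[OF g]
        by (auto simp: B_def \<Lambda>_def)
      finally show ?thesis
        using em[OF cocycle_act_vimage_sets[OF g A]] by simp
    qed
    have "B \<inter> horocompactification = B"
      by (auto simp: B_def)
    moreover have "measure (\<nu> p) B \<noteq> 0"
      using massB ne by (simp add: \<Lambda>_def)
    ultimately show "emeasure (\<nu>' p) horocompactification \<noteq> 0"
      using em[OF hX, of p] by (simp add: \<nu>.emeasure_eq_measure measure_le_0_iff)
  qed (use not_virtually_cyclic \<omega>_nonneg in auto)
  then interpret \<nu>': conformal_action G \<phi> g0 y \<alpha> p \<omega> \<nu>' .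
  \<comment> \<open>Both densities are tested against the same orbit sums.\<close>
  have "0 < measure (\<nu>' p) \<Lambda>"
    using pos radial_limit_set_positive_iff \<nu>'.radial_limit_set_positive_iff by (simp add: \<Lambda>_def)
  moreover have "B \<inter> \<Lambda> = {}"
    by (auto simp: B_def)
  then have "emeasure (\<nu>' p) \<Lambda> = 0"
    using em[OF \<Lambda>(1), of p] by simp
  ultimately show False
    by (simp add: measure_def)
qed

end

theorem theorem1p4:
  fixes G :: "('g, 'm) monoid_scheme"
    and \<phi> :: "'g \<Rightarrow> 'a::metric_space \<Rightarrow> 'a"
    and p :: 'a
    and \<omega> :: real
    and \<nu> \<mu> :: "'a \<Rightarrow> 'a cocycle measure"
  assumes "proper_space TYPE('a)"
    and "geodesic_space TYPE('a)"
    and "isometric_action G \<phi>"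
    and "proper_action G \<phi>"
    and "\<exists>g. contracting_element G \<phi> g"
    and "\<not> virtually_cyclic G"
    and "\<omega> \<ge> 0"
    and "density_family p \<nu>"
    and "invariant_density G \<phi> \<nu>"
    and "conformal_density \<omega> \<nu>"
    and "\<And>x. \<mu> x = reduced_restriction (\<nu> x)"
  shows "(divergent_action G \<phi> p \<and> ereal \<omega> = critical_exponent G \<phi> p
            \<longleftrightarrow> emeasure (\<mu> p) (radial_limit_set G \<phi> p) > 0) \<and>
         (emeasure (\<mu> p) (radial_limit_set G \<phi> p) > 0
            \<longleftrightarrow> emeasure (\<mu> p) (radial_limit_set G \<phi> p) = 1)"
proof -
  interpret proper_isometric_action G \<phi>
    using assms(1-4) by unfold_locales
  obtain g0 y \<alpha> where "g0 \<in> carrier G" "qi_embedding_int (\<lambda>n::int. \<phi> (g0 [^]\<^bsub>G\<^esub> n) y)"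
    "closed (range (\<lambda>n::int. \<phi> (g0 [^]\<^bsub>G\<^esub> n) y))"
    "alpha_contracting \<alpha> (range (\<lambda>n::int. \<phi> (g0 [^]\<^bsub>G\<^esub> n) y))" "\<alpha> > 0"
    using assms(5) unfolding contracting_element_def contracting_set_def by blast
  then interpret contracting_axis G \<phi> g0 y \<alpha>
    by unfold_locales
  have sets: "sets (\<nu> x) = sets horoborel" and finite: "finite_measure (\<nu> x)"
    and ac: "absolutely_continuous (\<nu> z) (\<nu> x)" for x z
    using assms(8) by (auto simp: density_family_def)
  have sp: "space (\<nu> x) = horocompactification" for x
    using sets_eq_imp_space_eq[OF sets] by simp
  have total: "emeasure (\<nu> p) horocompactification = 1"
    using assms(8) by (simp add: density_family_def)
  interpret conformal_action G \<phi> g0 y \<alpha> p \<omega> \<nu>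
  proof (intro conformal_action.intro contracting_axis_axioms conformal_action_axioms.intro)
    show "emeasure (\<nu> x) A = (\<integral>\<^sup>+ c. ennreal (exp (- \<omega> * c x z)) * indicator A c \<partial>\<nu> z)"
      if A: "A \<in> sets horoborel" for x z A
    proof -
      interpret finite_measure "\<nu> z" by (rule finite)
      \<comment> \<open>The hypothesis only describes \<open>RN_deriv\<close>; absolute continuity
        makes it an actual density.\<close>
      have "emeasure (\<nu> x) A = emeasure (density (\<nu> z) (RN_deriv (\<nu> z) (\<nu> x))) A"
        using density_RN_deriv[OF ac[of z x]] by (simp add: sets)
      also have "\<dots> = (\<integral>\<^sup>+ c. RN_deriv (\<nu> z) (\<nu> x) c * indicator A c \<partial>\<nu> z)"
        using A by (intro emeasure_density) (auto simp: sets)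
      also have "\<dots> = (\<integral>\<^sup>+ c. ennreal (exp (- \<omega> * c x z)) * indicator A c \<partial>\<nu> z)"
      proof (rule nn_integral_cong_AE)
        have "AE c in \<nu> z. RN_deriv (\<nu> z) (\<nu> x) c = ennreal (exp (- \<omega> * c x z))"
          using assms(10) unfolding conformal_density_def by blast
        then show "AE c in \<nu> z. RN_deriv (\<nu> z) (\<nu> x) c * indicator A c
            = ennreal (exp (- \<omega> * c x z)) * indicator A c"
          by eventually_elim simp
      qed
      finally show ?thesis .
    qed
    show "emeasure (\<nu> (\<phi> g x)) A = emeasure (\<nu> x) (cocycle_act G \<phi> g -` A \<inter> horocompactification)"
      if g: "g \<in> carrier G" and A: "A \<in> sets horoborel" for g x A
    proof -
      have "\<nu> (\<phi> g x) = distr (\<nu> x) horoborel (cocycle_act G \<phi> g)"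
        using assms(9) g by (simp add: invariant_density_def)
      moreover have "cocycle_act G \<phi> g \<in> \<nu> x \<rightarrow>\<^sub>M horoborel"
        using measurable_cocycle_act[OF g] by (simp cong: measurable_cong_sets add: sets)
      ultimately show ?thesis
        using A by (simp add: emeasure_distr sp)
    qed
  qed (use assms(6,7) sets finite total in auto)
  have mass: "mass = 1"
    by (simp add: mass_def measure_def total)
  \<comment> \<open>The radial limit set is a saturated Borel subset of the boundary, so the reduced
    measure agrees with \<open>\<nu> p\<close> on it.\<close>
  have \<mu>: "emeasure (\<mu> p) (radial_limit_set G \<phi> p) = ennreal (measure (\<nu> p) (radial_limit_set G \<phi> p))"
    unfolding assms(11) \<nu>.emeasure_eq_measure[symmetric]
    by (intro emeasure_reduced_restriction assms(1) sets radial_limit_set_sets radial_limit_set_subset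
        radial_limit_set_saturated)
  show ?thesis
    unfolding \<mu> divergent_iff radial_limit_set_positive_iff[symmetric]
    using radial_limit_set_full by (auto simp: mass)
qed

end
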